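(* Consider the overlaid primary and secondary networks on the unit square operating under the primary and secondary protocols described in the context. The secondary network can achieve the following throughput per S-D pair $\lambda_s(m)$ and sum throughput $T_s(m)$ w.h.p.: $$\lambda_s(m)=\Theta\left(\sqrt{\frac{1}{m\log m}}\right)\quad\text{and}\quad T_s(m)=\Theta\left(\sqrt{\frac{m}{\log m}}\right).$$
   Context: W.h.p. means with probability tending to 1 as $n\to\infty$ (equivalently $m\to\infty$). $O,\Omega,\Theta$ have their usual asymptotic meaning; e.g. $\lambda_s(m)=\Theta(f(m))$ w.h.p. means there are deterministic constants $c_2>0$, $c_1<\infty$ with $p(c_2f(m)\le\lambda_s(m)\le c_1f(m))\to1$. $\log$ is the natural logarithm in the cell sizes. Network model. Primary nodes form a Poisson point process of density $n$ on the unit square and secondary nodes a Poisson point process of density $m=n^\beta$, $\beta>1$. Nodes of each network are randomly grouped into one-to-one source-destination (S-D) pairs. The channel power gain at distance $r$ is $g(r)=r^{-\alpha}$, $\alpha>2$, with noise power $N_0$ and unit bandwidth. An active transmitter (TX)/receiver (RX) pair at distance $d$ with transmit power $P$ has rate $\log\left(1+\frac{P g(d)}{N_0+I}\right)$, where $I$ is the total interference at the RX from all other active TXs of both networks (a TX of power $P'$ at distance $r$ contributes $P'g(r)$). Primary protocol. The unit square is divided into square primary cells of area $a_p=\frac{k_1\log n}{n}$, $k_1\ge1$, grouped into clusters of $25$ ($5\times5$) cells. Time is split into TDMA frames of 25 slots, each of length $t_p$; in each slot one cell per cluster is active, cells taking turns in round-robin fashion, with the same pattern in all clusters. The data path of an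 S-D pair is the horizontal line (HDP) followed by the vertical line (VDP) connecting source to destination. In each cell one node is the designated relay node (nodes take turns). When a cell is active, its slot is divided into packet slots, one for each data path passing through or originating from the cell: the relay transmits one packet for each path passing through the cell, then each source in the cell transmits one packet. Each packet goes to the relay node of the neighboring cell along the data path, or directly to the destination if that is the next hop (the destination may be in the same or a neighboring cell). Received packets are buffered and sent in the next active slot of the cell. TX power is $P_0a_p^{\alpha/2}$, $P_0$ constant. Secondary protocol. Same construction with square secondary cells of area $a_s=\frac{k_2\log m}{m}$, $k_2=k_1\ge1$, clusters of 25 cells, 25-slot TDMA, horizontal-then-vertical data paths, relay nodes, and TX power $P_1a_s^{\alpha/2}$, $P_1$ constant; one secondary TDMA frame has the duration $t_p$ of one primary slot. Around each primary cell containing an active primary TX there is a preservation region, a square of $M^2$ secondary cells, $M=\lfloor 3\sqrt{a_p/a_s}\rfloor+2$, in which no secondary node may transmit (but may receive). A relay node in a preservation region buffers packets until the region is cleared and its cell is active. Throughput. For a network with $n_t$ nodes, the throughput per S-D pair $\lambda(n_t)$ is the average data rate that each source can transmit to its destination w.h.p. in multi-hop fashion under the given scheduling scheme, i.e. $p\left(\min_{1\le i\le n_t/2}\liminf_{t\to\infty}\frac1tM_i(t)\ge\lambda(n_t)\right)\to1$ as $n_t\to\infty$, where $M_i(t)$ is the number of bits S-D pair $i$ transmitted in $t$ time slots. The sum throughput is $T(n_t)=\frac{n_t}{2}\lambda(n_t)$. For the secondary network these are written $\lambda_s(m)$, $T_s(m)$. *)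

theory Defs
  imports "HOL-Probability.Probability"
begin

subsection \<open>Random networks\<close>

type_synonym point = "real \<times> real"

type_synonym cell = "int \<times> int"

text \<open>
  A realization \<open>((N, \<pi>), X)\<close> has the nodes \<open>0, \<dots>, N - 1\<close>, node \<open>v\<close> being located at \<open>X v\<close>
  (the locations \<open>X v\<close> with \<open>v \<ge> N\<close> are ignored), and the S-D pairs \<open>(\<pi> (2 i), \<pi> (2 i + 1))\<close>
  for \<open>i < N div 2\<close>; if \<open>N\<close> is odd, one node is neither a source nor a destination.
\<close>

type_synonym network = "(nat \<times> (nat \<Rightarrow> nat)) \<times> (nat \<Rightarrow> point)"

definition num_nodes :: "network \<Rightarrow> nat" where
  "num_nodes w = fst (fst w)"

definition num_pairs :: "network \<Rightarrow> nat" where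
  "num_pairs w = num_nodes w div 2"

definition pos :: "network \<Rightarrow> nat \<Rightarrow> point" where
  "pos w v = snd w v"

definition source :: "network \<Rightarrow> nat \<Rightarrow> nat" where
  "source w i = snd (fst w) (2 * i)"

definition dest :: "network \<Rightarrow> nat \<Rightarrow> nat" where
  "dest w i = snd (fst w) (2 * i + 1)"

definition unit_square :: "point set" where
  "unit_square = {0..<1} \<times> {0..<1}"

text \<open>
  The Poisson point process of density \<open>\<delta>\<close> on the unit square is a Poisson(\<open>\<delta>\<close>) number of
  independent uniformly distributed points. Independently of the locations, the nodes are grouped
  into S-D pairs by a uniformly random permutation.
\<close>

definition network_measure :: "real \<Rightarrow> network measure" where
  "network_measure \<delta> =
     measure_pmf (poisson_pmf \<delta> \<bind>
       (\<lambda>N. map_pmf (Pair N) (pmf_of_set {\<pi>. \<pi> permutes {..<N}})))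
     \<Otimes>\<^sub>M (\<Pi>\<^sub>M v\<in>UNIV. uniform_measure lborel unit_square)"

text \<open>The primary network (first component) and the secondary network are independent.\<close>

definition overlay_measure :: "real \<Rightarrow> real \<Rightarrow> (network \<times> network) measure" where
  "overlay_measure n m = network_measure n \<Otimes>\<^sub>M network_measure m"

text \<open>
  Probability tending to 1 as \<open>n \<rightarrow> \<infinity>\<close>. For measurable events this is convergence of their
  probabilities to 1; in general it is convergence of their inner probabilities.
\<close>

definition whp :: "(real \<Rightarrow> 'w measure) \<Rightarrow> (real \<Rightarrow> 'w \<Rightarrow> bool) \<Rightarrow> bool" where
  "whp M P \<longleftrightarrow>
     (\<exists>E. (\<forall>\<^sub>F n in at_top. E n \<in> sets (M n) \<and> E n \<subseteq> {\<omega> \<in> space (M n). P n \<omega>}) \<and>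
          ((\<lambda>n. measure (M n) (E n)) \<longlongrightarrow> 1) at_top)"


subsection \<open>Cells, TDMA pattern and data paths, common to both networks\<close>

text \<open>
  The unit square is cut into \<open>q \<times> q\<close> square cells. To obtain a whole number of cells of nominal
  area \<open>k log \<delta> / \<delta>\<close>, the number of cells per side is rounded down; the actual area \<open>1 / q\<^sup>2\<close> is
  the one entering the transmit powers and the size of the preservation regions.
\<close>

definition cells_per_side :: "real \<Rightarrow> real \<Rightarrow> nat" where
  "cells_per_side k \<delta> = nat \<lfloor>1 / sqrt (k * ln \<delta> / \<delta>)\<rfloor>"

definition cell_area :: "nat \<Rightarrow> real" where
  "cell_area q = 1 / (real q)\<^sup>2"

definition grid :: "nat \<Rightarrow> cell set" where
  "grid q = {0..<int q} \<times> {0..<int q}"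

definition cell_of :: "nat \<Rightarrow> point \<Rightarrow> cell" where
  "cell_of q z = (\<lfloor>real q * fst z\<rfloor>, \<lfloor>real q * snd z\<rfloor>)"

text \<open>
  Round robin through the cells of each \<open>5 \<times> 5\<close> cluster (incomplete clusters at the upper and
  right border follow the same pattern).
\<close>

definition scheduled :: "cell \<Rightarrow> nat \<Rightarrow> bool" where
  "scheduled c t \<longleftrightarrow> fst c mod 5 + 5 * (snd c mod 5) = int (t mod 25)"

definition source_cell :: "nat \<Rightarrow> network \<Rightarrow> nat \<Rightarrow> cell" where
  "source_cell q w i = cell_of q (pos w (source w i))"

definition dest_cell :: "nat \<Rightarrow> network \<Rightarrow> nat \<Rightarrow> cell" where
  "dest_cell q w i = cell_of q (pos w (dest w i))"

definition path_length :: "nat \<Rightarrow> network \<Rightarrow> nat \<Rightarrow> nat" where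
  "path_length q w i =
     nat (\<bar>fst (dest_cell q w i) - fst (source_cell q w i)\<bar> +
          \<bar>snd (dest_cell q w i) - snd (source_cell q w i)\<bar>)"

text \<open>
  The cells crossed by the HDP (along the row of the source) and then by the VDP (along the column
  of the destination), for \<open>h = 0, \<dots>, path_length q w i\<close>.
\<close>

definition path_cell :: "nat \<Rightarrow> network \<Rightarrow> nat \<Rightarrow> nat \<Rightarrow> cell" where
  "path_cell q w i h =
     (let (xs, ys) = source_cell q w i; (xd, yd) = dest_cell q w i; dx = nat \<bar>xd - xs\<bar>
      in if h \<le> dx then (xs + sgn (xd - xs) * int h, ys)
         else (xd, ys + sgn (yd - ys) * int (h - dx)))"

text \<open>
  Hop \<open>h\<close> leads from cell \<open>h\<close> of the path to cell \<open>h + 1\<close>; source and destination in the same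
  cell communicate directly, in one hop.
\<close>

definition num_hops :: "nat \<Rightarrow> network \<Rightarrow> nat \<Rightarrow> nat" where
  "num_hops q w i = max 1 (path_length q w i)"

definition passing :: "nat \<Rightarrow> network \<Rightarrow> cell \<Rightarrow> nat set" where
  "passing q w c =
     {i. i < num_pairs w \<and> (\<exists>h. 1 \<le> h \<and> h < num_hops q w i \<and> path_cell q w i h = c)}"

definition originating :: "nat \<Rightarrow> network \<Rightarrow> cell \<Rightarrow> nat set" where
  "originating q w c = {i. i < num_pairs w \<and> source_cell q w i = c}"

text \<open>The data paths served by a cell, in the order of their packet slots.\<close>

definition packets :: "nat \<Rightarrow> network \<Rightarrow> cell \<Rightarrow> nat list" where
  "packets q w c =
     sorted_list_of_set (passing q w c) @ sorted_list_of_set (originating q w c)"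

text \<open>The data path served at time \<open>u\<close> after the start of a slot of length \<open>T\<close>.\<close>

definition path_at :: "nat list \<Rightarrow> real \<Rightarrow> real \<Rightarrow> nat" where
  "path_at l T u = l ! nat \<lfloor>u * real (length l) / T\<rfloor>"

definition nodes_in :: "nat \<Rightarrow> network \<Rightarrow> cell \<Rightarrow> nat list" where
  "nodes_in q w c = sorted_list_of_set {v. v < num_nodes w \<and> cell_of q (pos w v) = c}"

text \<open>
  The designated relay node in slot \<open>t\<close>. The nodes of a cell take turns, a turn ending with a slot
  in which the cell may transmit, so that packets are forwarded by the node that received them.
\<close>

definition relay :: "nat \<Rightarrow> network \<Rightarrow> (cell \<Rightarrow> nat \<Rightarrow> bool) \<Rightarrow> cell \<Rightarrow> nat \<Rightarrow> nat" where
  "relay q w transmits c t =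
     nodes_in q w c ! (card {t'. t' < t \<and> transmits c t'} mod length (nodes_in q w c))"

text \<open>The node of cell \<open>c\<close> transmitting the packet of path \<open>i\<close>, when \<open>r\<close> is the relay node of \<open>c\<close>.\<close>

definition transmitter :: "nat \<Rightarrow> network \<Rightarrow> cell \<Rightarrow> nat \<Rightarrow> nat \<Rightarrow> nat" where
  "transmitter q w c r i = (if source_cell q w i = c then source w i else r)"


subsection \<open>The overlaid networks\<close>

text \<open>
  One realization \<open>wp\<close>, \<open>ws\<close> of the primary and secondary networks, with \<open>qp\<close>, \<open>qs\<close> cells per side.
  Time is measured in secondary slots, of length \<open>tp / 25\<close>: secondary slot \<open>t\<close> lies in the primary
  slot \<open>t div 25\<close>, which has length \<open>tp\<close>.
\<close>

locale overlay =
  fixes \<alpha> N0 P0 P1 tp :: real and qp qs :: nat and wp ws :: network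
begin

definition gain :: "real \<Rightarrow> real" where
  "gain r = r powr (- \<alpha>)"

definition prim_power :: real where
  "prim_power = P0 * cell_area qp powr (\<alpha> / 2)"

definition sec_power :: real where
  "sec_power = P1 * cell_area qs powr (\<alpha> / 2)"

definition ts :: real where
  "ts = tp / 25"

definition prim_may_transmit :: "cell \<Rightarrow> nat \<Rightarrow> bool" where
  "prim_may_transmit c p \<longleftrightarrow> c \<in> grid qp \<and> scheduled c p"

text \<open>The primary cells containing an active transmitter in primary slot \<open>p\<close>.\<close>

definition prim_active :: "nat \<Rightarrow> cell set" where
  "prim_active p = {c. prim_may_transmit c p \<and> packets qp wp c \<noteq> []}"

text \<open>The location of the transmitter of primary cell \<open>c\<close>, at time \<open>u\<close> into primary slot \<open>p\<close>.\<close>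

definition prim_tx_pos :: "nat \<Rightarrow> real \<Rightarrow> cell \<Rightarrow> point" where
  "prim_tx_pos p u c =
     pos wp (transmitter qp wp c (relay qp wp prim_may_transmit c p) (path_at (packets qp wp c) tp u))"

definition region_width :: int where
  "region_width = \<lfloor>3 * sqrt (cell_area qp / cell_area qs)\<rfloor> + 2"

text \<open>
  The secondary cells in the preservation region around a primary cell. Since secondary cells need
  not be aligned with primary cells, the block of \<open>region_width\<^sup>2\<close> secondary cells is placed so that
  its lower left cell contains the lower left corner of the \<open>3 \<times> 3\<close> primary cells centered at the
  given one; it then covers all of these. Cells of the block outside the unit square are void.
\<close>

definition preservation_region :: "cell \<Rightarrow> cell set" where
  "preservation_region c =
     (let lo = (\<lambda>i::int. \<lfloor>(real_of_int i - 1) * sqrt (cell_area qp / cell_area qs)\<rfloor>)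
      in {lo (fst c)..<lo (fst c) + region_width} \<times> {lo (snd c)..<lo (snd c) + region_width})"

definition sec_may_transmit :: "cell \<Rightarrow> nat \<Rightarrow> bool" where
  "sec_may_transmit c t \<longleftrightarrow>
     c \<in> grid qs \<and> scheduled c t \<and> (\<forall>c' \<in> prim_active (t div 25). c \<notin> preservation_region c')"

definition sec_active :: "nat \<Rightarrow> cell set" where
  "sec_active t = {c. sec_may_transmit c t \<and> packets qs ws c \<noteq> []}"

definition sec_relay :: "cell \<Rightarrow> nat \<Rightarrow> nat" where
  "sec_relay c t = relay qs ws sec_may_transmit c t"

definition sec_tx_pos :: "nat \<Rightarrow> real \<Rightarrow> cell \<Rightarrow> point" where
  "sec_tx_pos t u c =
     pos ws (transmitter qs ws c (sec_relay c t) (path_at (packets qs ws c) ts u))"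

text \<open>
  Total interference at location \<open>z\<close>, at time \<open>u\<close> into secondary slot \<open>t\<close>, for the reception from
  the transmitter of secondary cell \<open>c\<close>. Packet slots of different cells differ in length, so the
  set of transmitters changes during a slot.
\<close>

definition interference :: "nat \<Rightarrow> real \<Rightarrow> cell \<Rightarrow> point \<Rightarrow> real" where
  "interference t u c z =
     (\<Sum>c' \<in> sec_active t - {c}. sec_power * gain (dist (sec_tx_pos t u c') z)) +
     (\<Sum>c' \<in> prim_active (t div 25).
        prim_power * gain (dist (prim_tx_pos (t div 25) (real (t mod 25) * ts + u) c') z))"

definition sec_rate :: "nat \<Rightarrow> real \<Rightarrow> cell \<Rightarrow> point \<Rightarrow> real" where
  "sec_rate t u c z =
     log 2 (1 + sec_power * gain (dist (sec_tx_pos t u c) z) / (N0 + interference t u c z))"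

definition receiver :: "nat \<Rightarrow> nat \<Rightarrow> nat \<Rightarrow> nat" where
  "receiver i h t =
     (if path_length qs ws i \<le> h + 1 then dest ws i else sec_relay (path_cell qs ws i (h + 1)) t)"

text \<open>
  The number of bits that can be sent over hop \<open>h\<close> of path \<open>i\<close> in slot \<open>t\<close>, i.e. during the packet
  slot of path \<open>i\<close>.
\<close>

definition capacity :: "nat \<Rightarrow> nat \<Rightarrow> nat \<Rightarrow> real" where
  "capacity i h t =
     (let c = path_cell qs ws i h
      in if c \<in> sec_active t
         then integral {0..ts}
           (\<lambda>u. if path_at (packets qs ws c) ts u = i
                 then sec_rate t u c (pos ws (receiver i h t)) else 0)
         else 0)"

text \<open>
  The number of bits sent over hop \<open>h\<close> in slot \<open>t\<close>, when \<open>b h v\<close> bits are buffered at the relay node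
  \<open>v\<close> of cell \<open>h\<close> of the path. Sources always have bits to send; relay nodes can only send what they
  have in their buffers.
\<close>

definition sent :: "nat \<Rightarrow> (nat \<Rightarrow> nat \<Rightarrow> real) \<Rightarrow> nat \<Rightarrow> nat \<Rightarrow> real" where
  "sent i b h t =
     (if h = 0 then capacity i 0 t
      else min (b h (sec_relay (path_cell qs ws i h) t)) (capacity i h t))"

text \<open>The bits of path \<open>i\<close> in the buffers at the beginning of slot \<open>t\<close>.\<close>

primrec buffer :: "nat \<Rightarrow> nat \<Rightarrow> nat \<Rightarrow> nat \<Rightarrow> real" where
  "buffer i 0 = (\<lambda>h v. 0)"
| "buffer i (Suc t) = (\<lambda>h v.
     if 1 \<le> h \<and> h < num_hops qs ws i \<and> v = sec_relay (path_cell qs ws i h) t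
     then buffer i t h v - sent i (buffer i t) h t + sent i (buffer i t) (h - 1) t
     else buffer i t h v)"

text \<open>The number of bits of S-D pair \<open>i\<close> delivered to the destination in \<open>t\<close> slots.\<close>

definition delivered :: "nat \<Rightarrow> nat \<Rightarrow> real" where
  "delivered i t = (\<Sum>t'<t. sent i (buffer i t') (num_hops qs ws i - 1) t')"

definition throughput_per_pair :: ereal where
  "throughput_per_pair =
     (INF i \<in> {..<num_pairs ws}. liminf (\<lambda>t. ereal (1 / real t * delivered i t)))"

definition sum_throughput :: ereal where
  "sum_throughput = ereal (real (num_nodes ws) / 2) * throughput_per_pair"

end

text \<open>
  The largest throughput per S-D pair that the secondary network achieves in the realization
  \<open>\<omega>\<close>, and the corresponding sum throughput, for densities \<open>n\<close> and \<open>m\<close>.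
\<close>

definition lambda_s ::
  "real \<Rightarrow> real \<Rightarrow> real \<Rightarrow> real \<Rightarrow> real \<Rightarrow> real \<Rightarrow> real \<Rightarrow> real \<Rightarrow> real \<Rightarrow> network \<times> network \<Rightarrow> ereal" where
  "lambda_s \<alpha> N0 P0 P1 tp k1 k2 n m \<omega> =
     overlay.throughput_per_pair \<alpha> N0 P0 P1 tp
       (cells_per_side k1 n) (cells_per_side k2 m) (fst \<omega>) (snd \<omega>)"

definition T_s ::
  "real \<Rightarrow> real \<Rightarrow> real \<Rightarrow> real \<Rightarrow> real \<Rightarrow> real \<Rightarrow> real \<Rightarrow> real \<Rightarrow> real \<Rightarrow> network \<times> network \<Rightarrow> ereal" where
  "T_s \<alpha> N0 P0 P1 tp k1 k2 n m \<omega> =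
     overlay.sum_throughput \<alpha> N0 P0 P1 tp
       (cells_per_side k1 n) (cells_per_side k2 m) (fst \<omega>) (snd \<omega>)"

text \<open>\<open>X = \<Theta>(f)\<close> w.h.p., with deterministic constants.\<close>

definition theta_whp ::
  "(real \<Rightarrow> 'w measure) \<Rightarrow> (real \<Rightarrow> 'w \<Rightarrow> ereal) \<Rightarrow> (real \<Rightarrow> real) \<Rightarrow> bool" where
  "theta_whp M X f \<longleftrightarrow>
     (\<exists>c1 c2. 0 < c2 \<and> whp M (\<lambda>n \<omega>. ereal (c2 * f n) \<le> X n \<omega> \<and> X n \<omega> \<le> ereal (c1 * f n)))"

end

theory Submission
  imports Defs "HOL-Real_Asymp.Real_Asymp"
begin

text \<open>
  Write \<open>q\<close> for the number of secondary cells per side, so that \<open>q / m = \<Theta>(1 / sqrt (m ln m))\<close>.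

  Lower bound. Since \<open>\<alpha> > 2\<close>, both interference terms at a receiver are bounded by convergent sums
  in units of the cell size: simultaneous secondary transmitters are five cells apart, and the
  preservation regions keep primary transmitters half a primary cell away. So every hop has a
  constant rate while its cell is active. The pattern has period 625 slots, and each cell
  transmits at least once per period, as the preservation regions block at most four of the five
  columns of a primary cluster. A cell serves no more data paths than there are nodes in its row
  and in its column, hence \<open>O(m / q)\<close>.

  Upper bound. The cell in the middle of the square lies on the HDPs of \<open>\<Omega>(m / q)\<close> pairs. It also
  contains a source near its center with a destination elsewhere; the first hop of this source has
  length at least a quarter of a cell, so its rate is bounded, and it gets a fraction
  \<open>O(q / m)\<close> of the time.

  All random events reduce, by Markov's inequality, to the moments \<open>E[s ^ N(S)]\<close> of Poisson counts
  and their analogues for pairs.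
\<close>

subsection \<open>Cells and data paths\<close>

text \<open>The proof separates a deterministic half from a random half. The locale
  \<open>regular_overlay\<close> lists what a realization must satisfy, and rates, buffers and
  throughput are treated there for every such realization. The random half concerns only counts of
  nodes and of pairs in fixed rectangles and some almost sure properties. The throughput is never
  shown to be measurable, since \<open>whp\<close> asks only for a measurable subset of the event.
  The hypothesis \<open>k1 \<ge> 1\<close> enters through occupancy: a cell expects at least
  \<open>ln \<delta>\<close> nodes, so the expected number of empty cells is at most
  \<open>(\<delta> / ln \<delta>) * (1 / \<delta>)\<close>, which just tends to 0. The hypothesis
  \<open>\<beta> > 1\<close> makes secondary cells eventually at most half as wide as primary ones,
  which is what the geometry of the preservation regions uses. For the upper bound an arbitrary pair
  of the crowded cell will not do: the gain is unbounded near distance 0, so a very short first hop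
  could have a very high rate. Hence the source is taken near the center of its cell with its
  destination in another one. The throughput is an infimum over pairs, so a single such pair
  suffices.\<close>

lemma cell_of_in_grid:
  assumes "z \<in> unit_square" "q > 0"
  shows "cell_of q z \<in> grid q"
proof -
  have "\<lfloor>real q * a\<rfloor> \<in> {0..<int q}" if "0 \<le> a" "a < 1" for a
    using that \<open>q > 0\<close> by (simp add: floor_less_iff)
  then show ?thesis
    using assms by (auto simp: unit_square_def cell_of_def grid_def)
qed

lemma finite_grid [simp]: "finite (grid q)"
  by (simp add: grid_def)

lemma card_grid: "card (grid q) = q\<^sup>2"
  by (simp add: grid_def power2_eq_square)

lemma path_cell_0 [simp]: "path_cell q w i 0 = source_cell q w i"
  by (cases "source_cell q w i"; cases "dest_cell q w i") (simp add: path_cell_def)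

lemma sgn_mult_nat_abs: "sgn (a::int) * int (nat \<bar>a\<bar>) = a"
  by (simp add: mult.commute abs_mult_sgn)

lemma path_cell_path_length [simp]:
  "path_cell q w i (path_length q w i) = dest_cell q w i"
proof -
  obtain xs ys xd yd where s: "source_cell q w i = (xs, ys)" "dest_cell q w i = (xd, yd)"
    by (metis surj_pair)
  define dx dy where "dx = nat \<bar>xd - xs\<bar>" and "dy = nat \<bar>yd - ys\<bar>"
  have "path_length q w i = dx + dy"
    using s by (simp add: path_length_def dx_def dy_def nat_add_distrib)
  moreover have "xs + sgn (xd - xs) * int dx = xd" "ys + sgn (yd - ys) * int dy = yd"
    using sgn_mult_nat_abs[of "xd - xs"] sgn_mult_nat_abs[of "yd - ys"]
    by (simp_all add: dx_def dy_def)
  moreover have "dy = 0 \<Longrightarrow> ys = yd" by (simp add: dy_def)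
  ultimately show ?thesis
    using s by (auto simp: path_cell_def Let_def dx_def[symmetric])
qed

text \<open>The Chebyshev distance of the index pairs. In it a hop has length 1 and two cells active
  in the same slot are at distance at least 5.\<close>

definition cell_dist :: "cell \<Rightarrow> cell \<Rightarrow> int" where
  "cell_dist c d = max \<bar>fst c - fst d\<bar> \<bar>snd c - snd d\<bar>"

lemma path_cell_Suc:
  assumes "h < path_length q w i"
  shows "cell_dist (path_cell q w i (Suc h)) (path_cell q w i h) = 1"
    and "path_cell q w i (Suc h) \<noteq> path_cell q w i h"
proof -
  obtain xs ys xd yd where s: "source_cell q w i = (xs, ys)" "dest_cell q w i = (xd, yd)"
    by (metis surj_pair)
  define dx where "dx = nat \<bar>xd - xs\<bar>"
  have l: "path_length q w i = dx + nat \<bar>yd - ys\<bar>"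
    using s by (simp add: path_length_def dx_def nat_add_distrib)
  have ps: "path_cell q w i h = (if h \<le> dx then (xs + sgn (xd - xs) * int h, ys)
         else (xd, ys + sgn (yd - ys) * int (h - dx)))" for h
    using s by (simp add: path_cell_def dx_def Let_def)
  have e: "xs + sgn (xd - xs) * int dx = xd"
    using sgn_mult_nat_abs[of "xd - xs"] by (simp add: dx_def)
  consider "Suc h \<le> dx" | "h = dx" | "h > dx" by linarith
  then have "cell_dist (path_cell q w i (Suc h)) (path_cell q w i h) = 1"
  proof cases
    case 1
    then have "\<bar>sgn (xd - xs)\<bar> = 1" by (auto simp: dx_def sgn_if)
    then show ?thesis using 1 by (simp add: ps cell_dist_def algebra_simps)
  next
    \<comment> \<open>The corner of the path: cell \<open>h\<close> is still given by the horizontal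
      formula and cell \<open>Suc h\<close> by the vertical one. By \<open>e\<close> both have
      abscissa \<open>xd\<close>.\<close>
    case 2
    then have "\<bar>sgn (yd - ys)\<bar> = 1" using assms l by (auto simp: sgn_if)
    then show ?thesis using 2 e by (simp add: ps cell_dist_def)
  next
    case 3
    then have "\<bar>sgn (yd - ys)\<bar> = 1" using assms l by (auto simp: sgn_if)
    moreover have "int (Suc h - dx) = int (h - dx) + 1" using 3 by simp
    ultimately show ?thesis using 3 by (simp add: ps cell_dist_def algebra_simps)
  qed
  then show "cell_dist (path_cell q w i (Suc h)) (path_cell q w i h) = 1"
    and "path_cell q w i (Suc h) \<noteq> path_cell q w i h" by (auto simp: cell_dist_def)
qed

text \<open>On the horizontal leg the abscissa has moved, on the vertical leg the ordinate. This
  keeps \<open>passing\<close> and \<open>originating\<close> disjoint, so that a path has one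
  packet slot per cell.\<close>

lemma path_cell_neq_source_cell:
  assumes "1 \<le> h" "h \<le> path_length q w i"
  shows "path_cell q w i h \<noteq> source_cell q w i"
proof -
  obtain xs ys xd yd where s: "source_cell q w i = (xs, ys)" "dest_cell q w i = (xd, yd)"
    by (metis surj_pair)
  define dx where "dx = nat \<bar>xd - xs\<bar>"
  have l: "path_length q w i = dx + nat \<bar>yd - ys\<bar>"
    using s by (simp add: path_length_def dx_def nat_add_distrib)
  have p: "path_cell q w i h = (if h \<le> dx then (xs + sgn (xd - xs) * int h, ys)
         else (xd, ys + sgn (yd - ys) * int (h - dx)))"
    using s by (simp add: path_cell_def dx_def Let_def)
  show ?thesis
  proof (cases "h \<le> dx")
    case True
    then have "xd - xs \<noteq> 0" using assms(1) by (auto simp: dx_def)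
    then show ?thesis using True p s assms(1) by (simp add: sgn_eq_0_iff)
  next
    case False
    then have "yd - ys \<noteq> 0" using assms(2) l by auto
    then show ?thesis using False p s by (simp add: sgn_eq_0_iff)
  qed
qed

text \<open>The load of a cell is bounded through this: each path crossing it is charged to a source
  in its row or to a destination in its column.\<close>

lemma path_cell_row_column:
  "snd (path_cell q w i h) = snd (source_cell q w i) \<or> fst (path_cell q w i h) = fst (dest_cell q w i)"
  by (cases "source_cell q w i"; cases "dest_cell q w i") (simp add: path_cell_def Let_def)

lemma path_cell_in_grid:
  assumes "source_cell q w i \<in> grid q" "dest_cell q w i \<in> grid q" "h \<le> path_length q w i"
  shows "path_cell q w i h \<in> grid q"
proof -
  obtain xs ys xd yd where s: "source_cell q w i = (xs, ys)" "dest_cell q w i = (xd, yd)"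
    by (metis surj_pair)
  define dx where "dx = nat \<bar>xd - xs\<bar>"
  have l: "path_length q w i = dx + nat \<bar>yd - ys\<bar>"
    using s by (simp add: path_length_def dx_def nat_add_distrib)
  have p: "path_cell q w i h = (if h \<le> dx then (xs + sgn (xd - xs) * int h, ys)
         else (xd, ys + sgn (yd - ys) * int (h - dx)))"
    using s by (simp add: path_cell_def dx_def Let_def)
  have between: "a + sgn (b - a) * int k \<in> {0..<int q}"
    if "a \<in> {0..<int q}" "b \<in> {0..<int q}" "k \<le> nat \<bar>b - a\<bar>" for a b :: int and k
    using that by (cases a b rule: linorder_cases) auto
  show ?thesis
  proof (cases "h \<le> dx")
    case True
    then show ?thesis using p s assms(1,2) between[of xs xd h] by (auto simp: grid_def dx_def)
  next
    case False
    then show ?thesis using p s l assms between[of ys yd "h - dx"] by (auto simp: grid_def)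
  qed
qed

lemma path_length_0_iff: "path_length q w i = 0 \<longleftrightarrow> source_cell q w i = dest_cell q w i"
  unfolding path_length_def prod_eq_iff by auto

lemma finite_passing [simp]: "finite (passing q w c)"
  by (rule finite_subset[of _ "{..<num_pairs w}"]) (auto simp: passing_def)

lemma finite_originating [simp]: "finite (originating q w c)"
  by (rule finite_subset[of _ "{..<num_pairs w}"]) (auto simp: originating_def)

lemma num_hops_le: "h < num_hops q w i \<Longrightarrow> h \<le> path_length q w i"
  by (simp add: num_hops_def max_def split: if_splits)

lemma set_packets: "set (packets q w c) = passing q w c \<union> originating q w c"
  by (simp add: packets_def)

lemma distinct_packets: "distinct (packets q w c)"
proof -
  have "passing q w c \<inter> originating q w c = {}"
    using path_cell_neq_source_cell[OF _ num_hops_le, of _ q w]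
    by (auto simp: passing_def originating_def)
  then show ?thesis by (simp add: packets_def)
qed

lemma path_cell_in_packets:
  assumes "i < num_pairs w" "h < num_hops q w i"
  shows "i \<in> set (packets q w (path_cell q w i h))"
proof (cases "h = 0")
  case True
  then show ?thesis using assms by (simp add: set_packets originating_def)
next
  case False
  then have "i \<in> passing q w (path_cell q w i h)"
    using assms unfolding passing_def by (intro CollectI conjI exI[of _ h]) auto
  then show ?thesis by (simp add: set_packets)
qed

lemma set_nodes_in: "set (nodes_in q w c) = {v. v < num_nodes w \<and> cell_of q (pos w v) = c}"
  by (simp add: nodes_in_def)

lemma cell_of_relay:
  assumes "nodes_in q w c \<noteq> []"
  shows "cell_of q (pos w (relay q w tr c t)) = c"
proof -
  have "relay q w tr c t \<in> set (nodes_in q w c)"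
    unfolding relay_def using assms by (intro nth_mem mod_less_divisor) simp
  then show ?thesis by (simp add: set_nodes_in)
qed

lemma cell_of_transmitter:
  assumes "nodes_in q w c \<noteq> []"
  shows "cell_of q (pos w (transmitter q w c (relay q w tr c t) i)) = c"
  using cell_of_relay[OF assms] by (simp add: transmitter_def source_cell_def)

text \<open>Whose turn it is depends only on the number of earlier transmissions of the cell, so the
  relay node stays the same while the cell is silent.\<close>

lemma relay_cong:
  assumes "t \<le> t'" "\<And>s. t \<le> s \<Longrightarrow> s < t' \<Longrightarrow> \<not> tr c s"
  shows "relay q w tr c t' = relay q w tr c t"
proof -
  have "{s. s < t' \<and> tr c s} = {s. s < t \<and> tr c s}"
    using assms by (meson not_le less_le_trans)
  then show ?thesis by (simp add: relay_def)
qed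

section \<open>Euclidean distance of points and distance of their cells\<close>

lemma dist_ge_coordinate_gap:
  assumes "q > 0" "\<lfloor>real q * x\<rfloor> = a" "\<lfloor>real q * y\<rfloor> = b"
  shows "(real_of_int \<bar>a - b\<bar> - 1) / real q \<le> \<bar>x - y\<bar>"
proof -
  have "real_of_int \<bar>a - b\<bar> - 1 \<le> \<bar>real q * x - real q * y\<bar>"
    using assms(2,3) by linarith
  also have "\<dots> = real q * \<bar>x - y\<bar>"
    by (metis abs_mult abs_of_nat right_diff_distrib)
  finally show ?thesis using \<open>q > 0\<close> by (simp add: field_simps)
qed

lemma dist_prod_ge:
  fixes x y :: point
  shows "\<bar>fst x - fst y\<bar> \<le> dist x y" "\<bar>snd x - snd y\<bar> \<le> dist x y"
  using dist_fst_le[of x y] dist_snd_le[of x y] by (simp_all add: dist_real_def)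

lemma dist_prod_le:
  fixes x y :: point
  shows "dist x y \<le> \<bar>fst x - fst y\<bar> + \<bar>snd x - snd y\<bar>"
  unfolding dist_prod_def dist_real_def power2_abs by (rule sqrt_sum_squares_le_sum_abs)

text \<open>One cell is lost because points of adjacent cells can be arbitrarily close.\<close>

lemma dist_ge_cell_dist:
  assumes "q > 0"
  shows "(real_of_int (cell_dist (cell_of q x) (cell_of q y)) - 1) / real q \<le> dist x y"
proof -
  have "(real_of_int \<bar>fst (cell_of q x) - fst (cell_of q y)\<bar> - 1) / real q \<le> dist x y"
    "(real_of_int \<bar>snd (cell_of q x) - snd (cell_of q y)\<bar> - 1) / real q \<le> dist x y"
    using dist_ge_coordinate_gap[OF assms, of "fst x" _ "fst y"] dist_prod_ge(1)[of x y]
      dist_ge_coordinate_gap[OF assms, of "snd x" _ "snd y"] dist_prod_ge(2)[of x y]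
    by (fastforce simp: cell_of_def)+
  then show ?thesis by (auto simp: cell_dist_def max_def)
qed

text \<open>The factor 2 comes from bounding the Euclidean distance by the sum of the two coordinate
  differences.\<close>

lemma dist_le_cell_dist:
  assumes "q > 0"
  shows "dist x y \<le> 2 * (real_of_int (cell_dist (cell_of q x) (cell_of q y)) + 1) / real q"
proof -
  have "\<bar>x - y\<bar> \<le> (real_of_int \<bar>\<lfloor>real q * x\<rfloor> - \<lfloor>real q * y\<rfloor>\<bar> + 1) / real q" for x y
  proof -
    have "real q * \<bar>x - y\<bar> = \<bar>real q * x - real q * y\<bar>"
      by (metis abs_mult abs_of_nat right_diff_distrib)
    also have "\<dots> \<le> real_of_int \<bar>\<lfloor>real q * x\<rfloor> - \<lfloor>real q * y\<rfloor>\<bar> + 1" by linarith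
    finally show ?thesis using assms by (simp add: field_simps)
  qed
  from this[of "fst x" "fst y"] this[of "snd x" "snd y"]
  have "dist x y \<le> (real_of_int \<bar>fst (cell_of q x) - fst (cell_of q y)\<bar> + 1) / real q
    + (real_of_int \<bar>snd (cell_of q x) - snd (cell_of q y)\<bar> + 1) / real q"
    using dist_prod_le[of x y] by (simp add: cell_of_def)
  also have "\<dots> \<le> (real_of_int (cell_dist (cell_of q x) (cell_of q y)) + 1) / real q
    + (real_of_int (cell_dist (cell_of q x) (cell_of q y)) + 1) / real q"
    by (intro add_mono divide_right_mono) (auto simp: cell_dist_def)
  finally show ?thesis by (simp add: field_simps)
qed

text \<open>The residues of the coordinates modulo 5 are the base 5 digits of the slot number modulo
  25. Cells sharing a slot therefore agree modulo 5 in both coordinates.\<close>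

lemma scheduled_same_slot_far:
  assumes "scheduled c t" "scheduled c' t" "c \<noteq> c'"
  shows "5 \<le> cell_dist c' c"
proof -
  have digits: "x = x' \<and> y = y'"
    if "x + 5 * y = x' + 5 * y'" "x \<in> {0..<5}" "x' \<in> {0..<5}" for x y x' y' :: int
  proof -
    have "y = y'" using that by simp
    then show ?thesis using that(1) by simp
  qed
  have "fst c mod 5 = fst c' mod 5 \<and> snd c mod 5 = snd c' mod 5"
    using assms(1,2) by (intro digits) (auto simp: scheduled_def)
  moreover have "b = a \<or> 5 \<le> \<bar>b - a\<bar>" if "a mod 5 = b mod 5" for a b :: int
    using that by presburger
  ultimately have "fst c' = fst c \<or> 5 \<le> \<bar>fst c' - fst c\<bar>" "snd c' = snd c \<or> 5 \<le> \<bar>snd c' - snd c\<bar>"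
    by blast+
  then show ?thesis using assms(3) by (auto simp: cell_dist_def prod_eq_iff)
qed

lemma scheduled_periodic: "scheduled c (t + 25 * j) = scheduled c t"
  by (simp add: scheduled_def)

subsection \<open>Interference sums\<close>

lemma summable_on_int_powr:
  assumes "a > (1::real)"
  shows "(\<lambda>k::int. (1 + real_of_int \<bar>k\<bar>) powr (- a)) summable_on UNIV"
proof -
  have s: "summable (\<lambda>k. (1 + real k) powr (- a))"
  proof -
    have "summable (\<lambda>k. real (Suc k) powr (- a))"
      using assms summable_real_powr_iff[of "-a"] by (subst summable_Suc_iff) auto
    then show ?thesis by (simp add: add.commute)
  qed
  have n: "(\<lambda>k. (1 + real k) powr (- a)) summable_on UNIV"
    using s by (subst summable_on_UNIV_nonneg_real_iff) auto
  have "(\<lambda>k::int. (1 + real_of_int \<bar>k\<bar>) powr (- a)) summable_on (range int)"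
    by (subst summable_on_reindex) (auto simp: o_def n)
  moreover have "(\<lambda>k::int. (1 + real_of_int \<bar>k\<bar>) powr (- a)) summable_on (range (\<lambda>k. - int k))"
    by (subst summable_on_reindex) (auto simp: o_def n inj_def)
  moreover have "(UNIV :: int set) = range int \<union> range (\<lambda>k. - int k)"
    by (auto intro: int_cases2)
  ultimately show ?thesis by (metis summable_on_union)
qed

text \<open>Bounds the sum of \<open>((1 + D) / 4) powr (- \<alpha>)\<close> over all cells at cell
  distance \<open>D\<close> from a given one; \<open>(1 + D) / 4\<close> cell sides is the lower
  bound for distances in \<open>sum_interference_le\<close>. The square is a product of two
  one-dimensional series.\<close>

definition interference_sum :: "real \<Rightarrow> real" where
  "interference_sum \<alpha> = 4 powr \<alpha> * (\<Sum>\<^sub>\<infinity>k::int. (1 + real_of_int \<bar>k\<bar>) powr (- (\<alpha> / 2)))\<^sup>2"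

lemma interference_sum_nonneg: "0 \<le> interference_sum \<alpha>"
  by (simp add: interference_sum_def)

text \<open>Since \<open>(1 + x) * (1 + y) \<le> (1 + max x y)^2\<close>, each term is at most a
  product of two terms with exponent \<open>\<alpha> / 2\<close>, and the double sum splits into two
  series. They converge because \<open>\<alpha> / 2 > 1\<close>.\<close>

lemma sum_cell_dist_powr_le:
  assumes "\<alpha> > 2" "finite A"
  shows "(\<Sum>c\<in>A. (1 + real_of_int (cell_dist c d)) powr (- \<alpha>))
    \<le> (\<Sum>\<^sub>\<infinity>k::int. (1 + real_of_int \<bar>k\<bar>) powr (- (\<alpha> / 2)))\<^sup>2"
proof -
  define g :: "int \<Rightarrow> real" where "g k = (1 + real_of_int \<bar>k\<bar>) powr (- (\<alpha> / 2))" for k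
  have g0: "g k \<ge> 0" for k by (simp add: g_def)
  have summ: "g summable_on UNIV"
    unfolding g_def using assms(1) by (intro summable_on_int_powr) simp
  have le: "sum g (f ` B) \<le> infsum g UNIV" if "finite B" for f :: "cell \<Rightarrow> int" and B
    using that g0 by (intro finite_sum_le_infsum summ) auto
  have "(\<Sum>c\<in>A. (1 + real_of_int (cell_dist c d)) powr (- \<alpha>))
      \<le> (\<Sum>c\<in>A. g (fst c - fst d) * g (snd c - snd d))"
  proof (rule sum_mono)
    fix c :: cell
    define x y where "x = real_of_int \<bar>fst c - fst d\<bar>" and "y = real_of_int \<bar>snd c - snd d\<bar>"
    have xy: "x \<ge> 0" "y \<ge> 0" by (simp_all add: x_def y_def)
    have D: "real_of_int (cell_dist c d) = max x y"
      by (simp add: cell_dist_def x_def y_def of_int_max)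
    have "(1 + x) * (1 + y) \<le> (1 + max x y) * (1 + max x y)"
      using xy by (intro mult_mono) auto
    then have "((1 + max x y) * (1 + max x y)) powr (- (\<alpha> / 2)) \<le> ((1 + x) * (1 + y)) powr (- (\<alpha> / 2))"
      using xy assms(1) by (intro powr_mono2') auto
    moreover have "((1 + max x y) * (1 + max x y)) powr (- (\<alpha> / 2)) = (1 + max x y) powr (- \<alpha>)"
      using xy by (subst powr_mult) (auto simp: powr_add[symmetric])
    ultimately show "(1 + real_of_int (cell_dist c d)) powr (- \<alpha>) \<le> g (fst c - fst d) * g (snd c - snd d)"
      using xy unfolding D g_def x_def[symmetric] y_def[symmetric] by (simp add: powr_mult)
  qed
  also have "\<dots> = (\<Sum>p\<in>(\<lambda>c. (fst c - fst d, snd c - snd d)) ` A. g (fst p) * g (snd p))"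
    by (subst sum.reindex) (auto simp: inj_on_def prod_eq_iff)
  also have "\<dots> \<le> (\<Sum>p\<in>((\<lambda>c. fst c - fst d) ` A) \<times> ((\<lambda>c. snd c - snd d) ` A). g (fst p) * g (snd p))"
    using assms(2) g0 by (intro sum_mono2) auto
  also have "\<dots> = sum g ((\<lambda>c. fst c - fst d) ` A) * sum g ((\<lambda>c. snd c - snd d) ` A)"
    by (simp add: sum_product sum.cartesian_product case_prod_unfold)
  also have "\<dots> \<le> infsum g UNIV * infsum g UNIV"
    using assms(2) g0 by (intro mult_mono le sum_nonneg infsum_nonneg) auto
  finally show ?thesis unfolding g_def power2_eq_square .
qed

lemma cell_area_powr:
  assumes "q > 0"
  shows "cell_area q powr (\<alpha> / 2) = real q powr (- \<alpha>)"
proof -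
  have "cell_area q = real q powr (-2)"
    using assms by (simp add: cell_area_def powr_minus_divide powr_numeral)
  then show ?thesis using assms by (simp add: powr_powr)
qed

text \<open>The transmit power carries \<open>real q powr (- \<alpha>)\<close>, which cancels the
  scale of the distances, so the bound does not depend on \<open>q\<close>. The form of
  \<open>far\<close> is chosen to fit both networks: \<open>(1 + D) / 4\<close> is at most
  \<open>D - 1\<close> for \<open>D \<ge> 2\<close>, and at most the half cell that the preservation
  regions guarantee for \<open>D \<le> 1\<close>.\<close>

lemma sum_interference_le:
  fixes x :: "cell \<Rightarrow> point"
  assumes "\<alpha> > 2" "finite A" "P \<ge> 0" "q > 0"
    and far: "\<And>c. c \<in> A \<Longrightarrow> (1 + real_of_int (cell_dist c d)) / (4 * real q) \<le> dist (x c) z"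
  shows "(\<Sum>c\<in>A. P * cell_area q powr (\<alpha> / 2) * dist (x c) z powr (- \<alpha>)) \<le> P * interference_sum \<alpha>"
proof -
  note a = cell_area_powr[OF \<open>q > 0\<close>]
  have "(\<Sum>c\<in>A. P * cell_area q powr (\<alpha> / 2) * dist (x c) z powr (- \<alpha>))
    \<le> (\<Sum>c\<in>A. P * 4 powr \<alpha> * (1 + real_of_int (cell_dist c d)) powr (- \<alpha>))"
  proof (rule sum_mono)
    fix c assume c: "c \<in> A"
    have p: "0 < 1 + real_of_int (cell_dist c d)" by (simp add: cell_dist_def)
    have "dist (x c) z powr (- \<alpha>) \<le> ((1 + real_of_int (cell_dist c d)) / (4 * real q)) powr (- \<alpha>)"
      using far[OF c] p assms(1,4) by (intro powr_mono2') auto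
    also have "\<dots> = (1 + real_of_int (cell_dist c d)) powr (- \<alpha>) * 4 powr \<alpha> * real q powr \<alpha>"
      using p assms(4) by (simp add: powr_divide powr_mult powr_minus field_simps)
    finally have "cell_area q powr (\<alpha> / 2) * dist (x c) z powr (- \<alpha>)
      \<le> real q powr (- \<alpha>) * ((1 + real_of_int (cell_dist c d)) powr (- \<alpha>) * 4 powr \<alpha> * real q powr \<alpha>)"
      unfolding a by (intro mult_left_mono) auto
    also have "\<dots> = 4 powr \<alpha> * (1 + real_of_int (cell_dist c d)) powr (- \<alpha>)"
      using assms(4) by (simp add: powr_minus field_simps)
    finally show "P * cell_area q powr (\<alpha> / 2) * dist (x c) z powr (- \<alpha>)
      \<le> P * 4 powr \<alpha> * (1 + real_of_int (cell_dist c d)) powr (- \<alpha>)"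
      using mult_left_mono[OF _ assms(3)] by (simp add: mult.assoc)
  qed
  also have "\<dots> = P * 4 powr \<alpha> * (\<Sum>c\<in>A. (1 + real_of_int (cell_dist c d)) powr (- \<alpha>))"
    by (simp add: sum_distrib_left)
  also have "\<dots> \<le> P * 4 powr \<alpha> * (\<Sum>\<^sub>\<infinity>k::int. (1 + real_of_int \<bar>k\<bar>) powr (- (\<alpha> / 2)))\<^sup>2"
    using assms by (intro mult_left_mono sum_cell_dist_powr_le) auto
  finally show ?thesis by (simp add: interference_sum_def mult.assoc)
qed

lemma cell_dist_triangle: "cell_dist c e \<le> cell_dist c d + cell_dist d e"
  by (auto simp: cell_dist_def)

lemma cell_dist_commute: "cell_dist c d = cell_dist d c"
  by (simp add: cell_dist_def abs_minus_commute)

lemma cell_dist_nonneg [simp]: "0 \<le> cell_dist c d"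
  by (simp add: cell_dist_def)

subsection \<open>Packet slots and preservation regions\<close>

lemma path_at_measurable [measurable]: "path_at l T \<in> measurable borel (count_space UNIV)"
  unfolding path_at_def[abs_def] by measurable

text \<open>The slot is cut into \<open>length l\<close> equal half-open intervals. At
  \<open>u = T\<close> the index would be \<open>length l\<close>, beyond the end of the list, hence
  the strict bound.\<close>

lemma path_at_eq_iff:
  assumes "distinct l" "k < length l" "l ! k = i" "0 < T" "0 \<le> u" "u < T"
  shows "path_at l T u = i \<longleftrightarrow>
    u \<in> {real k * T / real (length l)..<real (Suc k) * T / real (length l)}"
proof -
  define y where "y = u * real (length l) / T"
  have len: "0 < real (length l)" using assms(2) by (cases l) simp_all
  have y: "0 \<le> y" "y < real (length l)"
    using assms len by (simp_all add: y_def field_simps)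
  have "path_at l T u = i \<longleftrightarrow> l ! nat \<lfloor>y\<rfloor> = l ! k"
    using assms(3) by (simp add: path_at_def y_def)
  also have "\<dots> \<longleftrightarrow> nat \<lfloor>y\<rfloor> = k"
    using assms(1,2) y by (intro nth_eq_iff_index_eq) linarith+
  also have "\<dots> \<longleftrightarrow> real k \<le> y \<and> y < real (Suc k)"
    using y by (auto simp: nat_eq_iff floor_eq_iff)
  also have "\<dots> \<longleftrightarrow> u \<in> {real k * T / real (length l)..<real (Suc k) * T / real (length l)}"
    using assms(4) len by (simp add: y_def field_simps)
  finally show ?thesis .
qed

text \<open>The packet slot has length \<open>T / length l\<close>, and the integrand vanishes
  outside it, so \<open>g\<close> has to be bounded only while path \<open>i\<close> is served.
  Measurability and boundedness allow the Henstock-Kurzweil integral of \<open>capacity\<close> to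
  be compared with Lebesgue integrals.\<close>

lemma integral_packet_slot:
  fixes g :: "real \<Rightarrow> real"
  assumes l: "distinct l" "i \<in> set l" and T: "0 < T" and g [measurable]: "g \<in> borel_measurable borel"
    and bounds: "0 \<le> a" "\<And>u. path_at l T u = i \<Longrightarrow> a \<le> g u" "\<And>u. path_at l T u = i \<Longrightarrow> g u \<le> b"
  shows "a * T / real (length l) \<le> integral {0..T} (\<lambda>u. if path_at l T u = i then g u else 0)"
    and "integral {0..T} (\<lambda>u. if path_at l T u = i then g u else 0) \<le> b * T / real (length l)"
proof -
  obtain k where k: "k < length l" "l ! k = i" using l(2) by (auto simp: in_set_conv_nth)
  define L where "L = real (length l)"
  define f where "f u = (if path_at l T u = i then g u else 0)" for u
  define J where "J = {real k * T / L..<real (Suc k) * T / L}"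
  have L: "0 < L" using k by (auto simp: L_def)
  have Jsub: "J \<subseteq> {0..<T}"
  proof -
    have "real (Suc k) * T / L \<le> L * T / L"
      using k(1) T L by (intro divide_right_mono mult_right_mono) (auto simp: L_def)
    then show ?thesis using L T by (auto simp: J_def)
  qed
  have J: "u \<in> J \<longleftrightarrow> path_at l T u = i" if "0 \<le> u" "u < T" for u
    using path_at_eq_iff[OF l(1) k T that] by (simp add: J_def L_def)
  have lenJ: "measure lborel J = T / L"
    using T L by (subst J_def, subst measure_lborel_Ico) (auto simp: field_simps)
  have [measurable]: "f \<in> borel_measurable borel"
    unfolding f_def by measurable
  have f: "0 \<le> f u" for u
    using bounds(1) bounds(2)[of u] by (auto simp: f_def intro: order_trans)
  \<comment> \<open>The left end of the packet slot is a time at which path \<open>i\<close> is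
    served; it yields \<open>0 \<le> a \<le> b\<close>.\<close>
  define u0 where "u0 = real k * T / L"
  have "u0 \<in> J" using T L by (auto simp: J_def u0_def intro: divide_strict_right_mono)
  then have "path_at l T u0 = i" using J Jsub by (meson atLeastLessThan_iff subsetD)
  then have b: "0 \<le> b" using bounds(1) bounds(2,3)[of u0] by linarith
  have fb: "f u \<le> b" for u using bounds(3)[of u] b by (auto simp: f_def)
  have int: "set_integrable lborel {0..T} f"
    unfolding set_integrable_def
  proof (rule Bochner_Integration.integrable_bound)
    show "integrable lborel (\<lambda>u. indicator {0..T} u *\<^sub>R b)"
      using T by (intro integrable_scaleR_left integrable_real_indicator) auto
    show "AE u in lborel. norm (indicator {0..T} u *\<^sub>R f u) \<le> norm (indicator {0..T} u *\<^sub>R b)"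
      using f fb b by (auto intro!: AE_I2 simp: indicator_def)
  qed measurable
  have eq: "integral {0..T} f = (\<integral>u. indicator {0..T} u *\<^sub>R f u \<partial>lborel)"
    using set_borel_integral_eq_integral(2)[OF int] by (simp add: set_lebesgue_integral_def)
  have intJ: "integrable lborel (\<lambda>u. c * indicator J u)" for c :: real
    unfolding J_def using T L
    by (intro integrable_mult_right integrable_real_indicator) (auto simp: emeasure_lborel_Ico divide_right_mono mult_right_mono)
  have "a * T / L = (\<integral>u. a * indicator J u \<partial>lborel)"
    by (simp add: lenJ)
  also have "\<dots> \<le> (\<integral>u. indicator {0..T} u *\<^sub>R f u \<partial>lborel)"
  proof (rule integral_mono[OF intJ])
    show "integrable lborel (\<lambda>u. indicator {0..T} u *\<^sub>R f u)"
      using int by (simp add: set_integrable_def)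
    fix u
    show "a * indicator J u \<le> indicator {0..T} u *\<^sub>R f u"
    proof (cases "u \<in> J")
      case True
      then have "u \<in> {0..<T}" "path_at l T u = i" using Jsub J by (meson atLeastLessThan_iff subsetD)+
      then show ?thesis using True bounds(2) by (simp add: f_def)
    next
      case False
      then show ?thesis using f by (simp add: indicator_def)
    qed
  qed
  finally have "a * T / L \<le> integral {0..T} f" unfolding eq .
  then show "a * T / real (length l) \<le> integral {0..T} (\<lambda>u. if path_at l T u = i then g u else 0)"
    by (simp only: f_def[abs_def] L_def)
  have "(\<integral>u. indicator {0..T} u *\<^sub>R f u \<partial>lborel) \<le> (\<integral>u. b * indicator J u \<partial>lborel)"
  proof (rule integral_mono_AE[OF _ intJ])
    show "integrable lborel (\<lambda>u. indicator {0..T} u *\<^sub>R f u)"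
      using int by (simp add: set_integrable_def)
    show "AE u in lborel. indicator {0..T} u *\<^sub>R f u \<le> b * indicator J u"
      \<comment> \<open>At the right end point \<open>path_at\<close> reads beyond the list and its
        value is unspecified. That single point is a null set.\<close>
      using AE_lborel_singleton[of T]
    proof eventually_elim
      case (elim u)
      show ?case
      proof (cases "u \<in> {0..<T} \<and> path_at l T u = i")
        case True
        then have "u \<in> J" using J by simp
        then show ?thesis using fb[of u] b by (simp add: indicator_def)
      next
        case False
        then have "u \<notin> {0..T} \<or> f u = 0" using elim by (auto simp: f_def)
        then show ?thesis using b by (auto simp: indicator_def)
      qed
    qed
  qed
  also have "\<dots> = b * T / L" by (simp add: lenJ)
  finally have "integral {0..T} f \<le> b * T / L" unfolding eq .
  then show "integral {0..T} (\<lambda>u. if path_at l T u = i then g u else 0) \<le> b * T / real (length l)"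
    by (simp only: f_def[abs_def] L_def)
qed

text \<open>In units of secondary cells the primary transmitter lies in
  \<open>[i * r, (i + 1) * r]\<close>, and the block covers
  \<open>[(i - 1) * r, (i + 2) * r]\<close>; the 2 added to its width makes up for the two floors.
  The receiver, in column \<open>e\<close>, may be one column closer than the transmitter column
  \<open>k\<close>. What remains is \<open>r - 1\<close>, at least \<open>r / 2\<close> because
  \<open>r \<ge> 2\<close>.\<close>

lemma coordinate_gap:
  fixes r x z :: real and i k e :: int
  assumes "real qs = r * real qp" "2 \<le> r" "0 < qp"
    and x: "\<lfloor>real qp * x\<rfloor> = i" and z: "\<lfloor>real qs * z\<rfloor> = e" and "\<bar>e - k\<bar> \<le> 1"
    and k: "k \<notin> {\<lfloor>(real_of_int i - 1) * r\<rfloor>..<\<lfloor>(real_of_int i - 1) * r\<rfloor> + (\<lfloor>3 * r\<rfloor> + 2)}"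
  shows "1 / (2 * real qp) \<le> \<bar>x - z\<bar>"
proof -
  have x1: "real_of_int i \<le> real qp * x" "real qp * x \<le> real_of_int i + 1" using x by linarith+
  have "r * real_of_int i \<le> r * (real qp * x)" "r * (real qp * x) \<le> r * (real_of_int i + 1)"
    using x1 assms(2) by (simp_all add: mult_left_mono)
  then have xs: "r * real_of_int i \<le> real qs * x" "real qs * x \<le> r * real_of_int i + r"
    by (simp_all add: assms(1) algebra_simps)
  have zs: "real_of_int e \<le> real qs * z" "real qs * z < real_of_int e + 1" using z by linarith+
  have e: "real_of_int e \<le> real_of_int k + 1" "real_of_int k - 1 \<le> real_of_int e" using assms(6) by linarith+
  have ri: "(real_of_int i - 1) * r = r * real_of_int i - r" by (simp add: algebra_simps)
  consider "k < \<lfloor>r * real_of_int i - r\<rfloor>" | "\<lfloor>r * real_of_int i - r\<rfloor> + (\<lfloor>3 * r\<rfloor> + 2) \<le> k"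
    using k unfolding ri by force
  then have "r / 2 \<le> \<bar>real qs * x - real qs * z\<bar>"
  proof cases
    case 1
    then have "real_of_int k + 1 \<le> r * real_of_int i - r" by linarith
    then show ?thesis using xs zs e assms(2) by argo
  next
    case 2
    then have "r * real_of_int i + 2 * r \<le> real_of_int k" by linarith
    then show ?thesis using xs zs e assms(2) by argo
  qed
  also have "\<dots> = real qs * \<bar>x - z\<bar>"
    by (metis abs_mult abs_of_nat right_diff_distrib)
  also have "\<dots> = r * (real qp * \<bar>x - z\<bar>)" by (simp add: assms(1))
  finally have "1 / 2 \<le> real qp * \<bar>x - z\<bar>" using assms(2) by simp
  then show ?thesis using assms(3) by (simp add: field_simps)
qed

text \<open>The columns \<open>i\<close> whose block contains \<open>k\<close> satisfy
  \<open>(k - 1) / r - 2 \<le> i < (k + 1) / r + 1\<close>. This interval has length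
  \<open>3 + 2 / r \<le> 4\<close>, so they are among the four integers from \<open>i0\<close> on,
  and the residue of \<open>i0 + 4\<close> is free.\<close>

lemma ex_clear_residue:
  fixes r :: real and k :: int
  assumes "2 \<le> r"
  shows "\<exists>\<rho>\<in>{0..<5}. \<forall>i. i mod 5 = \<rho> \<longrightarrow>
    k \<notin> {\<lfloor>(real_of_int i - 1) * r\<rfloor>..<\<lfloor>(real_of_int i - 1) * r\<rfloor> + (\<lfloor>3 * r\<rfloor> + 2)}"
proof -
  define i0 where "i0 = \<lceil>(real_of_int k - 1) / r - 2\<rceil>"
  have "i \<in> {i0..<i0 + 4}"
    if "k \<in> {\<lfloor>(real_of_int i - 1) * r\<rfloor>..<\<lfloor>(real_of_int i - 1) * r\<rfloor> + (\<lfloor>3 * r\<rfloor> + 2)}" for i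
  proof -
    have ri: "(real_of_int i - 1) * r = r * real_of_int i - r" by (simp add: algebra_simps)
    have "\<lfloor>r * real_of_int i - r\<rfloor> \<le> k" "k < \<lfloor>r * real_of_int i - r\<rfloor> + (\<lfloor>3 * r\<rfloor> + 2)"
      using that unfolding ri by auto
    then have "r * real_of_int i - r < real_of_int k + 1" "real_of_int k - 1 \<le> r * real_of_int i + 2 * r"
      by linarith+
    then have 1: "real_of_int i < (real_of_int k + 1) / r + 1" "(real_of_int k - 1) / r - 2 \<le> real_of_int i"
      using assms by (simp_all add: field_simps)
    have "(real_of_int k + 1) / r = (real_of_int k - 1) / r + 2 / r"
      by (simp add: add_divide_distrib[symmetric])
    moreover have "2 / r \<le> 1" using assms by simp
    ultimately have "real_of_int i < (real_of_int k - 1) / r - 2 + 4" using 1 by linarith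
    then have "i < i0 + 4" unfolding i0_def by linarith
    moreover have "i0 \<le> i" unfolding i0_def using 1(2) by (simp only: ceiling_le_iff)
    ultimately show ?thesis by simp
  qed
  moreover have "i \<notin> {i0..<i0 + 4}" if "i mod 5 = (i0 + 4) mod 5" for i
    using that by (simp, presburger)
  ultimately show ?thesis by (intro bexI[of _ "(i0 + 4) mod 5"]) (blast, simp)
qed

lemma log2_mono: "0 < x \<Longrightarrow> x \<le> y \<Longrightarrow> log 2 x \<le> log 2 y"
  by simp

subsection \<open>Throughput of a regular realization\<close>

text \<open>\<open>4 powr (- \<alpha>)\<close> is the loss over the longest possible hop, 4 cell
  sides by \<open>dist_le_cell_dist\<close>, against the full interference of both networks. In
  \<open>max_rate\<close>, \<open>4 powr \<alpha>\<close> belongs to a hop of a quarter of a cell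
  side, with noise alone.\<close>

definition min_rate :: "real \<Rightarrow> real \<Rightarrow> real \<Rightarrow> real \<Rightarrow> real" where
  "min_rate \<alpha> N0 P0 P1 =
     log 2 (1 + P1 * 4 powr (- \<alpha>) / (N0 + (P1 * interference_sum \<alpha> + P0 * interference_sum \<alpha>)))"

definition max_rate :: "real \<Rightarrow> real \<Rightarrow> real \<Rightarrow> real" where
  "max_rate \<alpha> N0 P1 = log 2 (1 + P1 * 4 powr \<alpha> / N0)"

lemma min_rate_pos:
  assumes "0 < N0" "0 < P0" "0 < P1"
  shows "0 < min_rate \<alpha> N0 P0 P1"
proof -
  have "0 < N0 + (P1 * interference_sum \<alpha> + P0 * interference_sum \<alpha>)"
    using assms interference_sum_nonneg[of \<alpha>] by (intro add_pos_nonneg) auto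
  then have "0 < P1 * 4 powr (- \<alpha>) / (N0 + (P1 * interference_sum \<alpha> + P0 * interference_sum \<alpha>))"
    using assms by simp
  then show ?thesis unfolding min_rate_def by (simp add: zero_less_log_cancel_iff)
qed

lemma max_rate_pos: "0 < N0 \<Longrightarrow> 0 < P1 \<Longrightarrow> 0 < max_rate \<alpha> N0 P1"
  by (simp add: max_rate_def zero_less_log_cancel_iff add_pos_pos)

text \<open>The deterministic conditions behind both bounds. Occupied cells make every relay node an
  actual node of its cell. The condition \<open>separated\<close> is needed because
  \<open>0 powr (- \<alpha>) = 0\<close>: if source and destination coincided, their direct hop
  would have rate 0.\<close>

locale regular_overlay = overlay +
  assumes alpha: "\<alpha> > 2" and N0: "N0 > 0" and P0: "P0 > 0" and P1: "P1 > 0" and tp: "tp > 0"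
    and qp: "0 < qp" and qs: "2 * qp \<le> qs"
    and prim_occupied: "\<And>c. c \<in> grid qp \<Longrightarrow> nodes_in qp wp c \<noteq> []"
    and sec_occupied: "\<And>c. c \<in> grid qs \<Longrightarrow> nodes_in qs ws c \<noteq> []"
    and inside: "\<And>i. i < num_pairs ws \<Longrightarrow> pos ws (source ws i) \<in> unit_square"
      "\<And>i. i < num_pairs ws \<Longrightarrow> pos ws (dest ws i) \<in> unit_square"
    and separated: "\<And>i. i < num_pairs ws \<Longrightarrow> pos ws (source ws i) \<noteq> pos ws (dest ws i)"
begin

lemma qs_pos: "0 < qs"
  using qp qs by linarith

lemma ts_pos: "0 < ts"
  using tp by (simp add: ts_def)

definition side_ratio :: real where
  "side_ratio = real qs / real qp"

lemma min_rate_nonneg: "0 \<le> min_rate \<alpha> N0 P0 P1"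
  using min_rate_pos[OF N0 P0 P1, of \<alpha>] by simp

lemma max_rate_nonneg: "0 \<le> max_rate \<alpha> N0 P1"
  using max_rate_pos[OF N0 P1, of \<alpha>] by simp

lemma side_ratio: "real qs = side_ratio * real qp" "2 \<le> side_ratio"
proof -
  have "2 * real qp \<le> real qs" using qs by (metis of_nat_le_iff of_nat_mult of_nat_numeral)
  then show "real qs = side_ratio * real qp" "2 \<le> side_ratio"
    using qp by (simp_all add: side_ratio_def field_simps)
qed

lemma sqrt_cell_area_ratio: "sqrt (cell_area qp / cell_area qs) = side_ratio"
  using qs_pos qp by (simp add: cell_area_def side_ratio_def real_sqrt_divide)

lemma preservation_region_iff:
  "c \<in> preservation_region c' \<longleftrightarrow>
    fst c \<in> {\<lfloor>(real_of_int (fst c') - 1) * side_ratio\<rfloor>..<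
      \<lfloor>(real_of_int (fst c') - 1) * side_ratio\<rfloor> + (\<lfloor>3 * side_ratio\<rfloor> + 2)} \<and>
    snd c \<in> {\<lfloor>(real_of_int (snd c') - 1) * side_ratio\<rfloor>..<
      \<lfloor>(real_of_int (snd c') - 1) * side_ratio\<rfloor> + (\<lfloor>3 * side_ratio\<rfloor> + 2)}"
  by (simp add: preservation_region_def Let_def region_width_def sqrt_cell_area_ratio mem_Times_iff)

text \<open>One primary slot contains 25 secondary slots and one primary frame has 25 slots. The set
  of active primary cells depends on time only through the schedule.\<close>

lemma sec_may_transmit_periodic: "sec_may_transmit c (t + 625 * j) = sec_may_transmit c t"
proof -
  have "(t + 625 * j) div 25 = t div 25 + 25 * j" by simp
  then have "prim_active ((t + 625 * j) div 25) = prim_active (t div 25)"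
    by (simp add: prim_active_def prim_may_transmit_def scheduled_periodic)
  moreover have "scheduled c (t + 625 * j) = scheduled c t"
    using scheduled_periodic[of c t "25 * j"] by simp
  ultimately show ?thesis by (simp add: sec_may_transmit_def)
qed

text \<open>
  The preservation regions leave one of the five primary columns of a cluster harmless for a given
  secondary cell: their columns cover an interval of length at most 4 in units of primary cells.
\<close>

lemma ex_sec_may_transmit:
  assumes "c \<in> grid qs"
  shows "\<exists>t. sec_may_transmit c t"
proof -
  obtain \<rho> where \<rho>: "\<rho> \<in> {0..<5}" and clear: "\<And>i. i mod 5 = \<rho> \<Longrightarrow>
    fst c \<notin> {\<lfloor>(real_of_int i - 1) * side_ratio\<rfloor>..<
      \<lfloor>(real_of_int i - 1) * side_ratio\<rfloor> + (\<lfloor>3 * side_ratio\<rfloor> + 2)}"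
    using ex_clear_residue[OF side_ratio(2)] by metis
  define s where "s = nat (fst c mod 5 + 5 * (snd c mod 5))"
  have "fst c mod 5 + 5 * (snd c mod 5) \<in> {0..<25}" by auto
  then have s: "s < 25" "int s = fst c mod 5 + 5 * (snd c mod 5)"
    by (simp_all add: s_def)
  \<comment> \<open>In primary slot \<open>\<rho> < 5\<close> the base 5 digits force abscissa
    residue \<open>\<rho>\<close> and ordinate residue 0, so all active primary cells lie in the
    harmless columns. Within it, \<open>s\<close> is the secondary slot of \<open>c\<close>
    itself.\<close>
  define t where "t = 25 * nat \<rho> + s"
  have t: "t mod 25 = s" "t div 25 = nat \<rho>" using s by (simp_all add: t_def)
  have "c \<notin> preservation_region c'" if "c' \<in> prim_active (t div 25)" for c'
  proof -
    have "fst c' mod 5 + 5 * (snd c' mod 5) = \<rho>"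
      using that \<rho> by (auto simp: t prim_active_def prim_may_transmit_def scheduled_def zmod_int)
    moreover have "0 \<le> fst c' mod 5" "0 \<le> snd c' mod 5" by simp_all
    ultimately have "fst c' mod 5 = \<rho>"
      using \<rho> unfolding atLeastLessThan_iff by presburger
    then show ?thesis using clear unfolding preservation_region_iff by blast
  qed
  moreover have "scheduled c t" using t s by (simp add: scheduled_def)
  ultimately show ?thesis using assms by (auto simp: sec_may_transmit_def)
qed

section \<open>Interference and rate at a receiver\<close>

lemma sec_power_eq: "sec_power = P1 * real qs powr (- \<alpha>)"
  by (simp add: sec_power_def cell_area_powr[OF qs_pos])

lemma gain_nonneg: "0 \<le> gain r"
  by (simp add: gain_def)

lemma power_nonneg: "0 \<le> sec_power" "0 \<le> prim_power"
  using P0 P1 by (simp_all add: sec_power_def prim_power_def)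

lemma interference_nonneg: "0 \<le> interference t u c z"
  unfolding interference_def
  by (intro add_nonneg_nonneg sum_nonneg mult_nonneg_nonneg gain_nonneg power_nonneg)

lemma sec_rate_nonneg: "0 \<le> sec_rate t u c z"
proof -
  have "0 \<le> sec_power * gain (dist (sec_tx_pos t u c) z) / (N0 + interference t u c z)"
    using N0 interference_nonneg[of t u c z]
    by (intro divide_nonneg_nonneg mult_nonneg_nonneg gain_nonneg power_nonneg) auto
  then show ?thesis by (simp add: sec_rate_def zero_le_log_cancel_iff add_pos_nonneg)
qed

lemma finite_active: "finite (sec_active t)" "finite (prim_active p)"
  by (rule finite_subset[OF _ finite_grid[of qs]], auto simp: sec_active_def sec_may_transmit_def)
    (rule finite_subset[OF _ finite_grid[of qp]], auto simp: prim_active_def prim_may_transmit_def)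

lemma cell_of_sec_tx_pos:
  assumes "c \<in> grid qs"
  shows "cell_of qs (sec_tx_pos t u c) = c"
  unfolding sec_tx_pos_def sec_relay_def by (rule cell_of_transmitter[OF sec_occupied[OF assms]])

lemma cell_of_prim_tx_pos:
  assumes "c \<in> grid qp"
  shows "cell_of qp (prim_tx_pos p u c) = c"
  unfolding prim_tx_pos_def by (rule cell_of_transmitter[OF prim_occupied[OF assms]])

text \<open>Other active cells are at distance at least 5 from \<open>c\<close>, hence at least 4
  from the cell of the receiver, which is \<open>c\<close> or a neighbor of it.\<close>

lemma sec_interference_le:
  assumes "sec_may_transmit c t" "cell_dist (cell_of qs z) c \<le> 1"
  shows "(\<Sum>c' \<in> sec_active t - {c}. sec_power * gain (dist (sec_tx_pos t u c') z))
    \<le> P1 * interference_sum \<alpha>"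
  unfolding sec_power_def gain_def
proof (rule sum_interference_le[where d = "cell_of qs z"])
  fix c' assume c': "c' \<in> sec_active t - {c}"
  then have "c' \<in> grid qs" "scheduled c' t" "scheduled c t" "c' \<noteq> c"
    using assms(1) by (auto simp: sec_active_def sec_may_transmit_def)
  define D where "D = cell_dist c' (cell_of qs z)"
  have "5 \<le> cell_dist c' c"
    by (rule scheduled_same_slot_far[of _ t]) (use \<open>c' \<noteq> c\<close> in \<open>auto intro: \<open>scheduled c t\<close> \<open>scheduled c' t\<close>\<close>)
  then have "4 \<le> D"
    using cell_dist_triangle[of c' c "cell_of qs z"] assms(2) by (simp add: D_def)
  then have "(1 + real_of_int D) / (4 * real qs) \<le> (real_of_int D - 1) / real qs"
    using qs_pos by (simp add: field_simps)
  also have "\<dots> \<le> dist (sec_tx_pos t u c') z"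
    using dist_ge_cell_dist[OF qs_pos, of "sec_tx_pos t u c'" z] cell_of_sec_tx_pos[OF \<open>c' \<in> grid qs\<close>]
    by (simp add: D_def)
  finally show "(1 + real_of_int (cell_dist c' (cell_of qs z))) / (4 * real qs) \<le> dist (sec_tx_pos t u c') z"
    by (simp add: D_def)
qed (use alpha P1 qs_pos finite_active in auto)

lemma prim_interference_le:
  assumes "sec_may_transmit c t" "cell_dist (cell_of qs z) c \<le> 1"
  shows "(\<Sum>c' \<in> prim_active (t div 25). prim_power * gain (dist (prim_tx_pos (t div 25) u c') z))
    \<le> P0 * interference_sum \<alpha>"
  unfolding prim_power_def gain_def
proof (rule sum_interference_le[where d = "cell_of qp z"])
  fix c' assume c': "c' \<in> prim_active (t div 25)"
  define x where "x = prim_tx_pos (t div 25) u c'"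
  have "c' \<in> grid qp" "c \<notin> preservation_region c'"
    using assms(1) c' unfolding sec_may_transmit_def prim_active_def prim_may_transmit_def by blast+
  then have x: "cell_of qp x = c'" by (simp add: x_def cell_of_prim_tx_pos)
  have near: "\<bar>\<lfloor>real qs * fst z\<rfloor> - fst c\<bar> \<le> 1" "\<bar>\<lfloor>real qs * snd z\<rfloor> - snd c\<bar> \<le> 1"
    using assms(2) by (auto simp: cell_dist_def cell_of_def)
  have xf: "\<lfloor>real qp * fst x\<rfloor> = fst c'" "\<lfloor>real qp * snd x\<rfloor> = snd c'"
    using x by (auto simp: cell_of_def)
  \<comment> \<open>A cell outside a square block is outside its range in at least one coordinate,
    and a gap in that coordinate is enough.\<close>
  have "1 / (2 * real qp) \<le> \<bar>fst x - fst z\<bar> \<or> 1 / (2 * real qp) \<le> \<bar>snd x - snd z\<bar>"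
    using \<open>c \<notin> preservation_region c'\<close> coordinate_gap[OF side_ratio qp xf(1) refl near(1)]
      coordinate_gap[OF side_ratio qp xf(2) refl near(2)]
    unfolding preservation_region_iff by blast
  then have 1: "1 / (2 * real qp) \<le> dist x z"
    using dist_prod_ge[of x z] by linarith
  define D where "D = cell_dist c' (cell_of qp z)"
  have 2: "(real_of_int D - 1) / real qp \<le> dist x z"
    using dist_ge_cell_dist[OF qp, of x z] x by (simp add: D_def)
  have "0 \<le> D" by (simp add: D_def)
  \<comment> \<open>For \<open>D \<le> 1\<close> the cells may touch and only the gap from the
    preservation region helps. For \<open>D \<ge> 2\<close> the distance between the primary cells
    is enough.\<close>
  then have "D \<le> 1 \<or> 2 \<le> D" by linarith
  then have "1 + real_of_int D \<le> 2 \<or> 1 + real_of_int D \<le> 4 * (real_of_int D - 1)" by auto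
  then have "(1 + real_of_int D) / (4 * real qp) \<le> 1 / (2 * real qp)
    \<or> (1 + real_of_int D) / (4 * real qp) \<le> (real_of_int D - 1) / real qp"
    using qp by (simp add: field_simps)
  then have "(1 + real_of_int D) / (4 * real qp) \<le> dist x z" using 1 2 by linarith
  then show "(1 + real_of_int (cell_dist c' (cell_of qp z))) / (4 * real qp)
    \<le> dist (prim_tx_pos (t div 25) u c') z"
    by (simp add: D_def x_def)
qed (use alpha P0 qp finite_active in auto)

lemma sec_rate_ge:
  assumes "sec_may_transmit c t" "cell_dist (cell_of qs z) c \<le> 1" "sec_tx_pos t u c \<noteq> z"
  shows "min_rate \<alpha> N0 P0 P1 \<le> sec_rate t u c z"
proof -
  define x where "x = sec_tx_pos t u c"
  have "cell_of qs x = c"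
    using assms(1) by (simp add: x_def cell_of_sec_tx_pos sec_may_transmit_def)
  then have "dist x z \<le> 2 * (real_of_int (cell_dist (cell_of qs z) c) + 1) / real qs"
    using dist_le_cell_dist[OF qs_pos, of x z] by (simp add: cell_dist_commute)
  also have "\<dots> \<le> 4 / real qs"
    using assms(2) qs_pos by (intro divide_right_mono) auto
  finally have "(4 / real qs) powr (- \<alpha>) \<le> gain (dist x z)"
    unfolding gain_def using alpha assms(3) by (intro powr_mono2') (auto simp: x_def)
  moreover have "(4 / real qs) powr (- \<alpha>) = 4 powr (- \<alpha>) * real qs powr \<alpha>"
    using qs_pos by (simp add: powr_divide powr_minus field_simps)
  ultimately have "P1 * real qs powr (- \<alpha>) * (4 powr (- \<alpha>) * real qs powr \<alpha>) \<le> sec_power * gain (dist x z)"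
    unfolding sec_power_eq using P1 by (intro mult_left_mono) auto
  then have s: "P1 * 4 powr (- \<alpha>) \<le> sec_power * gain (dist x z)"
    using qs_pos by (simp add: powr_minus field_simps)
  have i: "interference t u c z \<le> P1 * interference_sum \<alpha> + P0 * interference_sum \<alpha>"
    unfolding interference_def
    by (intro add_mono sec_interference_le prim_interference_le[OF assms(1,2)] assms(1,2))
  have "P1 * 4 powr (- \<alpha>) / (N0 + (P1 * interference_sum \<alpha> + P0 * interference_sum \<alpha>))
    \<le> sec_power * gain (dist x z) / (N0 + interference t u c z)"
    using s i N0 interference_nonneg[of t u c z] P1
    by (intro frac_le add_left_mono add_pos_nonneg mult_nonneg_nonneg gain_nonneg power_nonneg) auto
  moreover have "0 \<le> P1 * 4 powr (- \<alpha>) / (N0 + (P1 * interference_sum \<alpha> + P0 * interference_sum \<alpha>))"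
    using P0 P1 N0 by (intro divide_nonneg_nonneg add_nonneg_nonneg mult_nonneg_nonneg interference_sum_nonneg) auto
  ultimately show ?thesis
    unfolding min_rate_def sec_rate_def x_def[symmetric] by (intro log2_mono) auto
qed

lemma sec_rate_le:
  assumes "B \<ge> 0" "sec_power * gain (dist (sec_tx_pos t u c) z) \<le> B"
  shows "sec_rate t u c z \<le> log 2 (1 + B / N0)"
proof -
  have "sec_power * gain (dist (sec_tx_pos t u c) z) / (N0 + interference t u c z) \<le> B / N0"
    using assms N0 interference_nonneg[of t u c z] by (intro frac_le) auto
  moreover have "0 \<le> sec_power * gain (dist (sec_tx_pos t u c) z) / (N0 + interference t u c z)"
    using N0 interference_nonneg[of t u c z]
    by (intro divide_nonneg_nonneg mult_nonneg_nonneg gain_nonneg power_nonneg) auto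
  ultimately show ?thesis unfolding sec_rate_def by (intro log2_mono) auto
qed

text \<open>Within a slot the rate changes only with the packets being served: it depends on
  \<open>u\<close> through finitely many values \<open>path_at\<close>, each measurable into a
  discrete space. The offset \<open>a\<close> accounts for the position of the secondary slot in the
  primary one.\<close>

lemma sec_rate_measurable [measurable]: "(\<lambda>u. sec_rate t u c z) \<in> borel_measurable borel"
proof -
  have tx: "(\<lambda>u. f (path_at l T (a + u))) \<in> borel_measurable borel" for f :: "nat \<Rightarrow> real" and l T a
  proof -
    have "(\<lambda>u. path_at l T (a + u)) \<in> measurable borel (count_space UNIV)" by measurable
    then show ?thesis by (rule measurable_compose) simp
  qed
  have "(\<lambda>u. gain (dist (sec_tx_pos t u c) z)) \<in> borel_measurable borel" for c
    using tx[of "\<lambda>i. gain (dist (pos ws (transmitter qs ws c (sec_relay c t) i)) z)" _ _ 0]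
    by (simp add: sec_tx_pos_def)
  moreover have "(\<lambda>u. gain (dist (prim_tx_pos p (a + u) c) z)) \<in> borel_measurable borel" for p a c
    unfolding prim_tx_pos_def by (rule tx)
  ultimately show ?thesis
    unfolding sec_rate_def interference_def by measurable
qed

lemma source_dest_in_grid:
  assumes "i < num_pairs ws"
  shows "source_cell qs ws i \<in> grid qs" "dest_cell qs ws i \<in> grid qs"
  using inside[OF assms] qs_pos by (simp_all add: source_cell_def dest_cell_def cell_of_in_grid)

lemma path_in_grid:
  assumes "i < num_pairs ws" "h < num_hops qs ws i"
  shows "path_cell qs ws i h \<in> grid qs"
  by (intro path_cell_in_grid source_dest_in_grid assms(1) num_hops_le[OF assms(2)])

lemma cell_of_receiver:
  assumes "i < num_pairs ws" "h < path_length qs ws i"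
  shows "cell_of qs (pos ws (receiver i h t)) = path_cell qs ws i (Suc h)"
proof (cases "path_length qs ws i \<le> h + 1")
  case True
  then have "path_length qs ws i = Suc h" using assms(2) by simp
  then show ?thesis
    using path_cell_path_length[of qs ws i] by (simp add: receiver_def dest_cell_def)
next
  case False
  then have "path_cell qs ws i (Suc h) \<in> grid qs"
    by (intro path_in_grid assms) (simp add: num_hops_def)
  then show ?thesis using False
    by (simp add: receiver_def sec_relay_def cell_of_relay[OF sec_occupied])
qed

lemma receiver_near:
  assumes "i < num_pairs ws" "h < num_hops qs ws i"
  shows "cell_dist (cell_of qs (pos ws (receiver i h t))) (path_cell qs ws i h) \<le> 1"
proof (cases "h < path_length qs ws i")
  case True
  then show ?thesis by (simp add: cell_of_receiver[OF assms(1)] path_cell_Suc)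
next
  case False
  then have "path_length qs ws i = 0" "h = 0" using assms(2) by (auto simp: num_hops_def)
  then show ?thesis
    using path_length_0_iff[of qs ws i] by (simp add: receiver_def dest_cell_def[symmetric] cell_dist_def)
qed

text \<open>A hop along a path of positive length ends in a different cell. In the remaining case
  source and destination share the cell; the hypothesis on \<open>path_at\<close> says that the
  source is transmitting, and \<open>separated\<close> applies.\<close>

lemma receiver_apart:
  assumes "i < num_pairs ws" "h < num_hops qs ws i" "path_at (packets qs ws (path_cell qs ws i h)) ts u = i"
  shows "sec_tx_pos t u (path_cell qs ws i h) \<noteq> pos ws (receiver i h t)"
proof (cases "h < path_length qs ws i")
  case True
  then show ?thesis
    using cell_of_receiver[OF assms(1) True, of t] path_cell_Suc(2)[OF True]
      cell_of_sec_tx_pos[OF path_in_grid[OF assms(1,2)], of t u] by metis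
next
  case False
  then have "path_length qs ws i = 0" "h = 0" using assms(2) by (auto simp: num_hops_def)
  then show ?thesis
    using separated[OF assms(1)] assms(3) by (simp add: receiver_def sec_tx_pos_def transmitter_def)
qed

section \<open>Capacity of a hop in one slot\<close>

lemma capacity_nonneg: "0 \<le> capacity i h t"
proof -
  have "0 \<le> integral {0..ts} (\<lambda>u. if P u then sec_rate t u c z else 0)" for P c z
    by (cases "(\<lambda>u. if P u then sec_rate t u c z else 0) integrable_on {0..ts}")
      (auto intro!: Henstock_Kurzweil_Integration.integral_nonneg sec_rate_nonneg simp: not_integrable_integral)
  then show ?thesis by (simp add: capacity_def Let_def)
qed

lemma sec_rate_le_of_path_at:
  assumes "path_at (packets qs ws c) ts u = i"
    and "B \<ge> 0" "sec_power * gain (dist (pos ws (transmitter qs ws c (sec_relay c t) i)) z) \<le> B"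
  shows "sec_rate t u c z \<le> log 2 (1 + B / N0)"
  using sec_rate_le[of B t u c z] assms by (simp add: sec_tx_pos_def)

lemma capacity_ge:
  assumes "i < num_pairs ws" "h < num_hops qs ws i" "sec_may_transmit (path_cell qs ws i h) t"
  shows "min_rate \<alpha> N0 P0 P1 * ts / real (length (packets qs ws (path_cell qs ws i h))) \<le> capacity i h t"
proof -
  define c where "c = path_cell qs ws i h"
  define z where "z = pos ws (receiver i h t)"
  have i: "i \<in> set (packets qs ws c)" unfolding c_def by (rule path_cell_in_packets[OF assms(1,2)])
  then have active: "c \<in> sec_active t"
    using assms(3) by (auto simp: sec_active_def c_def)
  have "min_rate \<alpha> N0 P0 P1 * ts / real (length (packets qs ws c))
    \<le> integral {0..ts} (\<lambda>u. if path_at (packets qs ws c) ts u = i then sec_rate t u c z else 0)"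
    \<comment> \<open>The upper bound required here is the rate of the fixed transmitter of path
      \<open>i\<close> without interference; it serves only to make the integrand bounded.\<close>
    by (rule integral_packet_slot(1)[OF distinct_packets i ts_pos sec_rate_measurable
          min_rate_nonneg _ sec_rate_le_of_path_at[OF _ mult_nonneg_nonneg[OF power_nonneg(1) gain_nonneg] order_refl]])
      (use assms sec_rate_ge receiver_near receiver_apart in \<open>auto simp: c_def z_def\<close>)
  then show ?thesis
    using active unfolding c_def z_def capacity_def Let_def by simp
qed

lemma capacity_le:
  assumes "i < num_pairs ws" "h < num_hops qs ws i"
    and far: "1 / (4 * real qs) \<le> dist (pos ws (transmitter qs ws (path_cell qs ws i h) (sec_relay (path_cell qs ws i h) t) i))
                (pos ws (receiver i h t))"
  shows "capacity i h t \<le> max_rate \<alpha> N0 P1 * ts / real (length (packets qs ws (path_cell qs ws i h)))"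
proof -
  define c where "c = path_cell qs ws i h"
  define z where "z = pos ws (receiver i h t)"
  define x where "x = pos ws (transmitter qs ws c (sec_relay c t) i)"
  have i: "i \<in> set (packets qs ws c)" unfolding c_def by (rule path_cell_in_packets[OF assms(1,2)])
  have "gain (dist x z) \<le> (1 / (4 * real qs)) powr (- \<alpha>)"
    unfolding gain_def using far alpha qs_pos by (intro powr_mono2') (auto simp: x_def z_def c_def)
  also have "\<dots> = 4 powr \<alpha> * real qs powr \<alpha>"
    using qs_pos by (simp add: powr_divide powr_mult powr_minus field_simps)
  finally have "sec_power * gain (dist x z) \<le> P1 * real qs powr (- \<alpha>) * (4 powr \<alpha> * real qs powr \<alpha>)"
    unfolding sec_power_eq using P1 by (intro mult_left_mono) auto
  then have s: "sec_power * gain (dist x z) \<le> P1 * 4 powr \<alpha>"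
    using qs_pos by (simp add: powr_minus field_simps)
  have "integral {0..ts} (\<lambda>u. if path_at (packets qs ws c) ts u = i then sec_rate t u c z else 0)
    \<le> max_rate \<alpha> N0 P1 * ts / real (length (packets qs ws c))"
    unfolding max_rate_def
    by (rule integral_packet_slot(2)[OF distinct_packets i ts_pos sec_rate_measurable order_refl
          sec_rate_nonneg sec_rate_le_of_path_at])
      (use P1 s in \<open>auto simp: x_def\<close>)
  moreover have "0 \<le> max_rate \<alpha> N0 P1 * ts / real (length (packets qs ws c))"
    using max_rate_nonneg ts_pos by simp
  ultimately show ?thesis
    unfolding c_def z_def capacity_def Let_def by simp
qed

section \<open>Buffers and the flow of bits along a path\<close>

lemma sec_relay_stable:
  assumes "t \<le> t'" "\<And>s. t \<le> s \<Longrightarrow> s < t' \<Longrightarrow> \<not> sec_may_transmit c s"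
  shows "sec_relay c t' = sec_relay c t"
  unfolding sec_relay_def using assms by (intro relay_cong) auto

lemma sent_nonneg: "(\<And>v. 0 \<le> b h v) \<Longrightarrow> 0 \<le> sent i b h t"
  by (simp add: sent_def capacity_nonneg)

lemma buffer_nonneg: "0 \<le> buffer i t h v"
proof (induction t arbitrary: h v)
  case (Suc t)
  have "sent i (buffer i t) h t \<le> buffer i t h (sec_relay (path_cell qs ws i h) t)" if "1 \<le> h"
    using that by (simp add: sent_def)
  moreover have "0 \<le> sent i (buffer i t) (h - 1) t"
    by (rule sent_nonneg) (rule Suc)
  ultimately show ?case using Suc[of h v] by auto
qed simp

text \<open>A relay node sends at most what it had at the beginning of the slot, so the arrivals of
  the slot are still there at its end. While the cell may not transmit, nothing leaves.\<close>

lemma buffer_Suc_ge: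
  assumes "1 \<le> h" "h < num_hops qs ws i" "v = sec_relay (path_cell qs ws i h) t"
  shows "sent i (buffer i t) (h - 1) t \<le> buffer i (Suc t) h v"
    and "\<not> sec_may_transmit (path_cell qs ws i h) t \<Longrightarrow> buffer i t h v \<le> buffer i (Suc t) h v"
proof -
  have "sent i (buffer i t) h t \<le> buffer i t h v"
    using assms by (simp add: sent_def)
  then show "sent i (buffer i t) (h - 1) t \<le> buffer i (Suc t) h v" using assms by simp
  have "0 \<le> sent i (buffer i t) (h - 1) t"
    by (rule sent_nonneg) (rule buffer_nonneg)
  moreover assume "\<not> sec_may_transmit (path_cell qs ws i h) t"
  then have "sent i (buffer i t) h t = 0"
    using assms buffer_nonneg[of i t h v] by (simp add: sent_def capacity_def sec_active_def)
  ultimately show "buffer i t h v \<le> buffer i (Suc t) h v" using assms by simp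
qed

text \<open>
  Whatever the relay node of a cell receives between two transmissions of the cell is forwarded by
  the same node in the second one. So a regular stream of \<open>C\<close> bits per 625 slots propagates
  along the path, whatever the excess bits left in the buffers.
\<close>

lemma steady_flow:
  assumes i: "i < num_pairs ws" and "0 \<le> C"
    and cap: "\<And>h t. h < num_hops qs ws i \<Longrightarrow> sec_may_transmit (path_cell qs ws i h) t \<Longrightarrow> C \<le> capacity i h t"
    and "h < num_hops qs ws i"
  shows "\<exists>t0. \<forall>j. sec_may_transmit (path_cell qs ws i h) (t0 + 625 * j) \<and>
    C \<le> sent i (buffer i (t0 + 625 * j)) h (t0 + 625 * j)"
  using assms(4)
proof (induction h)
  case 0
  obtain t0 where "sec_may_transmit (path_cell qs ws i 0) t0"
    using ex_sec_may_transmit path_in_grid[OF i 0] by blast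
  then have "sec_may_transmit (path_cell qs ws i 0) (t0 + 625 * j)" for j
    by (simp only: sec_may_transmit_periodic)
  then show ?case using cap[OF 0] by (auto simp: sent_def)
next
  case (Suc h)
  define c where "c = path_cell qs ws i (Suc h)"
  obtain t0 where t0: "\<And>j. sec_may_transmit (path_cell qs ws i h) (t0 + 625 * j)"
    "\<And>j. C \<le> sent i (buffer i (t0 + 625 * j)) h (t0 + 625 * j)"
    using Suc by auto
  obtain s where "sec_may_transmit c s"
    using ex_sec_may_transmit path_in_grid[OF i Suc.prems] c_def by blast
  then have ex: "t0 < s + 625 * Suc t0 \<and> sec_may_transmit c (s + 625 * Suc t0)"
    by (simp only: sec_may_transmit_periodic) simp
  \<comment> \<open>The first opportunity of \<open>c\<close> after the upstream slot
    \<open>t0\<close>; by \<open>ex\<close> there is one, obtained by adding periods to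
    \<open>s\<close>. Minimality ensures that the relay node of \<open>c\<close> has not changed in
    between.\<close>
  define t1 where "t1 = (LEAST t. t0 < t \<and> sec_may_transmit c t)"
  have t1: "t0 < t1" "sec_may_transmit c t1"
    using LeastI[of "\<lambda>t. t0 < t \<and> sec_may_transmit c t", OF ex] by (simp_all add: t1_def)
  have idle: "\<not> sec_may_transmit c t" if "t0 < t" "t < t1" for t
    using not_less_Least[of t "\<lambda>t. t0 < t \<and> sec_may_transmit c t"] that by (auto simp: t1_def)
  have "sec_may_transmit c (t1 + 625 * j) \<and> C \<le> sent i (buffer i (t1 + 625 * j)) (Suc h) (t1 + 625 * j)" for j
  proof -
    define a b where "a = t0 + 625 * j" and "b = t1 + 625 * j"
    have ab: "a < b" using t1 by (simp add: a_def b_def)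
    \<comment> \<open>Neighboring cells never share a slot. So \<open>c\<close> is silent also in
      the slot in which it receives, and the receiving node keeps its turn.\<close>
    have "\<not> sec_may_transmit c a"
    proof
      assume "sec_may_transmit c a"
      then have "scheduled c a" "scheduled (path_cell qs ws i h) a"
        using t0(1)[of j] by (auto simp: sec_may_transmit_def a_def)
      moreover have "h < path_length qs ws i" using num_hops_le[OF Suc.prems] by simp
      ultimately show False
        using path_cell_Suc[of h qs ws i] scheduled_same_slot_far[of "path_cell qs ws i h" a c]
        by (auto simp: c_def)
    qed
    moreover have "\<not> sec_may_transmit c s" if "a < s" "s < b" for s
    proof -
      have "t0 < s - 625 * j" "s - 625 * j < t1" "s - 625 * j + 625 * j = s"
        using that by (auto simp: a_def b_def)
      then show ?thesis using idle sec_may_transmit_periodic by metis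
    qed
    ultimately have idle': "\<not> sec_may_transmit c s" if "a \<le> s" "s < b" for s
      using that by (cases "s = a") auto
    define v where "v = sec_relay c a"
    have v: "v = sec_relay c s" if "a \<le> s" "s \<le> b" for s
      unfolding v_def using that idle' by (intro sec_relay_stable[symmetric]) auto
    have "C \<le> buffer i s (Suc h) v" if "Suc a \<le> s" "s \<le> b" for s
      using that
    proof (induction s rule: dec_induct)
      case base
      have "C \<le> sent i (buffer i a) (Suc h - 1) a" using t0(2)[of j] by (simp add: a_def)
      also have "\<dots> \<le> buffer i (Suc a) (Suc h) v"
        using Suc.prems ab by (intro buffer_Suc_ge(1)) (auto simp: v_def c_def)
      finally show ?case .
    next
      case (step s)
      then have "C \<le> buffer i s (Suc h) v" by simp
      also have "\<dots> \<le> buffer i (Suc s) (Suc h) v"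
        using Suc.prems step v[of s] idle'[of s] by (intro buffer_Suc_ge(2)) (auto simp: c_def)
      finally show ?case .
    qed
    then have "C \<le> buffer i b (Suc h) v" using ab by simp
    moreover have tr: "sec_may_transmit c b"
      using t1(2) by (simp add: b_def sec_may_transmit_periodic)
    moreover have "C \<le> capacity i (Suc h) b"
      using cap[OF Suc.prems] tr by (simp add: c_def)
    ultimately show ?thesis
      using v[of b] ab by (simp add: sent_def b_def[symmetric] c_def[symmetric])
  qed
  then show ?case unfolding c_def by blast
qed

lemma liminf_delivered_ge:
  assumes i: "i < num_pairs ws" and "0 \<le> C"
    and cap: "\<And>h t. h < num_hops qs ws i \<Longrightarrow> sec_may_transmit (path_cell qs ws i h) t \<Longrightarrow> C \<le> capacity i h t"
  shows "ereal (C / 625) \<le> liminf (\<lambda>t. ereal (1 / real t * delivered i t))"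
proof -
  define H where "H = num_hops qs ws i - 1"
  have "H < num_hops qs ws i" by (simp add: H_def num_hops_def)
  then obtain t0 where t0: "\<And>j. C \<le> sent i (buffer i (t0 + 625 * j)) H (t0 + 625 * j)"
    using steady_flow[OF i \<open>0 \<le> C\<close> cap] by blast
  have del: "C * (real ((t - t0) div 625)) \<le> delivered i t" for t
  proof -
    define J where "J = (\<lambda>j. t0 + 625 * j) ` {..<(t - t0) div 625}"
    have "J \<subseteq> {..<t}"
    proof
      fix s assume "s \<in> J"
      then obtain j where j: "j < (t - t0) div 625" "s = t0 + 625 * j" by (auto simp: J_def)
      then have "Suc j * 625 \<le> t - t0" by (metis Suc_leI less_eq_div_iff_mult_less_eq zero_less_numeral)
      then show "s \<in> {..<t}" using j by simp
    qed
    have "C * (real ((t - t0) div 625)) = (\<Sum>j<(t - t0) div 625. C)" by simp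
    also have "\<dots> \<le> (\<Sum>j<(t - t0) div 625. sent i (buffer i (t0 + 625 * j)) H (t0 + 625 * j))"
      by (intro sum_mono t0)
    also have "\<dots> = (\<Sum>s\<in>J. sent i (buffer i s) H s)"
      unfolding J_def by (subst sum.reindex) (auto simp: inj_on_def)
    also have "\<dots> \<le> (\<Sum>s<t. sent i (buffer i s) H s)"
      using \<open>J \<subseteq> {..<t}\<close> by (intro sum_mono2 sent_nonneg buffer_nonneg) auto
    finally show ?thesis by (simp add: delivered_def H_def)
  qed
  have "ereal (C / 625) = liminf (\<lambda>t. ereal (1 / real t * (C * ((real t - real t0) / 625 - 1))))"
  proof (rule lim_imp_Liminf[symmetric])
    have "(\<lambda>t. 1 / real t * (C * ((real t - real t0) / 625 - 1))) \<longlonglongrightarrow> C / 625"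
      by real_asymp
    then show "(\<lambda>t. ereal (1 / real t * (C * ((real t - real t0) / 625 - 1)))) \<longlonglongrightarrow> ereal (C / 625)"
      by simp
  qed simp
  also have "\<dots> \<le> liminf (\<lambda>t. ereal (1 / real t * delivered i t))"
  proof (intro Liminf_mono always_eventually allI)
    fix t
    have "real (t - t0) / 625 \<le> real ((t - t0) div 625) + 1"
      using div_mult_mod_eq[of "t - t0" 625] mod_less_divisor[of 625 "t - t0"] by linarith
    moreover have "(real t - real t0) / 625 \<le> real (t - t0) / 625"
      by (intro divide_right_mono) linarith+
    ultimately have "(real t - real t0) / 625 - 1 \<le> real ((t - t0) div 625)"
      unfolding diff_le_eq by (rule order_trans[rotated])
    then have "C * ((real t - real t0) / 625 - 1) \<le> delivered i t"
      using mult_left_mono[OF _ \<open>0 \<le> C\<close>] del[of t] by (meson order_trans)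
    then show "ereal (1 / real t * (C * ((real t - real t0) / 625 - 1))) \<le> ereal (1 / real t * delivered i t)"
      by (simp add: divide_right_mono)
  qed
  finally show ?thesis .
qed

text \<open>Conservation of bits in a cell of the path. Each node of the cell has its own buffer, so
  \<open>V\<close> has to contain every node that has had a turn as relay.\<close>

lemma sum_buffer:
  assumes "1 \<le> h" "h < num_hops qs ws i" "finite V"
    and "\<And>s. s < t \<Longrightarrow> sec_relay (path_cell qs ws i h) s \<in> V"
  shows "(\<Sum>v\<in>V. buffer i t h v) =
    (\<Sum>s<t. sent i (buffer i s) (h - 1) s) - (\<Sum>s<t. sent i (buffer i s) h s)"
  using assms(4)
proof (induction t)
  case (Suc t)
  define r where "r = sec_relay (path_cell qs ws i h) t"
  have r: "r \<in> V" using Suc.prems by (simp add: r_def)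
  have "(\<Sum>v\<in>V. buffer i (Suc t) h v) = buffer i (Suc t) h r + (\<Sum>v\<in>V - {r}. buffer i (Suc t) h v)"
    by (rule sum.remove[OF assms(3) r])
  also have "(\<Sum>v\<in>V - {r}. buffer i (Suc t) h v) = (\<Sum>v\<in>V - {r}. buffer i t h v)"
    by (rule sum.cong) (auto simp: r_def)
  also have "buffer i (Suc t) h r = buffer i t h r - sent i (buffer i t) h t + sent i (buffer i t) (h - 1) t"
    using assms(1,2) by (simp add: r_def)
  finally have "(\<Sum>v\<in>V. buffer i (Suc t) h v) =
    (\<Sum>v\<in>V. buffer i t h v) - sent i (buffer i t) h t + sent i (buffer i t) (h - 1) t"
    using sum.remove[OF assms(3) r, of "buffer i t h"] by simp
  then show ?case using Suc by simp
qed simp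

text \<open>The content of the buffers is nonnegative, so no cell has sent more than it received.
  Going back hop by hop reaches the source.\<close>

lemma sum_sent_le:
  assumes "h < num_hops qs ws i"
  shows "(\<Sum>s<t. sent i (buffer i s) h s) \<le> (\<Sum>s<t. sent i (buffer i s) 0 s)"
  using assms
proof (induction h)
  case (Suc h)
  define V where "V = sec_relay (path_cell qs ws i (Suc h)) ` {..<t}"
  have "0 \<le> (\<Sum>v\<in>V. buffer i t (Suc h) v)" by (intro sum_nonneg buffer_nonneg)
  also have "\<dots> = (\<Sum>s<t. sent i (buffer i s) h s) - (\<Sum>s<t. sent i (buffer i s) (Suc h) s)"
    using sum_buffer[of "Suc h" i V t] Suc.prems by (simp add: V_def)
  finally show ?case using Suc by simp
qed simp

lemma liminf_delivered_le:
  assumes "\<And>t. capacity i 0 t \<le> B"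
  shows "liminf (\<lambda>t. ereal (1 / real t * delivered i t)) \<le> ereal B"
proof -
  have "delivered i t \<le> real t * B" for t
  proof -
    have "delivered i t \<le> (\<Sum>s<t. sent i (buffer i s) 0 s)"
      unfolding delivered_def by (rule sum_sent_le) (simp add: num_hops_def)
    also have "\<dots> \<le> (\<Sum>s<t. B)" by (intro sum_mono) (simp add: sent_def assms)
    finally show ?thesis by simp
  qed
  then have "\<forall>\<^sub>F t in sequentially. ereal (1 / real t * delivered i t) \<le> ereal B"
    by (intro eventually_mono[OF eventually_gt_at_top[of 0]]) (simp add: field_simps)
  then have "limsup (\<lambda>t. ereal (1 / real t * delivered i t)) \<le> ereal B"
    by (rule Limsup_bounded)
  then show ?thesis using Liminf_le_Limsup[of sequentially] by (meson order_trans sequentially_bot)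
qed

section \<open>From the load of cells to the throughput\<close>

lemma throughput_ge:
  assumes "\<And>c. c \<in> grid qs \<Longrightarrow> real (length (packets qs ws c)) \<le> L"
  shows "ereal (min_rate \<alpha> N0 P0 P1 * ts / L / 625) \<le> throughput_per_pair"
  unfolding throughput_per_pair_def
proof (intro INF_greatest liminf_delivered_ge)
  fix i assume "i \<in> {..<num_pairs ws}"
  then show i: "i < num_pairs ws" by simp
  have c: "path_cell qs ws i 0 \<in> grid qs" using source_dest_in_grid[OF i] by simp
  have "0 \<le> L" using assms[OF c] by (meson of_nat_0_le_iff order_trans)
  then show "0 \<le> min_rate \<alpha> N0 P0 P1 * ts / L"
    using min_rate_nonneg ts_pos by simp
  fix h t assume h: "h < num_hops qs ws i" "sec_may_transmit (path_cell qs ws i h) t"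
  define l where "l = length (packets qs ws (path_cell qs ws i h))"
  have "0 < l" using path_cell_in_packets[OF i h(1)] by (auto simp: l_def)
  then have "min_rate \<alpha> N0 P0 P1 * ts / L \<le> min_rate \<alpha> N0 P0 P1 * ts / real l"
    using assms[OF path_in_grid[OF i h(1)]] min_rate_nonneg ts_pos
    by (intro divide_left_mono mult_nonneg_nonneg mult_pos_pos) (simp_all add: l_def del: length_greater_0_conv)
  also have "\<dots> \<le> capacity i h t" unfolding l_def by (rule capacity_ge[OF i h])
  finally show "min_rate \<alpha> N0 P0 P1 * ts / L \<le> capacity i h t" .
qed

text \<open>One pair bounds the infimum. It delivers no more than its source sends, and the source
  shares its slot with at least \<open>L\<close> paths. Every slot is counted as if the cell were
  active in it, which costs only a constant.\<close>

lemma throughput_le: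
  assumes i: "i < num_pairs ws" and "source_cell qs ws i \<noteq> dest_cell qs ws i"
    and central: "\<And>z. cell_of qs z \<noteq> source_cell qs ws i \<Longrightarrow> 1 / (4 * real qs) \<le> dist (pos ws (source ws i)) z"
    and L: "0 < L" "L \<le> real (length (packets qs ws (source_cell qs ws i)))"
  shows "throughput_per_pair \<le> ereal (max_rate \<alpha> N0 P1 * ts / L)"
  unfolding throughput_per_pair_def
proof (rule INF_lower2)
  show "i \<in> {..<num_pairs ws}" using i by simp
  show "liminf (\<lambda>t. ereal (1 / real t * delivered i t)) \<le> ereal (max_rate \<alpha> N0 P1 * ts / L)"
  proof (rule liminf_delivered_le)
    fix t
    have len: "0 < path_length qs ws i" using path_length_0_iff[of qs ws i] assms(2) by auto
    have "capacity i 0 t \<le> max_rate \<alpha> N0 P1 * ts / real (length (packets qs ws (path_cell qs ws i 0)))"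
    proof (rule capacity_le[OF i])
      show "0 < num_hops qs ws i" using len by (simp add: num_hops_def)
      have "cell_of qs (pos ws (receiver i 0 t)) \<noteq> source_cell qs ws i"
        using path_cell_Suc(2)[OF len] by (simp add: cell_of_receiver[OF i len])
      then show "1 / (4 * real qs) \<le> dist (pos ws (transmitter qs ws (path_cell qs ws i 0)
          (sec_relay (path_cell qs ws i 0) t) i)) (pos ws (receiver i 0 t))"
        using central by (simp add: transmitter_def)
    qed
    also have "\<dots> \<le> max_rate \<alpha> N0 P1 * ts / L"
      using L max_rate_nonneg ts_pos by (intro divide_left_mono mult_nonneg_nonneg mult_pos_pos) auto
    finally show "capacity i 0 t \<le> max_rate \<alpha> N0 P1 * ts / L" .
  qed
qed

end

lemma central_far:
  assumes "q > 0" "frac (real q * fst x) \<in> {1/4..3/4}" "frac (real q * snd x) \<in> {1/4..3/4}"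
    and "cell_of q z \<noteq> cell_of q x"
  shows "1 / (4 * real q) \<le> dist x z"
proof -
  have "1 / (4 * real q) \<le> \<bar>a - b\<bar>"
    if "frac (real q * a) \<in> {1/4..3/4}" "\<lfloor>real q * b\<rfloor> \<noteq> \<lfloor>real q * a\<rfloor>" for a b
  proof -
    have "1 / 4 \<le> \<bar>real q * a - real q * b\<bar>"
      using that unfolding frac_def atLeastAtMost_iff by linarith
    also have "\<dots> = real q * \<bar>a - b\<bar>"
      by (metis abs_mult abs_of_nat right_diff_distrib)
    finally show ?thesis using \<open>q > 0\<close> by (simp add: field_simps)
  qed
  then have "1 / (4 * real q) \<le> \<bar>fst x - fst z\<bar> \<or> 1 / (4 * real q) \<le> \<bar>snd x - snd z\<bar>"
    using assms by (auto simp: cell_of_def)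
  then show ?thesis using dist_prod_ge[of x z] by linarith
qed

subsection \<open>Moments of the network measure\<close>

definition unif :: "point measure" where
  "unif = uniform_measure lborel unit_square"

lemma sets_unif [simp, measurable_cong]: "sets unif = sets borel"
  by (simp add: unif_def)

lemma space_unif [simp]: "space unif = UNIV"
  by (simp add: unif_def)

lemma unit_square_measurable [measurable]: "unit_square \<in> sets borel"
  unfolding unit_square_def by (simp add: borel_prod[symmetric])

lemma emeasure_unif_Times:
  assumes [measurable]: "A \<in> sets borel" "B \<in> sets borel" and sub: "A \<subseteq> {0..<1}" "B \<subseteq> {0..<1}"
  shows "emeasure unif (A \<times> B) = emeasure lborel A * emeasure lborel B"
proof -
  have e: "emeasure lborel (S \<times> T) = emeasure lborel S * emeasure lborel T"
    if "S \<in> sets borel" "T \<in> sets borel" for S T :: "real set"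
    using that by (simp add: lborel_prod[symmetric] lborel.emeasure_pair_measure_Times)
  have [measurable]: "A \<times> B \<in> sets borel" by (simp add: borel_prod[symmetric])
  have "unit_square \<inter> A \<times> B = A \<times> B" using sub by (auto simp: unit_square_def)
  moreover have "emeasure lborel unit_square = 1"
    by (simp add: unit_square_def e)
  ultimately show ?thesis
    by (simp add: unif_def emeasure_uniform_measure e divide_ennreal_def)
qed

lemma emeasure_unif_unit_square: "emeasure unif unit_square = 1"
  unfolding unit_square_def by (subst emeasure_unif_Times) auto

lemma prob_space_unif: "prob_space unif"
proof
  have "emeasure unif (space unif) = emeasure unif unit_square"
  proof (rule antisym)
    show "emeasure unif (space unif) \<le> emeasure unif unit_square"
      by (simp add: unif_def emeasure_uniform_measure)
  qed (auto intro!: emeasure_mono)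
  then show "emeasure unif (space unif) = 1" by (simp add: emeasure_unif_unit_square)
qed

interpretation unif: prob_space unif
  by (rule prob_space_unif)

lemma AE_unif: "AE x in unif. x \<in> unit_square"
  unfolding unif_def by (rule AE_uniform_measureI) auto

definition locations :: "(nat \<Rightarrow> point) measure" where
  "locations = (\<Pi>\<^sub>M v\<in>UNIV. unif)"

interpretation seq: sequence_space unif ..

lemma prob_space_locations: "prob_space locations"
  unfolding locations_def by (rule seq.prob_space_axioms)

interpretation locations: prob_space locations
  by (rule prob_space_locations)

lemma locations_component [measurable]: "(\<lambda>X. X v) \<in> measurable locations borel"
  unfolding locations_def by (rule measurable_PiM_component_rev) auto

text \<open>An independent uniform sequence is a first point followed by an independent sequence of
  the same law. Products over initial segments then factor by induction.\<close>

lemma nn_integral_locations_split: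
  assumes [measurable]: "F \<in> borel_measurable locations"
  shows "(\<integral>\<^sup>+X. F X \<partial>locations) = (\<integral>\<^sup>+x. (\<integral>\<^sup>+X. F (case_nat x X) \<partial>locations) \<partial>unif)"
proof -
  have m [measurable]: "(\<lambda>(s, \<omega>). case_nat s \<omega>) \<in> measurable (unif \<Otimes>\<^sub>M locations) locations"
    unfolding locations_def by measurable
  have "(\<integral>\<^sup>+X. F X \<partial>locations) =
      (\<integral>\<^sup>+X. F X \<partial>distr (unif \<Otimes>\<^sub>M locations) locations (\<lambda>(s, \<omega>). case_nat s \<omega>))"
    using seq.PiM_iter by (simp add: locations_def)
  also have "\<dots> = (\<integral>\<^sup>+p. F (case_nat (fst p) (snd p)) \<partial>(unif \<Otimes>\<^sub>M locations))"
    by (subst nn_integral_distr) (auto simp: case_prod_unfold)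
  also have "\<dots> = (\<integral>\<^sup>+x. (\<integral>\<^sup>+X. F (case_nat x X) \<partial>locations) \<partial>unif)"
    using m by (subst locations.nn_integral_fst[symmetric]) (auto simp: case_prod_unfold)
  finally show ?thesis .
qed

lemma nn_integral_prod_locations:
  assumes [measurable]: "f \<in> borel_measurable borel"
  shows "(\<integral>\<^sup>+X. (\<Prod>v<k. f (X v)) \<partial>locations) = (\<integral>\<^sup>+x. f x \<partial>unif) ^ k"
proof (induction k)
  case 0
  show ?case by (simp add: locations.emeasure_space_1)
next
  case (Suc k)
  have f: "f \<in> borel_measurable unif"
    using assms by (simp cong: measurable_cong_sets)
  have "(\<integral>\<^sup>+X. (\<Prod>v<Suc k. f (X v)) \<partial>locations)
      = (\<integral>\<^sup>+x. (\<integral>\<^sup>+X. f x * (\<Prod>v<k. f (X v)) \<partial>locations) \<partial>unif)"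
    by (subst nn_integral_locations_split) (auto simp: prod.lessThan_Suc_shift simp del: prod.lessThan_Suc)
  also have "\<dots> = (\<integral>\<^sup>+x. f x \<partial>unif) * (\<integral>\<^sup>+x. f x \<partial>unif) ^ k"
    using f by (simp add: nn_integral_cmult nn_integral_multc Suc)
  finally show ?case by simp
qed

lemma nn_integral_prod_pairs_locations:
  assumes [measurable]: "(\<lambda>p. g (fst p) (snd p)) \<in> borel_measurable borel"
  shows "(\<integral>\<^sup>+X. (\<Prod>i<k. g (X (2 * i)) (X (2 * i + 1))) \<partial>locations)
    = (\<integral>\<^sup>+x. (\<integral>\<^sup>+y. g x y \<partial>unif) \<partial>unif) ^ k"
proof (induction k)
  case 0
  show ?case by (simp add: locations.emeasure_space_1)
next
  case (Suc k)
  \<comment> \<open>The assumption on pairs as a composition rule, which covers the sections of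
    \<open>g\<close> as well as its evaluation at two locations.\<close>
  have g [measurable (raw)]: "(\<lambda>z. g (a z) (b z)) \<in> borel_measurable M"
    if "a \<in> measurable M borel" "b \<in> measurable M borel" for a b and M :: "'a measure"
    using measurable_compose[OF measurable_Pair[OF that], of "\<lambda>p. g (fst p) (snd p)" borel]
    by (simp add: borel_prod)
  have [simp]: "g x \<in> borel_measurable unif" for x
    using g[of "\<lambda>_. x" unif "\<lambda>y. y"] by (simp cong: measurable_cong_sets)
  have [simp]: "(\<lambda>x. \<integral>\<^sup>+y. g x y \<partial>unif) \<in> borel_measurable unif" by measurable
  have "(\<integral>\<^sup>+X. (\<Prod>i<Suc k. g (X (2 * i)) (X (2 * i + 1))) \<partial>locations)
      = (\<integral>\<^sup>+x. (\<integral>\<^sup>+X. g x (X 0) * (\<Prod>i<k. g (X (Suc (2 * i))) (X (Suc (Suc (2 * i))))) \<partial>locations) \<partial>unif)"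
    by (subst nn_integral_locations_split) (auto simp: prod.lessThan_Suc_shift simp del: prod.lessThan_Suc)
  also have "\<dots> = (\<integral>\<^sup>+x. (\<integral>\<^sup>+y. (\<integral>\<^sup>+X. g x y * (\<Prod>i<k. g (X (2 * i)) (X (2 * i + 1))) \<partial>locations) \<partial>unif) \<partial>unif)"
    by (subst nn_integral_locations_split) auto
  also have "\<dots> = (\<integral>\<^sup>+x. (\<integral>\<^sup>+y. g x y \<partial>unif) \<partial>unif) * (\<integral>\<^sup>+x. (\<integral>\<^sup>+y. g x y \<partial>unif) \<partial>unif) ^ k"
    unfolding Suc[symmetric]
    by (simp add: nn_integral_cmult nn_integral_multc)
  finally show ?case by simp
qed

text \<open>Exchangeability. It removes the random pairing: for a fixed permutation the pairs may be
  taken to be \<open>(2 * i, 2 * i + 1)\<close>.\<close>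

lemma nn_integral_locations_permute:
  assumes "bij \<pi>" and [measurable]: "F \<in> borel_measurable locations"
  shows "(\<integral>\<^sup>+X. F (\<lambda>v. X (\<pi> v)) \<partial>locations) = (\<integral>\<^sup>+X. F X \<partial>locations)"
proof -
  have "distr locations locations (\<lambda>X. \<lambda>v\<in>UNIV. X (\<pi> v)) = locations"
    unfolding locations_def
    using distr_PiM_reindex[of UNIV "\<lambda>_. unif" \<pi> UNIV] assms(1) prob_space_unif by (simp add: bij_def)
  then have "distr locations locations (\<lambda>X v. X (\<pi> v)) = locations"
    by (simp add: restrict_def)
  moreover have "(\<lambda>X v. X (\<pi> v)) \<in> measurable locations locations"
    unfolding locations_def
    by (rule measurable_PiM_single') (auto intro!: measurable_component_singleton)
  ultimately show ?thesis
    using nn_integral_distr[of "\<lambda>X v. X (\<pi> v)" locations locations F] assms(2) by simp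
qed

section \<open>Number of nodes, random pairing and measurability\<close>

definition matching_pmf :: "real \<Rightarrow> (nat \<times> (nat \<Rightarrow> nat)) pmf" where
  "matching_pmf \<delta> = poisson_pmf \<delta> \<bind> (\<lambda>N. map_pmf (Pair N) (pmf_of_set {\<pi>. \<pi> permutes {..<N}}))"

lemma network_measure_eq: "network_measure \<delta> = measure_pmf (matching_pmf \<delta>) \<Otimes>\<^sub>M locations"
  by (simp add: network_measure_def matching_pmf_def locations_def unif_def)

lemma prob_space_network: "prob_space (network_measure \<delta>)"
proof -
  interpret pair_prob_space "measure_pmf (matching_pmf \<delta>)" locations ..
  show ?thesis unfolding network_measure_eq by unfold_locales
qed

lemma fst_network [measurable]: "(\<lambda>w. h (fst w)) \<in> measurable (network_measure \<delta>) (count_space UNIV)"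
proof -
  have "fst \<in> measurable (network_measure \<delta>) (count_space UNIV)"
    unfolding network_measure_eq by (subst measurable_cong_sets[OF refl sets_measure_pmf_count_space[symmetric]]) measurable
  then show ?thesis by (rule measurable_compose) simp
qed

lemma pos_network [measurable]: "(\<lambda>w. pos w v) \<in> measurable (network_measure \<delta>) borel"
  unfolding network_measure_eq pos_def by measurable

lemma num_nodes_network [measurable]: "num_nodes \<in> measurable (network_measure \<delta>) (count_space UNIV)"
  using fst_network[of "\<lambda>p. fst p" \<delta>] by (simp add: num_nodes_def[abs_def])

lemma num_pairs_network [measurable]: "num_pairs \<in> measurable (network_measure \<delta>) (count_space UNIV)"
  using fst_network[of "\<lambda>p. fst p div 2" \<delta>] by (simp add: num_pairs_def[abs_def] num_nodes_def)

text \<open>The index of the source is itself random; measurability follows by distinguishing its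
  countably many values.\<close>

lemma pos_source_network [measurable]: "(\<lambda>w. pos w (source w i)) \<in> measurable (network_measure \<delta>) borel"
  by (rule measurable_compose_countable[where g = "\<lambda>w. source w i"])
    (auto simp: source_def intro!: fst_network[of "\<lambda>p. snd p (2 * i)", simplified])

lemma pos_dest_network [measurable]: "(\<lambda>w. pos w (dest w i)) \<in> measurable (network_measure \<delta>) borel"
  by (rule measurable_compose_countable[where g = "\<lambda>w. dest w i"])
    (auto simp: dest_def intro!: fst_network[of "\<lambda>p. snd p (2 * i + 1)", simplified])

lemma prod_nodes_measurable [measurable]:
  assumes [measurable]: "f \<in> borel_measurable borel"
  shows "(\<lambda>w. \<Prod>v<num_nodes w. f (pos w v) :: ennreal) \<in> borel_measurable (network_measure \<delta>)"
  by (rule measurable_compose_countable[where g = num_nodes]) measurable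

lemma prod_pairs_measurable [measurable]:
  assumes [measurable]: "(\<lambda>p. g (fst p) (snd p)) \<in> borel_measurable borel"
  shows "(\<lambda>w. \<Prod>i<num_pairs w. g (pos w (source w i)) (pos w (dest w i)) :: ennreal)
    \<in> borel_measurable (network_measure \<delta>)"
proof (rule measurable_compose_countable[where g = num_pairs])
  fix k
  have "(\<lambda>w. g (pos w (source w i)) (pos w (dest w i))) \<in> borel_measurable (network_measure \<delta>)" for i
    using measurable_compose[OF measurable_Pair[OF pos_source_network pos_dest_network],
      of "\<lambda>p. g (fst p) (snd p)" borel]
    by (simp add: borel_prod)
  then show "(\<lambda>w. \<Prod>i<k. g (pos w (source w i)) (pos w (dest w i))) \<in> borel_measurable (network_measure \<delta>)"
    by (intro borel_measurable_prod_ennreal)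
qed measurable

text \<open>The probability generating function of the Poisson distribution.\<close>

lemma nn_integral_poisson_power:
  assumes "0 < \<delta>" "0 \<le> a"
  shows "(\<integral>\<^sup>+N. ennreal a ^ N \<partial>measure_pmf (poisson_pmf \<delta>)) = ennreal (exp (\<delta> * (a - 1)))"
proof -
  have "(\<lambda>N. (\<delta> * a) ^ N /\<^sub>R fact N) sums exp (\<delta> * a)" by (rule exp_converges)
  then have s: "(\<lambda>N. (\<delta> * a) ^ N / fact N * exp (- \<delta>)) sums (exp (\<delta> * a) * exp (- \<delta>))"
    by (intro sums_mult2) (simp add: field_simps)
  have "(\<integral>\<^sup>+N. ennreal a ^ N \<partial>measure_pmf (poisson_pmf \<delta>))
      = (\<integral>\<^sup>+N. ennreal ((\<delta> * a) ^ N / fact N * exp (- \<delta>)) \<partial>count_space UNIV)"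
    using assms
    by (auto simp: nn_integral_measure_pmf ennreal_power ennreal_mult[symmetric] power_mult_distrib field_simps
        intro!: nn_integral_cong)
  also have "\<dots> = ennreal (exp (\<delta> * a) * exp (- \<delta>))"
    using assms by (subst nn_integral_count_space_nat, intro suminf_ennreal_eq s) auto
  finally show ?thesis by (simp add: exp_add[symmetric] algebra_simps)
qed

lemma nn_integral_network:
  assumes [measurable]: "F \<in> borel_measurable (network_measure \<delta>)"
  shows "(\<integral>\<^sup>+w. F w \<partial>network_measure \<delta>) =
    (\<integral>\<^sup>+N. (\<integral>\<^sup>+\<pi>. (\<integral>\<^sup>+X. F ((N, \<pi>), X) \<partial>locations) \<partial>measure_pmf (pmf_of_set {\<pi>. \<pi> permutes {..<N}}))
      \<partial>measure_pmf (poisson_pmf \<delta>))"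
  using assms unfolding network_measure_eq
  by (subst locations.nn_integral_fst[symmetric]) (simp_all add: matching_pmf_def)

lemma set_pmf_permutes: "set_pmf (pmf_of_set {\<pi>. \<pi> permutes {..<N::nat}}) = {\<pi>. \<pi> permutes {..<N}}"
  by (rule set_pmf_of_set) (auto intro: permutes_id finite_permutations)

text \<open>The probability generating functional of the Poisson process.\<close>

lemma nn_integral_prod_nodes:
  assumes "0 < \<delta>" and [measurable]: "f \<in> borel_measurable borel"
    and "(\<integral>\<^sup>+x. f x \<partial>unif) = ennreal a" "0 \<le> a"
  shows "(\<integral>\<^sup>+w. (\<Prod>v<num_nodes w. f (pos w v)) \<partial>network_measure \<delta>) = ennreal (exp (\<delta> * (a - 1)))"
  by (subst nn_integral_network[OF prod_nodes_measurable[OF assms(2)]])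
    (auto simp: num_nodes_def pos_def nn_integral_prod_locations assms measure_pmf.emeasure_space_1
      nn_integral_poisson_power[OF assms(1,4)])

text \<open>There are \<open>N div 2\<close> pairs, which gives no closed form in \<open>N\<close>.
  With \<open>b = (1 + a) / 2\<close> one has \<open>a \<le> b^2\<close>, so
  \<open>a ^ (N div 2)\<close> is at most \<open>b ^ N\<close> up to one factor \<open>b\<close> for
  an odd node; the factor 2 pays for it, as \<open>b \<ge> 1 / 2\<close>. The Poisson generating
  function then applies to \<open>b\<close>.\<close>

lemma nn_integral_prod_pairs_le:
  assumes "0 < \<delta>" and g: "(\<lambda>p. g (fst p) (snd p)) \<in> borel_measurable borel"
    and a: "(\<integral>\<^sup>+x. (\<integral>\<^sup>+y. g x y \<partial>unif) \<partial>unif) = ennreal a" "0 \<le> a" "a \<le> 1"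
  shows "(\<integral>\<^sup>+w. (\<Prod>i<num_pairs w. g (pos w (source w i)) (pos w (dest w i))) \<partial>network_measure \<delta>)
    \<le> ennreal (2 * exp (- \<delta> * (1 - a) / 2))"
proof -
  define b where "b = (1 + a) / 2"
  have b: "1 / 2 \<le> b" "b \<le> 1" "a \<le> b ^ 2"
    using a zero_le_power2[of "1 - a"] by (auto simp: b_def power2_eq_square field_simps)
  have "a ^ (N div 2) \<le> 2 * b ^ N" for N
  proof -
    have "a ^ (N div 2) \<le> (b ^ 2) ^ (N div 2)" using a b by (intro power_mono) auto
    also have "\<dots> = b ^ (2 * (N div 2))" by (simp add: power_mult)
    also have "\<dots> \<le> 2 * (b ^ (2 * (N div 2)) * b)"
      using mult_left_mono[OF b(1), of "b ^ (2 * (N div 2))"] b by simp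
    also have "\<dots> = 2 * b ^ (Suc (2 * (N div 2)))" by simp
    also have "\<dots> \<le> 2 * b ^ N"
      using b by (intro mult_left_mono power_decreasing) auto
    finally show ?thesis .
  qed
  then have le: "ennreal a ^ (N div 2) \<le> 2 * ennreal b ^ N" for N
    using a b by (simp add: ennreal_power ennreal_mult'[symmetric] ennreal_numeral[symmetric] del: ennreal_numeral)
  have "(\<integral>\<^sup>+w. (\<Prod>i<num_pairs w. g (pos w (source w i)) (pos w (dest w i))) \<partial>network_measure \<delta>)
    = (\<integral>\<^sup>+N. (\<integral>\<^sup>+\<pi>. (\<integral>\<^sup>+X. (\<Prod>i<N div 2. g (X (\<pi> (2 * i))) (X (\<pi> (2 * i + 1)))) \<partial>locations)
        \<partial>measure_pmf (pmf_of_set {\<pi>. \<pi> permutes {..<N}})) \<partial>measure_pmf (poisson_pmf \<delta>))"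
    by (subst nn_integral_network[OF prod_pairs_measurable[OF g]])
      (simp add: num_pairs_def num_nodes_def pos_def source_def dest_def)
  also have "\<dots> = (\<integral>\<^sup>+N. (\<integral>\<^sup>+\<pi>. ennreal a ^ (N div 2)
        \<partial>measure_pmf (pmf_of_set {\<pi>. \<pi> permutes {..<N}})) \<partial>measure_pmf (poisson_pmf \<delta>))"
  proof (rule nn_integral_cong, rule nn_integral_cong_AE, rule AE_pmfI)
    fix N :: nat and \<pi> assume "\<pi> \<in> set_pmf (pmf_of_set {\<pi>. \<pi> permutes {..<N}})"
    then have "bij \<pi>" by (auto simp: set_pmf_permutes permutes_bij)
    moreover have "(\<lambda>X. \<Prod>i<N div 2. g (X (2 * i)) (X (2 * i + 1))) \<in> borel_measurable locations"
    proof (intro borel_measurable_prod_ennreal)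
      fix i
      show "(\<lambda>X. g (X (2 * i)) (X (2 * i + 1))) \<in> borel_measurable locations"
        using measurable_compose[OF measurable_Pair[OF locations_component locations_component],
          of "\<lambda>p. g (fst p) (snd p)" borel] g
        by (simp add: borel_prod)
    qed
    ultimately show "(\<integral>\<^sup>+X. (\<Prod>i<N div 2. g (X (\<pi> (2 * i))) (X (\<pi> (2 * i + 1)))) \<partial>locations) = ennreal a ^ (N div 2)"
      using nn_integral_locations_permute[of \<pi> "\<lambda>X. \<Prod>i<N div 2. g (X (2 * i)) (X (2 * i + 1))"]
      by (simp add: nn_integral_prod_pairs_locations[OF g, simplified] a)
  qed
  also have "\<dots> \<le> (\<integral>\<^sup>+N. 2 * ennreal b ^ N \<partial>measure_pmf (poisson_pmf \<delta>))"
    by (intro nn_integral_mono) (simp add: measure_pmf.emeasure_space_1 le)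
  also have "\<dots> = 2 * ennreal (exp (\<delta> * (b - 1)))"
    using b by (simp add: nn_integral_cmult nn_integral_poisson_power[OF assms(1)])
  also have "\<dots> = ennreal (2 * exp (- \<delta> * (1 - a) / 2))"
  proof -
    have "\<delta> * (b - 1) = - \<delta> * (1 - a) / 2" by (simp add: b_def field_simps)
    then show ?thesis by (simp add: ennreal_mult)
  qed
  finally show ?thesis .
qed

subsection \<open>Events with high probability\<close>

lemma whp_mono:
  assumes "whp M P" "\<forall>\<^sub>F n in at_top. \<forall>\<omega>\<in>space (M n). P n \<omega> \<longrightarrow> Q n \<omega>"
  shows "whp M Q"
proof -
  obtain E where E: "\<forall>\<^sub>F n in at_top. E n \<in> sets (M n) \<and> E n \<subseteq> {\<omega> \<in> space (M n). P n \<omega>}"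
    "((\<lambda>n. measure (M n) (E n)) \<longlongrightarrow> 1) at_top"
    using assms(1) unfolding whp_def by blast
  have "\<forall>\<^sub>F n in at_top. E n \<in> sets (M n) \<and> E n \<subseteq> {\<omega> \<in> space (M n). Q n \<omega>}"
    using E(1) assms(2) by eventually_elim blast
  then show ?thesis using E(2) unfolding whp_def by blast
qed

text \<open>\<open>F\<close> is at least 1 wherever \<open>P\<close> fails. The set where
  \<open>F\<close> is below 1 is the measurable witness required by \<open>whp\<close>, so
  \<open>P\<close> itself may be non-measurable.\<close>

lemma whp_Markov:
  assumes prob: "\<And>n. prob_space (M n)"
    and F: "\<forall>\<^sub>F n in at_top. F n \<in> borel_measurable (M n)"
    and le: "\<forall>\<^sub>F n in at_top. (\<integral>\<^sup>+\<omega>. F n \<omega> \<partial>M n) \<le> ennreal (e n)"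
    and e: "(e \<longlongrightarrow> 0) at_top"
    and P: "\<forall>\<^sub>F n in at_top. \<forall>\<omega>\<in>space (M n). F n \<omega> < 1 \<longrightarrow> P n \<omega>"
  shows "whp M P"
proof -
  define E where "E n = {\<omega> \<in> space (M n). F n \<omega> < 1}" for n
  have "\<forall>\<^sub>F n in at_top. E n \<in> sets (M n) \<and> E n \<subseteq> {\<omega> \<in> space (M n). P n \<omega>}"
    using F P
  proof eventually_elim
    case (elim n)
    then have [measurable]: "F n \<in> borel_measurable (M n)" by simp
    have "E n \<in> sets (M n)" unfolding E_def by measurable
    then show ?case using elim(2) by (auto simp: E_def)
  qed
  moreover have "((\<lambda>n. measure (M n) (E n)) \<longlongrightarrow> 1) at_top"
  proof (rule tendsto_sandwich)
    show "\<forall>\<^sub>F n in at_top. 1 - \<bar>e n\<bar> \<le> measure (M n) (E n)"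
      using F le
    proof eventually_elim
      case (elim n)
      interpret prob_space "M n" by (rule prob)
      have [measurable]: "F n \<in> borel_measurable (M n)" using elim by simp
      have [measurable]: "E n \<in> sets (M n)" unfolding E_def by measurable
      have "space (M n) - E n = {\<omega> \<in> space (M n). 1 \<le> F n \<omega>}" by (auto simp: E_def)
      then have "emeasure (M n) (space (M n) - E n) \<le> (\<integral>\<^sup>+\<omega>. F n \<omega> \<partial>M n)"
        using nn_integral_Markov_inequality[of "F n" "space (M n)" "M n" 1]
        by (simp cong: nn_integral_cong)
      also have "\<dots> \<le> ennreal \<bar>e n\<bar>" using elim(2) by (rule order_trans) (simp add: ennreal_leI)
      finally have "measure (M n) (space (M n) - E n) \<le> \<bar>e n\<bar>"
        by (simp add: emeasure_eq_measure)
      then show ?case using prob_compl[of "E n"] by simp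
    qed
    show "\<forall>\<^sub>F n in at_top. measure (M n) (E n) \<le> 1"
      using prob by (simp add: prob_space.prob_le_1)
    show "((\<lambda>n. 1 - \<bar>e n\<bar>) \<longlongrightarrow> 1) at_top"
      using tendsto_diff[OF tendsto_const[of 1] tendsto_rabs[OF e]] by simp
  qed simp
  ultimately show ?thesis unfolding whp_def by (intro exI[of _ E] conjI)
qed

lemma whp_AE:
  assumes prob: "\<And>n. prob_space (M n)" and "\<forall>\<^sub>F n in at_top. AE \<omega> in M n. P n \<omega>"
  shows "whp M P"
proof -
  have "\<exists>E. E \<in> sets (M n) \<and> E \<subseteq> {\<omega> \<in> space (M n). P n \<omega>} \<and> measure (M n) E = 1"
    if "AE \<omega> in M n. P n \<omega>" for n
  proof -
    interpret prob_space "M n" by (rule prob)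
    from that obtain N where N: "{\<omega> \<in> space (M n). \<not> P n \<omega>} \<subseteq> N" "emeasure (M n) N = 0" "N \<in> sets (M n)"
      by (rule AE_E)
    then have "measure (M n) (space (M n) - N) = 1"
      using prob_compl[of N] by (simp add: measure_def)
    then show ?thesis using N by (intro exI[of _ "space (M n) - N"]) auto
  qed
  then obtain E where E: "\<And>n. (AE \<omega> in M n. P n \<omega>) \<Longrightarrow>
      E n \<in> sets (M n) \<and> E n \<subseteq> {\<omega> \<in> space (M n). P n \<omega>} \<and> measure (M n) (E n) = 1"
    by metis
  have "\<forall>\<^sub>F n in at_top. E n \<in> sets (M n) \<and> E n \<subseteq> {\<omega> \<in> space (M n). P n \<omega>}"
    using assms(2) by eventually_elim (use E in blast)
  moreover have "\<forall>\<^sub>F n in at_top. measure (M n) (E n) = 1"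
    using assms(2) by eventually_elim (use E in blast)
  then have "((\<lambda>n. measure (M n) (E n)) \<longlongrightarrow> 1) at_top"
    by (rule tendsto_eventually)
  ultimately show ?thesis unfolding whp_def by (intro exI[of _ E] conjI)
qed

lemma whp_conj:
  assumes prob: "\<And>n. prob_space (M n)" and "whp M P" "whp M Q"
  shows "whp M (\<lambda>n \<omega>. P n \<omega> \<and> Q n \<omega>)"
proof -
  obtain E where E: "\<forall>\<^sub>F n in at_top. E n \<in> sets (M n) \<and> E n \<subseteq> {\<omega> \<in> space (M n). P n \<omega>}"
    "((\<lambda>n. measure (M n) (E n)) \<longlongrightarrow> 1) at_top"
    using assms(2) unfolding whp_def by blast
  obtain E' where E': "\<forall>\<^sub>F n in at_top. E' n \<in> sets (M n) \<and> E' n \<subseteq> {\<omega> \<in> space (M n). Q n \<omega>}"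
    "((\<lambda>n. measure (M n) (E' n)) \<longlongrightarrow> 1) at_top"
    using assms(3) unfolding whp_def by blast
  have "\<forall>\<^sub>F n in at_top. E n \<inter> E' n \<in> sets (M n) \<and> E n \<inter> E' n \<subseteq> {\<omega> \<in> space (M n). P n \<omega> \<and> Q n \<omega>}"
    using E(1) E'(1) by eventually_elim auto
  moreover have "((\<lambda>n. measure (M n) (E n \<inter> E' n)) \<longlongrightarrow> 1) at_top"
  proof (rule tendsto_sandwich)
    show "\<forall>\<^sub>F n in at_top. measure (M n) (E n) + measure (M n) (E' n) - 1 \<le> measure (M n) (E n \<inter> E' n)"
      using E(1) E'(1)
    proof eventually_elim
      case (elim n)
      interpret prob_space "M n" by (rule prob)
      have "measure (M n) (E n \<union> E' n) = measure (M n) (E n) + measure (M n) (E' n) - measure (M n) (E n \<inter> E' n)"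
        using elim by (intro measure_Un3) (auto simp: fmeasurable_eq_sets)
      then show ?case using prob_le_1[of "E n \<union> E' n"] by linarith
    qed
    show "\<forall>\<^sub>F n in at_top. measure (M n) (E n \<inter> E' n) \<le> 1"
      using prob by (simp add: prob_space.prob_le_1)
    show "((\<lambda>n. measure (M n) (E n) + measure (M n) (E' n) - 1) \<longlongrightarrow> 1) at_top"
      using tendsto_diff[OF tendsto_add[OF E(2) E'(2)] tendsto_const[of 1]] by simp
  qed simp
  ultimately show ?thesis unfolding whp_def by (intro exI[of _ "\<lambda>n. E n \<inter> E' n"] conjI)
qed

text \<open>Used with \<open>g n = n powr \<beta>\<close>, to turn statements about a secondary
  network of density tending to infinity into statements in \<open>n\<close>.\<close>

lemma whp_compose:
  assumes "whp M P" "filterlim g at_top at_top"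
  shows "whp (\<lambda>n. M (g n)) (\<lambda>n. P (g n))"
proof -
  obtain E where E: "\<forall>\<^sub>F n in at_top. E n \<in> sets (M n) \<and> E n \<subseteq> {\<omega> \<in> space (M n). P n \<omega>}"
    "((\<lambda>n. measure (M n) (E n)) \<longlongrightarrow> 1) at_top"
    using assms(1) unfolding whp_def by blast
  then show ?thesis
    unfolding whp_def
    using filterlim_compose[OF E(2) assms(2)] eventually_compose_filterlim[OF E(1) assms(2)]
    by (intro exI[of _ "\<lambda>n. E (g n)"]) simp
qed

lemma whp_fst:
  assumes prob: "\<And>n. prob_space (M n)" "\<And>n. prob_space (M' n)" and "whp M P"
  shows "whp (\<lambda>n. M n \<Otimes>\<^sub>M M' n) (\<lambda>n \<omega>. P n (fst \<omega>))"
proof -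
  obtain E where E: "\<forall>\<^sub>F n in at_top. E n \<in> sets (M n) \<and> E n \<subseteq> {\<omega> \<in> space (M n). P n \<omega>}"
    "((\<lambda>n. measure (M n) (E n)) \<longlongrightarrow> 1) at_top"
    using assms(3) unfolding whp_def by blast
  have "\<forall>\<^sub>F n in at_top. E n \<times> space (M' n) \<in> sets (M n \<Otimes>\<^sub>M M' n) \<and>
      E n \<times> space (M' n) \<subseteq> {\<omega> \<in> space (M n \<Otimes>\<^sub>M M' n). P n (fst \<omega>)}"
    using E(1) by eventually_elim (auto simp: space_pair_measure)
  moreover have "\<forall>\<^sub>F n in at_top. measure (M n) (E n) = measure (M n \<Otimes>\<^sub>M M' n) (E n \<times> space (M' n))"
    using E(1)
  proof eventually_elim
    case (elim n)
    interpret M': prob_space "M' n" by (rule prob)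
    show ?case using elim
      by (simp add: measure_def M'.emeasure_pair_measure_Times M'.emeasure_space_1)
  qed
  then have "((\<lambda>n. measure (M n \<Otimes>\<^sub>M M' n) (E n \<times> space (M' n))) \<longlongrightarrow> 1) at_top"
    using E(2) by (rule Lim_transform_eventually[rotated])
  ultimately show ?thesis unfolding whp_def by (intro exI[of _ "\<lambda>n. E n \<times> space (M' n)"] conjI)
qed

lemma whp_snd:
  assumes prob: "\<And>n. prob_space (M n)" "\<And>n. prob_space (M' n)" and "whp M' P"
  shows "whp (\<lambda>n. M n \<Otimes>\<^sub>M M' n) (\<lambda>n \<omega>. P n (snd \<omega>))"
proof -
  obtain E where E: "\<forall>\<^sub>F n in at_top. E n \<in> sets (M' n) \<and> E n \<subseteq> {\<omega> \<in> space (M' n). P n \<omega>}"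
    "((\<lambda>n. measure (M' n) (E n)) \<longlongrightarrow> 1) at_top"
    using assms(3) unfolding whp_def by blast
  have "\<forall>\<^sub>F n in at_top. space (M n) \<times> E n \<in> sets (M n \<Otimes>\<^sub>M M' n) \<and>
      space (M n) \<times> E n \<subseteq> {\<omega> \<in> space (M n \<Otimes>\<^sub>M M' n). P n (snd \<omega>)}"
    using E(1) by eventually_elim (auto simp: space_pair_measure)
  moreover have "\<forall>\<^sub>F n in at_top. measure (M' n) (E n) = measure (M n \<Otimes>\<^sub>M M' n) (space (M n) \<times> E n)"
    using E(1)
  proof eventually_elim
    case (elim n)
    interpret M: prob_space "M n" by (rule prob)
    interpret M': prob_space "M' n" by (rule prob)
    show ?case using elim
      by (simp add: measure_def M'.emeasure_pair_measure_Times M.emeasure_space_1)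
  qed
  then have "((\<lambda>n. measure (M n \<Otimes>\<^sub>M M' n) (space (M n) \<times> E n)) \<longlongrightarrow> 1) at_top"
    using E(2) by (rule Lim_transform_eventually[rotated])
  ultimately show ?thesis unfolding whp_def by (intro exI[of _ "\<lambda>n. space (M n) \<times> E n"] conjI)
qed

section \<open>Moments of counts of nodes and of pairs\<close>

lemma emeasure_unif_rectangle:
  assumes "0 \<le> a" "a \<le> b" "b \<le> 1" "0 \<le> c" "c \<le> d" "d \<le> 1"
  shows "emeasure unif ({a..<b} \<times> {c..<d}) = ennreal ((b - a) * (d - c))"
  using assms by (subst emeasure_unif_Times) (auto simp: ennreal_mult)

lemma nn_integral_unif_if:
  assumes [measurable]: "S \<in> sets borel" and "emeasure unif S = ennreal p" "0 \<le> p" "0 \<le> u" "0 \<le> v"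
  shows "(\<integral>\<^sup>+x. (if x \<in> S then ennreal u else ennreal v) \<partial>unif) = ennreal (u * p + v * (1 - p))"
proof -
  have "ennreal p \<le> 1" using assms(2) unif.emeasure_space_1 emeasure_space[of unif S] by simp
  then have p: "p \<le> 1" by (simp add: ennreal_le_1)
  have [measurable]: "S \<in> sets unif" by simp
  have c: "emeasure unif (- S) = ennreal (1 - p)"
    using emeasure_compl[of S unif] assms(2,3) unif.emeasure_space_1
    by (simp add: Compl_eq_Diff_UNIV ennreal_minus[symmetric])
  have "(\<integral>\<^sup>+x. (if x \<in> S then ennreal u else ennreal v) \<partial>unif)
    = (\<integral>\<^sup>+x. ennreal u * indicator S x + ennreal v * indicator (- S) x \<partial>unif)"
    by (intro nn_integral_cong) (auto simp: indicator_def)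
  also have "\<dots> = ennreal u * ennreal p + ennreal v * ennreal (1 - p)"
    using assms(2) c by (subst nn_integral_add) (auto simp: nn_integral_cmult_indicator)
  also have "\<dots> = ennreal (u * p + v * (1 - p))"
    using assms p by (simp add: ennreal_mult ennreal_plus)
  finally show ?thesis .
qed

lemma rectangle_measurable [measurable]: "{a..<b::real} \<times> {c..<d::real} \<in> sets borel"
  by (simp add: borel_prod[symmetric])

text \<open>The choice of \<open>s\<close> selects the event: \<open>s = 0\<close> gives the
  indicator of an empty set, by \<open>0 ^ 0 = 1\<close>; \<open>s > 1\<close> gives upper tails and
  \<open>0 < s < 1\<close> lower tails.\<close>

lemma nn_integral_power_count:
  assumes "0 < \<delta>" and S: "S \<in> sets borel" "emeasure unif S = ennreal p" "0 \<le> p" and "0 \<le> s"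
  shows "(\<integral>\<^sup>+w. ennreal s ^ card {v. v < num_nodes w \<and> pos w v \<in> S} \<partial>network_measure \<delta>)
    = ennreal (exp (\<delta> * p * (s - 1)))"
    and "(\<lambda>w. ennreal s ^ card {v. v < num_nodes w \<and> pos w v \<in> S}) \<in> borel_measurable (network_measure \<delta>)"
proof -
  define f where "f x = (if x \<in> S then ennreal s else ennreal 1)" for x
  have f [measurable]: "f \<in> borel_measurable borel" unfolding f_def using S(1) by measurable
  have eq: "ennreal s ^ card {v. v < num_nodes w \<and> pos w v \<in> S} = (\<Prod>v<num_nodes w. f (pos w v))" for w
    by (simp add: f_def prod.If_cases lessThan_def Collect_conj_eq)
  have p: "p \<le> 1"
    using S(2) unif.emeasure_space_1 emeasure_space[of unif S] by (simp add: ennreal_le_1)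
  have i: "(\<integral>\<^sup>+x. f x \<partial>unif) = ennreal (s * p + 1 * (1 - p))"
    unfolding f_def using assms by (intro nn_integral_unif_if) auto
  have "0 \<le> s * p + 1 * (1 - p)" using p assms by (intro add_nonneg_nonneg mult_nonneg_nonneg) auto
  from nn_integral_prod_nodes[OF assms(1) f i this]
  show "(\<integral>\<^sup>+w. ennreal s ^ card {v. v < num_nodes w \<and> pos w v \<in> S} \<partial>network_measure \<delta>)
    = ennreal (exp (\<delta> * p * (s - 1)))"
    unfolding eq by (simp add: algebra_simps)
  show "(\<lambda>w. ennreal s ^ card {v. v < num_nodes w \<and> pos w v \<in> S}) \<in> borel_measurable (network_measure \<delta>)"
    unfolding eq by measurable
qed

text \<open>Source and destination are independent, so a pair is counted with probability
  \<open>p * r\<close>. The range \<open>s \<le> 1\<close> covers what is asked of pairs: existence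
  and lower tails.\<close>

lemma nn_integral_power_count_pairs:
  assumes "0 < \<delta>" and S: "S \<in> sets borel" "emeasure unif S = ennreal p" "0 \<le> p"
    and W: "W \<in> sets borel" "emeasure unif W = ennreal r" "0 \<le> r" and "0 \<le> s" "s \<le> 1"
  shows "(\<integral>\<^sup>+w. ennreal s ^ card {i. i < num_pairs w \<and> pos w (source w i) \<in> S \<and> pos w (dest w i) \<in> W}
      \<partial>network_measure \<delta>) \<le> ennreal (2 * exp (- \<delta> * ((1 - s) * (p * r)) / 2))"
    and "(\<lambda>w. ennreal s ^ card {i. i < num_pairs w \<and> pos w (source w i) \<in> S \<and> pos w (dest w i) \<in> W})
      \<in> borel_measurable (network_measure \<delta>)"
proof -
  define g where "g x y = (if x \<in> S then (if y \<in> W then ennreal s else ennreal 1) else ennreal 1)" for x y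
  have g: "(\<lambda>p. g (fst p) (snd p)) \<in> borel_measurable borel"
  proof -
    have [measurable]: "S \<in> sets (borel \<Otimes>\<^sub>M borel)" "W \<in> sets (borel \<Otimes>\<^sub>M borel)"
      unfolding borel_prod by (rule S(1), rule W(1))
    show ?thesis unfolding g_def borel_prod[symmetric] by measurable
  qed
  have eq: "ennreal s ^ card {i. i < num_pairs w \<and> pos w (source w i) \<in> S \<and> pos w (dest w i) \<in> W}
    = (\<Prod>i<num_pairs w. g (pos w (source w i)) (pos w (dest w i)))" for w
  proof -
    have "g x y = (if x \<in> S \<and> y \<in> W then ennreal s else 1)" for x y by (simp add: g_def)
    then show ?thesis by (simp add: prod.If_cases lessThan_def Collect_conj_eq)
  qed
  have le1: "x \<le> 1" if "emeasure unif T = ennreal x" for x T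
    using that unif.emeasure_space_1 emeasure_space[of unif T] by (simp add: ennreal_le_1)
  have p: "p \<le> 1" "r \<le> 1" using le1 S(2) W(2) by blast+
  have i1: "(\<integral>\<^sup>+y. g x y \<partial>unif) = (if x \<in> S then ennreal (s * r + 1 * (1 - r)) else ennreal 1)" for x
    unfolding g_def using assms unif.emeasure_space_1
    by (cases "x \<in> S") (simp_all only: if_True if_False nn_integral_unif_if[OF W] nn_integral_const, simp_all)
  have n: "0 \<le> s * r + 1 * (1 - r)" using p assms by (intro add_nonneg_nonneg mult_nonneg_nonneg) auto
  have i: "(\<integral>\<^sup>+x. (\<integral>\<^sup>+y. g x y \<partial>unif) \<partial>unif) = ennreal ((s * r + 1 * (1 - r)) * p + 1 * (1 - p))"
    unfolding i1 using n S by (intro nn_integral_unif_if) auto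
  have e: "(s * r + 1 * (1 - r)) * p + 1 * (1 - p) = 1 - (1 - s) * (p * r)" by (simp add: algebra_simps)
  have "(1 - s) * (p * r) \<le> 1 * (1 * 1)" using p assms by (intro mult_mono) auto
  then have "0 \<le> 1 - (1 - s) * (p * r)" "1 - (1 - s) * (p * r) \<le> 1" using p assms by auto
  from nn_integral_prod_pairs_le[OF assms(1) g i[unfolded e] this]
  show "(\<integral>\<^sup>+w. ennreal s ^ card {i. i < num_pairs w \<and> pos w (source w i) \<in> S \<and> pos w (dest w i) \<in> W}
      \<partial>network_measure \<delta>) \<le> ennreal (2 * exp (- \<delta> * ((1 - s) * (p * r)) / 2))"
    unfolding eq by simp
  show "(\<lambda>w. ennreal s ^ card {i. i < num_pairs w \<and> pos w (source w i) \<in> S \<and> pos w (dest w i) \<in> W})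
      \<in> borel_measurable (network_measure \<delta>)"
    unfolding eq by (rule prod_pairs_measurable[OF g])
qed

section \<open>Almost sure properties of a network\<close>

lemma AE_network:
  assumes "{w \<in> space (network_measure \<delta>). P w} \<in> sets (network_measure \<delta>)"
    and "\<And>p. snd p permutes {..<fst p} \<Longrightarrow> AE X in locations. P (p, X)"
  shows "AE w in network_measure \<delta>. P w"
proof -
  interpret pair_sigma_finite "measure_pmf (matching_pmf \<delta>)" locations ..
  show ?thesis
    using assms unfolding network_measure_eq
    by (intro AE_pair_measure AE_pmfI) (auto simp: matching_pmf_def set_pmf_permutes)
qed

lemma AE_permutes: "AE w in network_measure \<delta>. snd (fst w) permutes {..<num_nodes w}"
proof (rule AE_network)
  have [measurable]: "(\<lambda>w. fst w) \<in> measurable (network_measure \<delta>) (count_space UNIV)"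
    by (rule fst_network[of "\<lambda>p. p"])
  have "{w \<in> space (network_measure \<delta>). fst w \<in> {p. snd p permutes {..<fst p}}} \<in> sets (network_measure \<delta>)"
    by measurable
  then show "{w \<in> space (network_measure \<delta>). snd (fst w) permutes {..<num_nodes w}} \<in> sets (network_measure \<delta>)"
    by (simp add: num_nodes_def)
qed (simp add: num_nodes_def)

lemma AE_inside: "AE w in network_measure \<delta>. \<forall>v. pos w v \<in> unit_square"
proof (rule AE_network)
  show "{w \<in> space (network_measure \<delta>). \<forall>v. pos w v \<in> unit_square} \<in> sets (network_measure \<delta>)"
    by measurable
  have "AE X in locations. X v \<in> unit_square" for v
    unfolding locations_def using AE_unif by (intro AE_PiM_component prob_space_unif) auto
  then show "AE X in locations. \<forall>v. pos (p, X) v \<in> unit_square" for p :: "nat \<times> (nat \<Rightarrow> nat)"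
    by (simp add: pos_def AE_all_countable)
qed

text \<open>Exchangeability moves the two indices to 0 and 1, where the integral over one pair
  vanishes: for fixed \<open>x\<close>, a uniform point hits \<open>x\<close> with probability
  0.\<close>

lemma AE_locations_distinct:
  assumes "u \<noteq> v"
  shows "AE X in locations. X u \<noteq> X v"
proof -
  \<comment> \<open>Equality is expressed by the distance, whose measurability follows from
    continuity.\<close>
  define g :: "point \<Rightarrow> point \<Rightarrow> ennreal" where "g x y = (if dist x y = 0 then 1 else 0)" for x y
  have g: "(\<lambda>p. g (fst p) (snd p)) \<in> borel_measurable borel"
  proof -
    have [measurable]: "(\<lambda>p::point \<times> point. dist (fst p) (snd p)) \<in> borel_measurable borel"
      by (intro borel_measurable_continuous_onI continuous_intros)
    show ?thesis unfolding g_def by measurable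
  qed
  have F: "(\<lambda>X. g (X i) (X j)) \<in> borel_measurable locations" for i j
    unfolding g_def by measurable
  \<comment> \<open>Two transpositions give a bijection with 0 sent to \<open>u\<close> and 1 to
    \<open>v\<close>. The inner one fixes 0 because \<open>\<tau> v\<close> is not 0, which holds as
    \<open>u\<close> and \<open>v\<close> differ.\<close>
  define \<tau> where "\<tau> = Transposition.transpose 0 u"
  define \<pi> where "\<pi> = \<tau> \<circ> Transposition.transpose 1 (\<tau> v)"
  have \<tau>: "\<tau> (\<tau> v) = v" "\<tau> v \<noteq> 0" "\<tau> 0 = u"
    using assms by (auto simp: \<tau>_def transpose_eq_iff)
  then have \<pi>: "\<pi> 0 = u" "\<pi> 1 = v" by (simp_all add: \<pi>_def transpose_eq_iff Transposition.transpose_def)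
  have "bij \<pi>" by (simp add: \<pi>_def \<tau>_def bij_comp)
  have diag: "(\<integral>\<^sup>+y. g x y \<partial>unif) = 0" for x
  proof -
    have "(\<integral>\<^sup>+y. g x y \<partial>unif) = (\<integral>\<^sup>+y. indicator {x} y \<partial>unif)"
      by (intro nn_integral_cong) (auto simp: g_def indicator_def)
    also have "\<dots> = emeasure unif {x}" by simp
    also have "\<dots> \<le> emeasure lborel (unit_square \<inter> {x}) / emeasure lborel unit_square"
      by (simp add: unif_def emeasure_uniform_measure)
    also have "emeasure lborel (unit_square \<inter> {x}) = 0"
      by (rule emeasure_lborel_countable) (auto intro: countable_subset[of _ "{x}"])
    finally show ?thesis by (simp add: divide_ennreal_def)
  qed
  have "(\<integral>\<^sup>+X. g (X u) (X v) \<partial>locations) = (\<integral>\<^sup>+X. g (X 0) (X 1) \<partial>locations)"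
    using nn_integral_locations_permute[OF \<open>bij \<pi>\<close> F[of 0 1]] \<pi> by simp
  also have "\<dots> = (\<integral>\<^sup>+X. (\<Prod>i<1. g (X (2 * i)) (X (2 * i + 1))) \<partial>locations)" by simp
  also have "\<dots> = 0" by (subst nn_integral_prod_pairs_locations[OF g]) (simp add: diag)
  finally have "AE X in locations. g (X u) (X v) = 0"
    using F[of u v] by (simp add: nn_integral_0_iff_AE)
  then show ?thesis by eventually_elim (auto simp: g_def)
qed

lemma AE_separated:
  "AE w in network_measure \<delta>. \<forall>i<num_pairs w. pos w (source w i) \<noteq> pos w (dest w i)"
proof -
  have "AE w in network_measure \<delta>. \<forall>i. i < num_pairs w \<longrightarrow> dist (pos w (source w i)) (pos w (dest w i)) > 0"
  proof (rule AE_network)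
    show "{w \<in> space (network_measure \<delta>).
        \<forall>i. i < num_pairs w \<longrightarrow> dist (pos w (source w i)) (pos w (dest w i)) > 0}
      \<in> sets (network_measure \<delta>)"
      by measurable
    fix p :: "nat \<times> (nat \<Rightarrow> nat)" assume "snd p permutes {..<fst p}"
    then have "inj (snd p)" by (rule permutes_inj)
    then have "snd p (2 * i) \<noteq> snd p (2 * i + 1)" for i
      using inj_eq[of "snd p" "2 * i" "2 * i + 1"] by simp
    from AE_locations_distinct[OF this]
    have "AE X in locations. \<forall>i. X (snd p (2 * i)) \<noteq> X (snd p (2 * i + 1))"
      by (simp add: AE_all_countable)
    then show "AE X in locations. \<forall>i. i < num_pairs (p, X) \<longrightarrow>
        dist (pos (p, X) (source (p, X) i)) (pos (p, X) (dest (p, X) i)) > 0"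
      by eventually_elim (simp add: pos_def source_def dest_def)
  qed
  then show ?thesis by eventually_elim auto
qed

subsection \<open>Occupancy, load and number of nodes\<close>

text \<open>Rounding to a whole number of cells costs at most a factor 2. Having at least 4 cells
  per side leaves a constant fraction of the square on each side of the middle column, see
  \<open>half_bounds\<close>.\<close>

lemma eventually_cells_per_side:
  assumes "k \<ge> 1"
  shows "\<forall>\<^sub>F \<delta> in at_top. 1 \<le> ln \<delta> \<and> 4 \<le> cells_per_side k \<delta> \<and>
    real (cells_per_side k \<delta>) \<le> sqrt (\<delta> / (k * ln \<delta>)) \<and>
    sqrt (\<delta> / (k * ln \<delta>)) / 2 \<le> real (cells_per_side k \<delta>)"
proof -
  have "filterlim (\<lambda>\<delta>. sqrt (\<delta> / (k * ln \<delta>))) at_top at_top"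
    using assms by real_asymp
  then have "\<forall>\<^sub>F \<delta> in at_top. 8 \<le> sqrt (\<delta> / (k * ln \<delta>))"
    by (simp add: filterlim_at_top)
  moreover have "\<forall>\<^sub>F \<delta> in at_top. 1 \<le> ln (\<delta>::real)" by real_asymp
  ultimately show ?thesis
  proof eventually_elim
    case (elim \<delta>)
    have "1 / sqrt (k * ln \<delta> / \<delta>) = sqrt (\<delta> / (k * ln \<delta>))"
      by (simp add: real_sqrt_divide)
    then have "cells_per_side k \<delta> = nat \<lfloor>sqrt (\<delta> / (k * ln \<delta>))\<rfloor>"
      by (simp add: cells_per_side_def)
    moreover have "4 \<le> nat \<lfloor>x\<rfloor> \<and> real (nat \<lfloor>x\<rfloor>) \<le> x \<and> x / 2 \<le> real (nat \<lfloor>x\<rfloor>)" if "8 \<le> x" for x :: real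
      using that by (intro conjI) linarith+
    ultimately show ?case using elim by metis
  qed
qed

text \<open>The expected numbers of nodes behind the union bounds: \<open>k \<ge> 1\<close> gives at
  least \<open>ln \<delta>\<close> per cell, and a row or column has at least
  \<open>sqrt \<delta>\<close>.\<close>

lemma eventually_density_per_cell:
  assumes "k \<ge> 1"
  shows "\<forall>\<^sub>F \<delta> in at_top. 1 \<le> ln \<delta> \<and> 0 < \<delta> \<and> 4 \<le> cells_per_side k \<delta> \<and>
    (real (cells_per_side k \<delta>))\<^sup>2 \<le> \<delta> / ln \<delta> \<and>
    ln \<delta> \<le> \<delta> / (real (cells_per_side k \<delta>))\<^sup>2 \<and>
    sqrt \<delta> \<le> \<delta> / real (cells_per_side k \<delta>)"
  using eventually_cells_per_side[OF assms] eventually_gt_at_top[of 0]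
proof eventually_elim
  case (elim \<delta>)
  define q where "q = real (cells_per_side k \<delta>)"
  have q: "4 \<le> q" "q \<le> sqrt (\<delta> / (k * ln \<delta>))" using elim by (simp_all add: q_def)
  have L: "1 \<le> ln \<delta>" "0 < ln \<delta>" using elim(1) by linarith+
  have "1 * ln \<delta> \<le> k * ln \<delta>" using elim(1) assms by (intro mult_right_mono) linarith+
  then have "\<delta> / (k * ln \<delta>) \<le> \<delta> / ln \<delta>" using elim(1) \<open>0 < \<delta>\<close> by (intro frac_le) linarith+
  then have "q \<le> sqrt (\<delta> / ln \<delta>)" using q(2) by (meson order_trans real_sqrt_le_mono)
  then have 1: "q\<^sup>2 \<le> \<delta> / ln \<delta>"
  proof -
    have "q\<^sup>2 \<le> (sqrt (\<delta> / ln \<delta>))\<^sup>2" using \<open>q \<le> sqrt (\<delta> / ln \<delta>)\<close> q(1) by (intro power_mono) auto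
    moreover have "0 \<le> \<delta> / ln \<delta>" using elim by (intro divide_nonneg_nonneg) linarith+
    ultimately show ?thesis by simp
  qed
  then have 2: "ln \<delta> \<le> \<delta> / q\<^sup>2"
    using q L by (simp add: field_simps)
  have "\<delta> / ln \<delta> \<le> \<delta> / 1" using L elim(2) by (intro divide_left_mono) auto
  then have "q\<^sup>2 \<le> \<delta>" using 1 by simp
  then have "q \<le> sqrt \<delta>" using q by (simp add: real_le_rsqrt)
  then have "sqrt \<delta> * q \<le> sqrt \<delta> * sqrt \<delta>" using elim by (intro mult_left_mono) auto
  then have "sqrt \<delta> \<le> \<delta> / q" using q elim by (simp add: field_simps)
  then show ?case using 1 2 elim by (simp add: q_def)
qed

definition cell_box :: "nat \<Rightarrow> cell \<Rightarrow> point set" where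
  "cell_box q c = {real_of_int (fst c) / real q..<(real_of_int (fst c) + 1) / real q} \<times>
    {real_of_int (snd c) / real q..<(real_of_int (snd c) + 1) / real q}"

lemma mem_strip_iff:
  assumes "q > 0"
  shows "t \<in> {real_of_int a / real q..<(real_of_int a + 1) / real q} \<longleftrightarrow> \<lfloor>real q * t\<rfloor> = a"
  using assms by (auto simp: floor_eq_iff field_simps)

lemma cell_of_cell_box: "q > 0 \<Longrightarrow> x \<in> cell_box q c \<Longrightarrow> cell_of q x = c"
  unfolding cell_box_def mem_Times_iff by (simp only: mem_strip_iff cell_of_def prod_eq_iff) simp

lemma strip_bounds:
  assumes "q > 0" "a \<in> {0..<int q}"
  shows "0 \<le> real_of_int a / real q" "(real_of_int a + 1) / real q \<le> 1"
    "real_of_int a / real q \<le> (real_of_int a + 1) / real q"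
    "(real_of_int a + 1) / real q - real_of_int a / real q = 1 / real q"
proof -
  have "a + 1 \<le> int q" using assms by simp
  then have "real_of_int a + 1 \<le> real q" by linarith
  then show "(real_of_int a + 1) / real q \<le> 1" using assms by simp
  show "0 \<le> real_of_int a / real q" "real_of_int a / real q \<le> (real_of_int a + 1) / real q"
    using assms by (simp_all add: divide_right_mono)
  show "(real_of_int a + 1) / real q - real_of_int a / real q = 1 / real q"
    by (simp add: diff_divide_distrib[symmetric])
qed

lemma emeasure_cell_box:
  assumes "q > 0" "c \<in> grid q"
  shows "emeasure unif (cell_box q c) = ennreal (1 / (real q)\<^sup>2)"
proof -
  have c: "fst c \<in> {0..<int q}" "snd c \<in> {0..<int q}" using assms(2) by (auto simp: grid_def)
  show ?thesis
    unfolding cell_box_def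
    by (subst emeasure_unif_rectangle)
      (use strip_bounds[OF assms(1) c(1)] strip_bounds[OF assms(1) c(2)] in \<open>auto simp: power2_eq_square\<close>)
qed

text \<open>\<open>F\<close> counts the empty cells. Its expectation is
  \<open>q^2 * exp (- \<delta> / q^2)\<close>, and \<open>q^2 \<le> \<delta> / ln \<delta>\<close>
  together with \<open>\<delta> / q^2 \<ge> ln \<delta>\<close> bounds it by
  \<open>1 / ln \<delta>\<close>.\<close>

lemma whp_occupied:
  assumes "k \<ge> 1"
  shows "whp network_measure (\<lambda>\<delta> w. \<forall>c\<in>grid (cells_per_side k \<delta>). nodes_in (cells_per_side k \<delta>) w c \<noteq> [])"
proof (rule whp_Markov)
  define F where "F \<delta> w = (\<Sum>c\<in>grid (cells_per_side k \<delta>).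
    ennreal 0 ^ card {v. v < num_nodes w \<and> pos w v \<in> cell_box (cells_per_side k \<delta>) c})" for \<delta> w
  note ev = eventually_density_per_cell[OF assms]
  have box: "cell_box q c \<in> sets borel" for q c unfolding cell_box_def by measurable
  show "prob_space (network_measure \<delta>)" for \<delta> by (rule prob_space_network)
  show "\<forall>\<^sub>F \<delta> in at_top. F \<delta> \<in> borel_measurable (network_measure \<delta>)"
    using ev
  proof eventually_elim
    case (elim \<delta>)
    then show ?case
      unfolding F_def
      by (intro borel_measurable_sum nn_integral_power_count(2)[OF _ box emeasure_cell_box]) auto
  qed
  show "\<forall>\<^sub>F \<delta> in at_top. (\<integral>\<^sup>+w. F \<delta> w \<partial>network_measure \<delta>) \<le> ennreal (1 / ln \<delta>)"
    using ev
  proof eventually_elim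
    case (elim \<delta>)
    define q where "q = cells_per_side k \<delta>"
    have d: "0 < \<delta>" "1 \<le> ln \<delta>" using elim by blast+
    have q: "0 < q" "(real q)\<^sup>2 \<le> \<delta> / ln \<delta>" "ln \<delta> \<le> \<delta> / (real q)\<^sup>2" using elim by (simp_all add: q_def)
    have "(\<integral>\<^sup>+w. F \<delta> w \<partial>network_measure \<delta>) = (\<Sum>c\<in>grid q. ennreal (exp (\<delta> * (1 / (real q)\<^sup>2) * (0 - 1))))"
    proof -
      have pos: "0 < \<delta>" "0 \<le> 1 / (real q)\<^sup>2" using d by auto
      have m: "(\<lambda>w. ennreal 0 ^ card {v. v < num_nodes w \<and> pos w v \<in> cell_box q c}) \<in> borel_measurable (network_measure \<delta>)"
        if "c \<in> grid q" for c
        by (rule nn_integral_power_count(2)[OF pos(1) box emeasure_cell_box[OF q(1) that] pos(2) order_refl])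
      have i: "(\<integral>\<^sup>+w. ennreal 0 ^ card {v. v < num_nodes w \<and> pos w v \<in> cell_box q c} \<partial>network_measure \<delta>)
          = ennreal (exp (\<delta> * (1 / (real q)\<^sup>2) * (0 - 1)))" if "c \<in> grid q" for c
        by (rule nn_integral_power_count(1)[OF pos(1) box emeasure_cell_box[OF q(1) that] pos(2) order_refl])
      have "(\<integral>\<^sup>+w. F \<delta> w \<partial>network_measure \<delta>) = (\<Sum>c\<in>grid q.
          \<integral>\<^sup>+w. ennreal 0 ^ card {v. v < num_nodes w \<and> pos w v \<in> cell_box q c} \<partial>network_measure \<delta>)"
        unfolding F_def q_def[symmetric] by (rule nn_integral_sum[OF m])
      also have "\<dots> = (\<Sum>c\<in>grid q. ennreal (exp (\<delta> * (1 / (real q)\<^sup>2) * (0 - 1))))"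
        by (rule sum.cong[OF refl i])
      finally show ?thesis .
    qed
    also have "\<dots> = ennreal ((real q)\<^sup>2 * exp (- (\<delta> / (real q)\<^sup>2)))"
      by (simp add: card_grid ennreal_mult ennreal_of_nat_eq_real_of_nat)
    also have "\<dots> \<le> ennreal (\<delta> / ln \<delta> * exp (- ln \<delta>))"
    proof (intro ennreal_leI mult_mono)
      show "0 \<le> \<delta> / ln \<delta>" using d by (intro divide_nonneg_nonneg) linarith+
    qed (use q in auto)
    also have "\<delta> / ln \<delta> * exp (- ln \<delta>) = 1 / ln \<delta>"
    proof -
      have "exp (- ln \<delta>) = 1 / \<delta>" using d by (simp add: exp_minus inverse_eq_divide)
      then show ?thesis using d by simp
    qed
    finally show ?case .
  qed
  show "((\<lambda>\<delta>::real. 1 / ln \<delta>) \<longlongrightarrow> 0) at_top" by real_asymp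
  show "\<forall>\<^sub>F \<delta> in at_top. \<forall>w\<in>space (network_measure \<delta>). F \<delta> w < 1 \<longrightarrow>
      (\<forall>c\<in>grid (cells_per_side k \<delta>). nodes_in (cells_per_side k \<delta>) w c \<noteq> [])"
    using ev
  proof eventually_elim
    case (elim \<delta>)
    define q where "q = cells_per_side k \<delta>"
    have q: "0 < q" using elim by (simp add: q_def)
    have "nodes_in q w c \<noteq> []" if "F \<delta> w < 1" "c \<in> grid q" for w c
    proof -
      have "ennreal 0 ^ card {v. v < num_nodes w \<and> pos w v \<in> cell_box q c} \<le> F \<delta> w"
        unfolding F_def q_def[symmetric] by (rule member_le_sum[OF that(2)]) auto
      then have "card {v. v < num_nodes w \<and> pos w v \<in> cell_box q c} \<noteq> 0"
        using that(1) by (intro notI) simp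
      then obtain v where "v < num_nodes w" "pos w v \<in> cell_box q c"
        by (metis (mono_tags, lifting) Collect_empty_eq card.empty)
      then have "v \<in> set (nodes_in q w c)"
        using cell_of_cell_box[OF q] by (simp add: set_nodes_in)
      then show ?thesis by auto
    qed
    then show ?case by (simp add: q_def)
  qed
qed

text \<open>A Chernoff bound with base 2 at four times the mean \<open>\<delta> / q\<close>: as
  \<open>4 * ln 2 - 1 \<ge> 1\<close>, each strip fails with probability at most
  \<open>exp (- \<delta> / q) \<le> exp (- sqrt \<delta>)\<close>. There are at most
  \<open>\<delta>\<close> strips. The family \<open>S\<close> is left open to serve rows and
  columns.\<close>

lemma whp_strip:
  fixes S :: "nat \<Rightarrow> nat \<Rightarrow> point set"
  assumes "k \<ge> 1" and S: "\<And>q b. b < q \<Longrightarrow> S q b \<in> sets borel"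
    "\<And>q b. b < q \<Longrightarrow> emeasure unif (S q b) = ennreal (1 / real q)"
  shows "whp network_measure (\<lambda>\<delta> w. \<forall>b<cells_per_side k \<delta>.
    real (card {v. v < num_nodes w \<and> pos w v \<in> S (cells_per_side k \<delta>) b}) \<le> 4 * \<delta> / real (cells_per_side k \<delta>))"
proof (rule whp_Markov)
  define F where "F \<delta> w = (\<Sum>b<cells_per_side k \<delta>.
    ennreal 2 ^ card {v. v < num_nodes w \<and> pos w v \<in> S (cells_per_side k \<delta>) b} *
    ennreal (2 powr (- (4 * \<delta> / real (cells_per_side k \<delta>)))))" for \<delta> w
  note ev = eventually_density_per_cell[OF assms(1)]
  have m: "(\<lambda>w. ennreal 2 ^ card {v. v < num_nodes w \<and> pos w v \<in> S (cells_per_side k \<delta>) b} *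
    ennreal (2 powr (- (4 * \<delta> / real (cells_per_side k \<delta>))))) \<in> borel_measurable (network_measure \<delta>)"
    if "0 < \<delta>" "b < cells_per_side k \<delta>" for \<delta> b
    using that S by (intro borel_measurable_times_ennreal borel_measurable_const nn_integral_power_count(2)) auto
  show "prob_space (network_measure \<delta>)" for \<delta> by (rule prob_space_network)
  show "\<forall>\<^sub>F \<delta> in at_top. F \<delta> \<in> borel_measurable (network_measure \<delta>)"
    using ev
  proof eventually_elim
    case (elim \<delta>)
    then show ?case unfolding F_def by (intro borel_measurable_sum m) auto
  qed
  show "\<forall>\<^sub>F \<delta> in at_top. (\<integral>\<^sup>+w. F \<delta> w \<partial>network_measure \<delta>) \<le> ennreal (\<delta> * exp (- sqrt \<delta>))"
    using ev
  proof eventually_elim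
    case (elim \<delta>)
    define q where "q = cells_per_side k \<delta>"
    have d: "0 < \<delta>" "1 \<le> ln \<delta>" using elim by blast+
    have q: "0 < q" "(real q)\<^sup>2 \<le> \<delta> / ln \<delta>" "sqrt \<delta> \<le> \<delta> / real q" using elim by (simp_all add: q_def)
    have "(\<integral>\<^sup>+w. F \<delta> w \<partial>network_measure \<delta>) = (\<Sum>b<q. ennreal (exp (\<delta> * (1 / real q) * (2 - 1))) *
        ennreal (2 powr (- (4 * \<delta> / real q))))"
    proof -
      have pos: "0 \<le> 1 / real q" "0 \<le> (2::real)" by auto
      note rules = nn_integral_power_count[OF d(1) S pos]
      have i: "(\<integral>\<^sup>+w. ennreal 2 ^ card {v. v < num_nodes w \<and> pos w v \<in> S q b} *
          ennreal (2 powr (- (4 * \<delta> / real q))) \<partial>network_measure \<delta>)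
        = ennreal (exp (\<delta> * (1 / real q) * (2 - 1))) * ennreal (2 powr (- (4 * \<delta> / real q)))" if "b < q" for b
        unfolding nn_integral_multc[OF rules(2)[OF that that]] rules(1)[OF that that] ..
      have "(\<integral>\<^sup>+w. F \<delta> w \<partial>network_measure \<delta>) = (\<Sum>b<q. \<integral>\<^sup>+w.
          ennreal 2 ^ card {v. v < num_nodes w \<and> pos w v \<in> S q b} *
          ennreal (2 powr (- (4 * \<delta> / real q))) \<partial>network_measure \<delta>)"
        unfolding F_def q_def[symmetric]
        by (rule nn_integral_sum, rule m[OF d(1), folded q_def]) simp
      also have "\<dots> = (\<Sum>b<q. ennreal (exp (\<delta> * (1 / real q) * (2 - 1))) *
          ennreal (2 powr (- (4 * \<delta> / real q))))"
        by (rule sum.cong[OF refl i]) simp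
      finally show ?thesis .
    qed
    also have "\<dots> = ennreal (real q * (exp (\<delta> / real q) * 2 powr (- (4 * \<delta> / real q))))"
      by (simp add: ennreal_mult ennreal_of_nat_eq_real_of_nat)
    also have "\<dots> \<le> ennreal (\<delta> * exp (- sqrt \<delta>))"
    proof (intro ennreal_leI mult_mono)
      have "real q \<le> (real q)\<^sup>2" using q(1) by (simp add: power2_eq_square)
      also have "\<dots> \<le> \<delta> / ln \<delta>" by (rule q)
      also have "\<dots> \<le> \<delta> / 1" using d by (intro divide_left_mono) linarith+
      finally show "real q \<le> \<delta>" by simp
      have "2 powr (- (4 * \<delta> / real q)) = exp (- (4 * (\<delta> / real q)) * ln 2)" by (simp add: powr_def)
      then have "exp (\<delta> / real q) * 2 powr (- (4 * \<delta> / real q)) = exp (\<delta> / real q * (1 - 4 * ln 2))"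
        by (simp add: exp_add[symmetric] algebra_simps)
      also have "\<delta> / real q * (1 - 4 * ln 2) \<le> \<delta> / real q * (- 1)"
        using ln2_ge_two_thirds d by (intro mult_left_mono) auto
      also have "\<dots> \<le> - sqrt \<delta>" using q(3) by simp
      finally show "exp (\<delta> / real q) * 2 powr (- (4 * \<delta> / real q)) \<le> exp (- sqrt \<delta>)" by simp
    qed (use d in auto)
    finally show ?case .
  qed
  show "((\<lambda>\<delta>::real. \<delta> * exp (- sqrt \<delta>)) \<longlongrightarrow> 0) at_top" by real_asymp
  show "\<forall>\<^sub>F \<delta> in at_top. \<forall>w\<in>space (network_measure \<delta>). F \<delta> w < 1 \<longrightarrow> (\<forall>b<cells_per_side k \<delta>.
    real (card {v. v < num_nodes w \<and> pos w v \<in> S (cells_per_side k \<delta>) b}) \<le> 4 * \<delta> / real (cells_per_side k \<delta>))"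
  proof (intro always_eventually allI ballI impI)
    fix \<delta> w b assume F: "F \<delta> w < 1" and b: "b < cells_per_side k \<delta>"
    define K where "K = 4 * \<delta> / real (cells_per_side k \<delta>)"
    define n where "n = card {v. v < num_nodes w \<and> pos w v \<in> S (cells_per_side k \<delta>) b}"
    have "ennreal 2 ^ n * ennreal (2 powr (- K)) \<le> F \<delta> w"
      unfolding F_def n_def K_def using b
      by (intro member_le_sum[of b "{..<cells_per_side k \<delta>}" "\<lambda>b. ennreal 2 ^ card {v. v < num_nodes w \<and> pos w v \<in> S (cells_per_side k \<delta>) b} *
    ennreal (2 powr (- (4 * \<delta> / real (cells_per_side k \<delta>))))"]) auto
    then have "ennreal (2 ^ n * 2 powr (- K)) < ennreal 1"
      using F by (simp add: ennreal_power ennreal_mult del: ennreal_numeral)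
    then have "2 ^ n * 2 powr (- K) < (1::real)" by (subst (asm) ennreal_less_iff) auto
    then have "2 powr (real n - K) < 2 powr 0" by (simp add: powr_diff powr_minus powr_realpow field_simps)
    then have "real n - K < 0" by (subst (asm) powr_less_cancel_iff) auto
    then show "real n \<le> K" by simp
  qed
qed

text \<open>Both tails at once, with base 2 for the upper and base 1/4 for the lower one. The
  exponents \<open>1 - 2 * ln 2\<close> and \<open>ln 4 / 4 - 3 / 4\<close> are negative because
  \<open>2 / 3 \<le> ln 2 < 1\<close>. The summands are nonnegative, so if their sum is below 1,
  each is.\<close>

lemma whp_num_nodes:
  "whp network_measure (\<lambda>\<delta> w. \<delta> / 4 \<le> real (num_nodes w) \<and> real (num_nodes w) \<le> 2 * \<delta>)"
proof (rule whp_Markov)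
  define F where "F \<delta> w = ennreal 2 ^ card {v. v < num_nodes w \<and> pos w v \<in> UNIV} * ennreal (2 powr (- (2 * \<delta>)))
    + ennreal (1 / 4) ^ card {v. v < num_nodes w \<and> pos w v \<in> UNIV} * ennreal (4 powr (\<delta> / 4))" for \<delta> w
  have U: "emeasure unif UNIV = ennreal 1" using unif.emeasure_space_1 by simp
  show "prob_space (network_measure \<delta>)" for \<delta> by (rule prob_space_network)
  have m [measurable]: "(\<lambda>w. ennreal s ^ card {v. v < num_nodes w \<and> pos w v \<in> UNIV}) \<in> borel_measurable (network_measure \<delta>)"
    if "0 < \<delta>" "0 \<le> s" for \<delta> s
    using that by (intro nn_integral_power_count(2)[OF _ _ U]) auto
  show "\<forall>\<^sub>F \<delta> in at_top. F \<delta> \<in> borel_measurable (network_measure \<delta>)"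
    using eventually_gt_at_top[of 0]
  proof eventually_elim
    case (elim \<delta>)
    then show ?case unfolding F_def by (intro borel_measurable_add borel_measurable_times m) auto
  qed
  show "\<forall>\<^sub>F \<delta> in at_top. (\<integral>\<^sup>+w. F \<delta> w \<partial>network_measure \<delta>) \<le>
      ennreal (exp (\<delta> * (1 - 2 * ln 2)) + exp (\<delta> * (ln 4 / 4 - 3 / 4)))"
    using eventually_gt_at_top[of 0]
  proof eventually_elim
    case (elim \<delta>)
    have "(\<integral>\<^sup>+w. F \<delta> w \<partial>network_measure \<delta>) = ennreal (exp (\<delta> * 1 * (2 - 1))) * ennreal (2 powr (- (2 * \<delta>)))
      + ennreal (exp (\<delta> * 1 * (1 / 4 - 1))) * ennreal (4 powr (\<delta> / 4))"
      unfolding F_def using m[OF elim, of 2] m[OF elim, of "1 / 4"]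
        nn_integral_power_count(1)[OF elim _ U, of 2] nn_integral_power_count(1)[OF elim _ U, of "1 / 4"]
      by (subst nn_integral_add) (auto simp: nn_integral_multc simp del: UNIV_I)
    also have "\<dots> = ennreal (exp \<delta> * 2 powr (- (2 * \<delta>)) + exp (\<delta> * (1 / 4 - 1)) * 4 powr (\<delta> / 4))"
      by (simp add: ennreal_mult ennreal_plus mult.commute)
    also have "exp \<delta> * 2 powr (- (2 * \<delta>)) = exp (\<delta> * (1 - 2 * ln 2))"
      by (simp add: powr_def exp_add[symmetric] algebra_simps)
    also have "exp (\<delta> * (1 / 4 - 1)) * 4 powr (\<delta> / 4) = exp (\<delta> * (ln 4 / 4 - 3 / 4))"
      by (simp add: powr_def exp_add[symmetric] algebra_simps)
    finally show ?case by simp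
  qed
  show "((\<lambda>\<delta>::real. exp (\<delta> * (1 - 2 * ln 2)) + exp (\<delta> * (ln 4 / 4 - 3 / 4))) \<longlongrightarrow> 0) at_top"
  proof -
    define a b where "a = 2 * ln 2 - (1::real)" and "b = 3 / 4 - ln 4 / (4::real)"
    have "0 < a" using ln2_ge_two_thirds by (simp add: a_def)
    have "ln (2^2) = 2 * ln (2::real)" by (subst ln_realpow) auto
    then have "0 < b" using ln_2_less_1 by (simp add: b_def)
    have "((\<lambda>\<delta>::real. exp (- a * \<delta>)) \<longlongrightarrow> 0) at_top" "((\<lambda>\<delta>::real. exp (- b * \<delta>)) \<longlongrightarrow> 0) at_top"
      using \<open>0 < a\<close> \<open>0 < b\<close> by real_asymp+
    then have "((\<lambda>\<delta>::real. exp (- a * \<delta>) + exp (- b * \<delta>)) \<longlongrightarrow> 0) at_top"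
      using tendsto_add by fastforce
    then show ?thesis by (simp add: a_def b_def algebra_simps)
  qed
  show "\<forall>\<^sub>F \<delta> in at_top. \<forall>w\<in>space (network_measure \<delta>). F \<delta> w < 1 \<longrightarrow>
      \<delta> / 4 \<le> real (num_nodes w) \<and> real (num_nodes w) \<le> 2 * \<delta>"
  proof (intro always_eventually allI ballI impI)
    fix \<delta> and w assume F: "F \<delta> w < 1"
    define n where "n = num_nodes w"
    have F_eq: "F \<delta> w = ennreal (2 ^ n * 2 powr (- (2 * \<delta>)) + (1 / 4) ^ n * 4 powr (\<delta> / 4))"
      unfolding F_def
      by (simp add: n_def ennreal_power ennreal_mult ennreal_plus del: ennreal_numeral)
    have *: "2 ^ n * 2 powr (- (2 * \<delta>)) + (1 / 4) ^ n * 4 powr (\<delta> / 4) < (1::real)"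
      using F unfolding F_eq ennreal_less_one_iff .
    moreover have "0 \<le> 2 ^ n * 2 powr (- (2 * \<delta>))" "0 \<le> (1 / 4) ^ n * 4 powr (\<delta> / 4)" by simp_all
    ultimately have **: "2 ^ n * 2 powr (- (2 * \<delta>)) < 1" "(1 / 4) ^ n * 4 powr (\<delta> / 4) < 1" by linarith+
    then have "2 ^ n * 2 powr (- (2 * \<delta>)) < (1::real)"
      by simp
    then have "2 powr (real n - 2 * \<delta>) < 2 powr 0" by (simp add: powr_diff powr_minus powr_realpow field_simps)
    then have "real n - 2 * \<delta> < 0" by (subst (asm) powr_less_cancel_iff) auto
    then have 1: "real n \<le> 2 * \<delta>" by simp
    have "(1 / 4) ^ n * 4 powr (\<delta> / 4) < (1::real)"
      using ** by simp
    moreover have "(1 / 4) ^ n = 4 powr (- real n)"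
      by (simp add: powr_minus powr_realpow power_one_over inverse_eq_divide)
    ultimately have "4 powr (- real n + \<delta> / 4) < 4 powr 0" by (simp only: powr_add) simp
    then have "- real n + \<delta> / 4 < 0" by (subst (asm) powr_less_cancel_iff) auto
    then have "\<delta> / 4 \<le> real n" by simp
    then show "\<delta> / 4 \<le> real (num_nodes w) \<and> real (num_nodes w) \<le> 2 * \<delta>" using 1 by (simp add: n_def)
  qed
qed

text \<open>
  All pairs with their source in \<open>left_strip q\<close> and their destination in \<open>right_part q\<close> have
  their HDP through the cell \<open>(q div 2, q div 2)\<close>; \<open>center_box q\<close> is the central quarter of this cell.
\<close>

definition left_strip :: "nat \<Rightarrow> point set" where
  "left_strip q = {0..<real (q div 2) / real q} \<times> {real (q div 2) / real q..<(real (q div 2) + 1) / real q}"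

definition right_part :: "nat \<Rightarrow> point set" where
  "right_part q = {(real (q div 2) + 1) / real q..<1} \<times> {0..<1}"

definition center_box :: "nat \<Rightarrow> point set" where
  "center_box q = {(real (q div 2) + 1 / 4) / real q..<(real (q div 2) + 3 / 4) / real q} \<times>
    {(real (q div 2) + 1 / 4) / real q..<(real (q div 2) + 3 / 4) / real q}"

lemma sets_center [measurable]:
  "left_strip q \<in> sets borel" "right_part q \<in> sets borel" "center_box q \<in> sets borel"
  unfolding left_strip_def right_part_def center_box_def by measurable

lemma half_bounds:
  assumes "4 \<le> q"
  shows "real q / 4 \<le> real (q div 2)" "real (q div 2) + 1 \<le> 3 / 4 * real q"
proof -
  have "real (2 * (q div 2)) \<le> real q" "real q \<le> real (2 * (q div 2) + 1)"
    unfolding of_nat_le_iff by linarith+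
  then show "real q / 4 \<le> real (q div 2)" "real (q div 2) + 1 \<le> 3 / 4 * real q"
    using assms unfolding of_nat_mult of_nat_add by linarith+
qed

lemma emeasure_left_strip:
  assumes "4 \<le> q"
  shows "emeasure unif (left_strip q) = ennreal (real (q div 2) / (real q)\<^sup>2)"
  using half_bounds[OF assms] assms unfolding left_strip_def
  by (subst emeasure_unif_rectangle)
    (simp_all add: power2_eq_square field_simps diff_divide_distrib[symmetric])

lemma emeasure_right_part:
  assumes "4 \<le> q"
  shows "emeasure unif (right_part q) = ennreal (1 - (real (q div 2) + 1) / real q)"
  using half_bounds[OF assms] assms unfolding right_part_def
  by (subst emeasure_unif_rectangle) (simp_all add: field_simps)

lemma emeasure_center_box:
  assumes "4 \<le> q"
  shows "emeasure unif (center_box q) = ennreal (1 / (4 * (real q)\<^sup>2))"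
proof -
  have "(real (q div 2) + 3 / 4) / real q - (real (q div 2) + 1 / 4) / real q = 1 / (2 * real q)"
    using assms by (simp add: diff_divide_distrib[symmetric])
  then show ?thesis
    using half_bounds[OF assms] assms unfolding center_box_def
    by (subst emeasure_unif_rectangle) (simp_all add: power2_eq_square divide_right_mono)
qed

lemma right_part_ge:
  assumes "4 \<le> q"
  shows "1 / 4 \<le> 1 - (real (q div 2) + 1) / real q"
  using half_bounds[OF assms] assms by (simp add: field_simps)

text \<open>The center box has area \<open>1 / (4 * q^2)\<close> and the right part area at least
  1/4, so no such pair exists with probability at most \<open>2 * exp (- ln \<delta> / 32)\<close>,
  where \<open>32 = 4 * 4 * 2\<close>.\<close>

lemma whp_central_source:
  assumes "k \<ge> 1"
  shows "whp network_measure (\<lambda>\<delta> w. \<exists>i<num_pairs w.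
    pos w (source w i) \<in> center_box (cells_per_side k \<delta>) \<and> pos w (dest w i) \<in> right_part (cells_per_side k \<delta>))"
proof (rule whp_Markov)
  define F where "F \<delta> w = ennreal 0 ^ card {i. i < num_pairs w \<and>
    pos w (source w i) \<in> center_box (cells_per_side k \<delta>) \<and> pos w (dest w i) \<in> right_part (cells_per_side k \<delta>)}" for \<delta> w
  note ev = eventually_density_per_cell[OF assms]
  have F: "F \<delta> \<in> borel_measurable (network_measure \<delta>)"
    "(\<integral>\<^sup>+w. F \<delta> w \<partial>network_measure \<delta>) \<le> ennreal (2 * exp (- ln \<delta> / 32))"
    if d: "0 < \<delta>" "4 \<le> cells_per_side k \<delta>" "ln \<delta> \<le> \<delta> / (real (cells_per_side k \<delta>))\<^sup>2" for \<delta>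
  proof -
    define q where "q = cells_per_side k \<delta>"
    have q: "4 \<le> q" "ln \<delta> \<le> \<delta> / (real q)\<^sup>2" using d by (simp_all add: q_def)
    define p r where "p = 1 / (4 * (real q)\<^sup>2)" and "r = 1 - (real (q div 2) + 1) / real q"
    have r: "1 / 4 \<le> r" using right_part_ge[OF q(1)] by (simp add: r_def)
    have pr: "0 \<le> p" "0 \<le> r" "0 \<le> (0::real)" "0 \<le> (1::real)" using r by (simp_all add: p_def)
    note rules = nn_integral_power_count_pairs[OF d(1) sets_center(3) emeasure_center_box[OF q(1), folded p_def] pr(1)
      sets_center(2) emeasure_right_part[OF q(1), folded r_def] pr(2) pr(3) pr(4)]
    show "F \<delta> \<in> borel_measurable (network_measure \<delta>)"
      unfolding F_def q_def[symmetric] by (rule rules(2))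
    have "(\<integral>\<^sup>+w. F \<delta> w \<partial>network_measure \<delta>) \<le> ennreal (2 * exp (- \<delta> * ((1 - 0) * (p * r)) / 2))"
      unfolding F_def q_def[symmetric] by (rule rules(1))
    also have "\<dots> \<le> ennreal (2 * exp (- ln \<delta> / 32))"
    proof -
      have "ln \<delta> / 32 \<le> \<delta> / (real q)\<^sup>2 / 32" using q(2) by simp
      also have "\<dots> = \<delta> * (p * (1 / 4)) / 2" by (simp add: p_def)
      also have "\<dots> \<le> \<delta> * (p * r) / 2"
        using r pr d(1) by (intro divide_right_mono mult_left_mono) auto
      finally show ?thesis by (intro ennreal_leI) simp
    qed
    finally show "(\<integral>\<^sup>+w. F \<delta> w \<partial>network_measure \<delta>) \<le> ennreal (2 * exp (- ln \<delta> / 32))" .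
  qed
  show "prob_space (network_measure \<delta>)" for \<delta> by (rule prob_space_network)
  show "\<forall>\<^sub>F \<delta> in at_top. F \<delta> \<in> borel_measurable (network_measure \<delta>)"
    using ev by eventually_elim (rule F, blast+)
  show "\<forall>\<^sub>F \<delta> in at_top. (\<integral>\<^sup>+w. F \<delta> w \<partial>network_measure \<delta>) \<le> ennreal (2 * exp (- ln \<delta> / 32))"
    using ev by eventually_elim (rule F, blast+)
  show "((\<lambda>\<delta>::real. 2 * exp (- ln \<delta> / 32)) \<longlongrightarrow> 0) at_top" by real_asymp
  have "\<exists>i<num_pairs w. pos w (source w i) \<in> center_box (cells_per_side k \<delta>) \<and>
      pos w (dest w i) \<in> right_part (cells_per_side k \<delta>)" if "F \<delta> w < 1" for \<delta> w
  proof (rule ccontr)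
    assume "\<not> ?thesis"
    then have "{i. i < num_pairs w \<and> pos w (source w i) \<in> center_box (cells_per_side k \<delta>) \<and>
      pos w (dest w i) \<in> right_part (cells_per_side k \<delta>)} = {}" by blast
    then have "F \<delta> w = 1" unfolding F_def by (simp only: card.empty power_0)
    then show False using that by simp
  qed
  then show "\<forall>\<^sub>F \<delta> in at_top. \<forall>w\<in>space (network_measure \<delta>). F \<delta> w < 1 \<longrightarrow> (\<exists>i<num_pairs w.
    pos w (source w i) \<in> center_box (cells_per_side k \<delta>) \<and> pos w (dest w i) \<in> right_part (cells_per_side k \<delta>))"
    by simp
qed

text \<open>A Chernoff bound with base 1/2. The left strip has area at least
  \<open>1 / (4 * q)\<close> and the right part at least 1/4, so the moment contributes the exponent
  \<open>- \<delta> / (64 * q)\<close>. The threshold with 128 spends at most half of it.\<close>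

lemma whp_center_load:
  assumes "k \<ge> 1"
  shows "whp network_measure (\<lambda>\<delta> w. \<delta> / (128 * real (cells_per_side k \<delta>)) \<le> real (card {i. i < num_pairs w \<and>
    pos w (source w i) \<in> left_strip (cells_per_side k \<delta>) \<and> pos w (dest w i) \<in> right_part (cells_per_side k \<delta>)}))"
proof (rule whp_Markov)
  define n where "n \<delta> w = card {i. i < num_pairs w \<and>
    pos w (source w i) \<in> left_strip (cells_per_side k \<delta>) \<and> pos w (dest w i) \<in> right_part (cells_per_side k \<delta>)}" for \<delta> w
  define K where "K \<delta> = \<delta> / (128 * real (cells_per_side k \<delta>))" for \<delta>
  define F where "F \<delta> w = ennreal (1 / 2) ^ n \<delta> w * ennreal (2 powr K \<delta>)" for \<delta> w
  note ev = eventually_density_per_cell[OF assms]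
  have F: "F \<delta> \<in> borel_measurable (network_measure \<delta>)"
    "(\<integral>\<^sup>+w. F \<delta> w \<partial>network_measure \<delta>) \<le> ennreal (2 * exp (- sqrt \<delta> / 128))"
    if d: "0 < \<delta>" "4 \<le> cells_per_side k \<delta>" "sqrt \<delta> \<le> \<delta> / real (cells_per_side k \<delta>)" for \<delta>
  proof -
    define q where "q = cells_per_side k \<delta>"
    have q: "4 \<le> q" "sqrt \<delta> \<le> \<delta> / real q" using d by (simp_all add: q_def)
    define p r where "p = real (q div 2) / (real q)\<^sup>2" and "r = 1 - (real (q div 2) + 1) / real q"
    have r: "1 / 4 \<le> r" using right_part_ge[OF q(1)] by (simp add: r_def)
    have "1 / (4 * real q) = real q / 4 / (real q)\<^sup>2" using q(1) by (simp add: power2_eq_square)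
    also have "\<dots> \<le> p" unfolding p_def using half_bounds(1)[OF q(1)] by (intro divide_right_mono) auto
    finally have p: "1 / (4 * real q) \<le> p" .
    have pr: "0 \<le> p" "0 \<le> r" "0 \<le> 1 / (2::real)" "1 / 2 \<le> (1::real)" using r by (simp_all add: p_def)
    note rules = nn_integral_power_count_pairs[OF d(1) sets_center(1) emeasure_left_strip[OF q(1), folded p_def] pr(1)
      sets_center(2) emeasure_right_part[OF q(1), folded r_def] pr(2) pr(3) pr(4)]
    have m: "(\<lambda>w. ennreal (1 / 2) ^ n \<delta> w) \<in> borel_measurable (network_measure \<delta>)"
      unfolding n_def q_def[symmetric] by (rule rules(2))
    show "F \<delta> \<in> borel_measurable (network_measure \<delta>)"
      unfolding F_def using m by (intro borel_measurable_times_ennreal borel_measurable_const)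
    have "(\<integral>\<^sup>+w. F \<delta> w \<partial>network_measure \<delta>) = (\<integral>\<^sup>+w. ennreal (1 / 2) ^ n \<delta> w \<partial>network_measure \<delta>) * ennreal (2 powr K \<delta>)"
      unfolding F_def by (rule nn_integral_multc[OF m])
    also have "\<dots> \<le> ennreal (2 * exp (- \<delta> * ((1 - 1 / 2) * (p * r)) / 2)) * ennreal (2 powr K \<delta>)"
      unfolding n_def q_def[symmetric] by (intro mult_right_mono rules(1)) simp
    also have "\<dots> = ennreal (2 * exp (- \<delta> * ((1 - 1 / 2) * (p * r)) / 2) * 2 powr K \<delta>)"
      by (rule ennreal_mult[symmetric]) auto
    also have "\<dots> \<le> ennreal (2 * exp (- sqrt \<delta> / 128))"
    proof -
      have "1 / (4 * real q) * (1 / 4) \<le> p * r"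
        using p r pr by (intro mult_mono) auto
      then have "\<delta> * (1 / (4 * real q) * (1 / 4)) \<le> \<delta> * (p * r)"
        using d(1) by (intro mult_left_mono) auto
      then have a: "\<delta> / real q / 16 \<le> \<delta> * (p * r)" by simp
      have "K \<delta> * ln 2 \<le> K \<delta> * 1"
        using ln_2_less_1 d(1) by (intro mult_left_mono) (auto simp: K_def)
      then have b: "K \<delta> * ln 2 \<le> \<delta> / real q / 128" by (simp add: K_def q_def)
      have "exp (- \<delta> * ((1 - 1 / 2) * (p * r)) / 2) * 2 powr K \<delta> = exp (- (\<delta> * (p * r)) / 4 + K \<delta> * ln 2)"
        by (simp add: powr_def exp_add[symmetric])
      also have "\<dots> \<le> exp (- sqrt \<delta> / 128)"
        using a b q(2) by simp
      finally show ?thesis by (intro ennreal_leI) simp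
    qed
    finally show "(\<integral>\<^sup>+w. F \<delta> w \<partial>network_measure \<delta>) \<le> ennreal (2 * exp (- sqrt \<delta> / 128))" .
  qed
  show "prob_space (network_measure \<delta>)" for \<delta> by (rule prob_space_network)
  show "\<forall>\<^sub>F \<delta> in at_top. F \<delta> \<in> borel_measurable (network_measure \<delta>)"
    using ev by eventually_elim (rule F, blast+)
  show "\<forall>\<^sub>F \<delta> in at_top. (\<integral>\<^sup>+w. F \<delta> w \<partial>network_measure \<delta>) \<le> ennreal (2 * exp (- sqrt \<delta> / 128))"
    using ev by eventually_elim (rule F, blast+)
  show "((\<lambda>\<delta>::real. 2 * exp (- sqrt \<delta> / 128)) \<longlongrightarrow> 0) at_top" by real_asymp
  have "K \<delta> \<le> real (n \<delta> w)" if "F \<delta> w < 1" for \<delta> w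
  proof -
    have "(1 / 2) ^ n \<delta> w = 2 powr (- real (n \<delta> w))"
      by (simp add: powr_minus powr_realpow power_one_over inverse_eq_divide)
    moreover have "F \<delta> w = ennreal ((1 / 2) ^ n \<delta> w * 2 powr K \<delta>)"
    proof -
      have "ennreal (1 / 2) ^ n \<delta> w = ennreal ((1 / 2) ^ n \<delta> w)" by (rule ennreal_power) simp
      then show ?thesis unfolding F_def by (simp only:) (rule ennreal_mult[symmetric], simp_all)
    qed
    ultimately have "F \<delta> w = ennreal (2 powr (- real (n \<delta> w) + K \<delta>))" by (simp only: powr_add)
    then have "2 powr (- real (n \<delta> w) + K \<delta>) < 2 powr 0" using that by (simp add: ennreal_less_one_iff)
    then have "- real (n \<delta> w) + K \<delta> < 0" by (subst (asm) powr_less_cancel_iff) auto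
    then show ?thesis by simp
  qed
  then show "\<forall>\<^sub>F \<delta> in at_top. \<forall>w\<in>space (network_measure \<delta>). F \<delta> w < 1 \<longrightarrow>
    \<delta> / (128 * real (cells_per_side k \<delta>)) \<le> real (card {i. i < num_pairs w \<and>
    pos w (source w i) \<in> left_strip (cells_per_side k \<delta>) \<and> pos w (dest w i) \<in> right_part (cells_per_side k \<delta>)})"
    by (simp add: K_def n_def)
qed

section \<open>Rows, columns and the load of a cell\<close>

definition row_strip :: "nat \<Rightarrow> nat \<Rightarrow> point set" where
  "row_strip q b = {0..<1} \<times> {real b / real q..<(real b + 1) / real q}"

definition column_strip :: "nat \<Rightarrow> nat \<Rightarrow> point set" where
  "column_strip q b = {real b / real q..<(real b + 1) / real q} \<times> {0..<1}"

lemma emeasure_strips: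
  assumes "b < q"
  shows "emeasure unif (row_strip q b) = ennreal (1 / real q)"
    and "emeasure unif (column_strip q b) = ennreal (1 / real q)"
proof -
  have "0 < q" "int b \<in> {0..<int q}" using assms by auto
  note sb = strip_bounds[OF this, unfolded of_int_of_nat_eq]
  show "emeasure unif (row_strip q b) = ennreal (1 / real q)"
    unfolding row_strip_def by (subst emeasure_unif_rectangle) (use sb in auto)
  show "emeasure unif (column_strip q b) = ennreal (1 / real q)"
    unfolding column_strip_def by (subst emeasure_unif_rectangle) (use sb in auto)
qed

lemma whp_strips:
  assumes "k \<ge> 1"
  shows "whp network_measure (\<lambda>\<delta> w. \<forall>b<cells_per_side k \<delta>.
    real (card {v. v < num_nodes w \<and> pos w v \<in> row_strip (cells_per_side k \<delta>) b}) \<le> 4 * \<delta> / real (cells_per_side k \<delta>))"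
  and "whp network_measure (\<lambda>\<delta> w. \<forall>b<cells_per_side k \<delta>.
    real (card {v. v < num_nodes w \<and> pos w v \<in> column_strip (cells_per_side k \<delta>) b}) \<le> 4 * \<delta> / real (cells_per_side k \<delta>))"
  by (rule whp_strip[OF assms _ emeasure_strips(1)]; simp add: row_strip_def)
    (rule whp_strip[OF assms _ emeasure_strips(2)]; simp add: column_strip_def)

lemma source_less:
  assumes "snd (fst w) permutes {..<num_nodes w}" "i < num_pairs w"
  shows "source w i < num_nodes w" "dest w i < num_nodes w"
  using assms permutes_in_image[OF assms(1)] by (auto simp: source_def dest_def num_pairs_def)

lemma inj_source_dest:
  assumes "snd (fst w) permutes {..<num_nodes w}"
  shows "inj (source w)" "inj (dest w)"
  using injD[OF permutes_inj[OF assms]] by (fastforce intro: injI simp: source_def dest_def)+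

text \<open>By \<open>path_cell_row_column\<close> each path is charged to its source in the row or
  to its destination in the column of the cell. Distinct pairs have distinct sources and distinct
  destinations, so no node is charged twice in either role.\<close>

lemma length_packets_le:
  assumes perm: "snd (fst w) permutes {..<num_nodes w}" and inside: "\<And>v. pos w v \<in> unit_square"
    and q: "q > 0" and c: "c \<in> grid q"
  shows "length (packets q w c) \<le> card {v. v < num_nodes w \<and> pos w v \<in> row_strip q (nat (snd c))}
    + card {v. v < num_nodes w \<and> pos w v \<in> column_strip q (nat (fst c))}"
proof -
  define A where "A = {v. v < num_nodes w \<and> pos w v \<in> row_strip q (nat (snd c))}"
  define B where "B = {v. v < num_nodes w \<and> pos w v \<in> column_strip q (nat (fst c))}"
  have c': "0 \<le> fst c" "0 \<le> snd c" using c by (auto simp: grid_def)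
  have sq: "fst (pos w v) \<in> {0..<1}" "snd (pos w v) \<in> {0..<1}" for v
    using inside[of v] by (simp_all add: unit_square_def mem_Times_iff)
  have row: "v \<in> A" if "v < num_nodes w" "snd (cell_of q (pos w v)) = snd c" for v
    using that sq[of v] c' mem_strip_iff[OF q, of "snd (pos w v)" "snd c"]
    by (simp add: A_def row_strip_def mem_Times_iff cell_of_def)
  have col: "v \<in> B" if "v < num_nodes w" "fst (cell_of q (pos w v)) = fst c" for v
    using that sq[of v] c' mem_strip_iff[OF q, of "fst (pos w v)" "fst c"]
    by (simp add: B_def column_strip_def mem_Times_iff cell_of_def)
  define I where "I = {i. i < num_pairs w \<and> source w i \<in> A}"
  define J where "J = {i. i < num_pairs w \<and> dest w i \<in> B}"
  have "set (packets q w c) \<subseteq> I \<union> J"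
  proof
    fix i assume "i \<in> set (packets q w c)"
    then obtain h where h: "i < num_pairs w" "path_cell q w i h = c"
      unfolding set_packets passing_def originating_def by (auto intro: path_cell_0)
    from path_cell_row_column[of q w i h] h(2)
    have "snd (source_cell q w i) = snd c \<or> fst (dest_cell q w i) = fst c" by auto
    then show "i \<in> I \<union> J"
      using h(1) row col source_less[OF perm h(1)] by (auto simp: I_def J_def source_cell_def dest_cell_def)
  qed
  moreover have fin: "finite I" "finite J" by (simp_all add: I_def J_def)
  ultimately have "card (set (packets q w c)) \<le> card (I \<union> J)" by (intro card_mono) auto
  also have "\<dots> \<le> card I + card J" by (rule card_Un_le)
  also have "card I \<le> card A"
    using inj_source_dest(1)[OF perm] by (intro card_inj_on_le[of "source w"]) (auto simp: I_def A_def inj_on_def inj_def)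
  also have "card J \<le> card B"
    using inj_source_dest(2)[OF perm] by (intro card_inj_on_le[of "dest w"]) (auto simp: J_def B_def inj_on_def inj_def)
  finally show ?thesis
    using distinct_card[OF distinct_packets[of q w c]] by (simp add: A_def B_def)
qed

lemma length_packets_ge:
  assumes q: "q > 0"
  shows "card {i. i < num_pairs w \<and> pos w (source w i) \<in> left_strip q \<and> pos w (dest w i) \<in> right_part q}
    \<le> length (packets q w (int (q div 2), int (q div 2)))"
proof -
  define k where "k = q div 2"
  have "i \<in> passing q w (int k, int k)"
    if i: "i < num_pairs w" "pos w (source w i) \<in> left_strip q" "pos w (dest w i) \<in> right_part q" for i
  proof -
    obtain xs ys xd yd where s: "source_cell q w i = (xs, ys)" "dest_cell q w i = (xd, yd)"
      by (metis surj_pair)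
    have "ys = int k"
      using i(2) mem_strip_iff[OF q, of "snd (pos w (source w i))" "int k"] s
      by (simp add: left_strip_def k_def source_cell_def cell_of_def mem_Times_iff)
    have "fst (pos w (source w i)) < real k / real q"
      using i(2) by (simp add: left_strip_def k_def mem_Times_iff)
    then have "real q * fst (pos w (source w i)) < real k" using q by (simp add: field_simps)
    then have xs: "xs < int k"
      using s(1) by (simp add: source_cell_def cell_of_def) linarith
    have "(real k + 1) / real q \<le> fst (pos w (dest w i))"
      using i(3) by (simp add: right_part_def k_def mem_Times_iff)
    then have "real k + 1 \<le> real q * fst (pos w (dest w i))" using q by (simp add: field_simps)
    then have xd: "int k < xd"
      using s(2) by (simp add: dest_cell_def cell_of_def) linarith
    \<comment> \<open>The step at which the HDP reaches the middle column. The source is strictly to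
      the left and the destination strictly to the right, so this is neither the first nor the last
      cell of the path.\<close>
    define h where "h = nat (int k - xs)"
    have "1 \<le> h" "h < path_length q w i"
      using xs xd s by (auto simp: h_def path_length_def)
    moreover have "path_cell q w i h = (int k, int k)"
      using xs xd s \<open>ys = int k\<close> by (simp add: path_cell_def h_def Let_def)
    ultimately show ?thesis
      using i(1) unfolding passing_def num_hops_def by (intro CollectI conjI exI[of _ h]) auto
  qed
  then have "{i. i < num_pairs w \<and> pos w (source w i) \<in> left_strip q \<and> pos w (dest w i) \<in> right_part q}
    \<subseteq> set (packets q w (int k, int k))" by (auto simp: set_packets)
  then have "card {i. i < num_pairs w \<and> pos w (source w i) \<in> left_strip q \<and> pos w (dest w i) \<in> right_part q}
    \<le> card (set (packets q w (int k, int k)))" by (intro card_mono) auto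
  then show ?thesis using distinct_card[OF distinct_packets[of q w "(int k, int k)"]] by (simp add: k_def)
qed

lemma center_box_central:
  assumes "q > 0" "x \<in> center_box q"
  shows "cell_of q x = (int (q div 2), int (q div 2))"
    and "frac (real q * fst x) \<in> {1/4..3/4}" "frac (real q * snd x) \<in> {1/4..3/4}"
proof -
  have "\<lfloor>real q * t\<rfloor> = int (q div 2) \<and> frac (real q * t) \<in> {1/4..3/4}"
    if "t \<in> {(real (q div 2) + 1 / 4) / real q..<(real (q div 2) + 3 / 4) / real q}" for t
  proof -
    have "real (q div 2) + 1 / 4 \<le> real q * t" "real q * t < real (q div 2) + 3 / 4"
      using that assms(1) by (simp_all add: field_simps)
    moreover from this have "\<lfloor>real q * t\<rfloor> = int (q div 2)" by linarith
    ultimately show ?thesis by (simp add: frac_def)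
  qed
  then show "cell_of q x = (int (q div 2), int (q div 2))"
    "frac (real q * fst x) \<in> {1/4..3/4}" "frac (real q * snd x) \<in> {1/4..3/4}"
    using assms(2) by (auto simp: center_box_def cell_of_def mem_Times_iff simp del: atLeastLessThan_iff atLeastAtMost_iff)
qed

lemma right_part_not_center:
  assumes "q > 0" "x \<in> right_part q"
  shows "cell_of q x \<noteq> (int (q div 2), int (q div 2))"
proof -
  have "(real (q div 2) + 1) / real q \<le> fst x" using assms by (simp add: right_part_def mem_Times_iff)
  then have "real (q div 2) + 1 \<le> real q * fst x" using assms(1) by (simp add: field_simps)
  then have "int (q div 2) < \<lfloor>real q * fst x\<rfloor>" by linarith
  then show ?thesis by (simp add: cell_of_def)
qed

subsection \<open>The throughput with high probability\<close>

text \<open>The bracketing mirrors the nested applications of \<open>whp_conj\<close> in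
  \<open>whp_good_network\<close>.\<close>

definition good_network :: "real \<Rightarrow> real \<Rightarrow> network \<Rightarrow> bool" where
  "good_network k \<delta> w \<longleftrightarrow>
    ((snd (fst w) permutes {..<num_nodes w} \<and> (\<forall>v. pos w v \<in> unit_square) \<and>
      (\<forall>i<num_pairs w. pos w (source w i) \<noteq> pos w (dest w i))) \<and>
    (\<forall>c\<in>grid (cells_per_side k \<delta>). nodes_in (cells_per_side k \<delta>) w c \<noteq> [])) \<and>
    ((\<forall>b<cells_per_side k \<delta>. real (card {v. v < num_nodes w \<and> pos w v \<in> row_strip (cells_per_side k \<delta>) b})
        \<le> 4 * \<delta> / real (cells_per_side k \<delta>)) \<and>
    (\<forall>b<cells_per_side k \<delta>. real (card {v. v < num_nodes w \<and> pos w v \<in> column_strip (cells_per_side k \<delta>) b})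
        \<le> 4 * \<delta> / real (cells_per_side k \<delta>))) \<and>
    ((\<exists>i<num_pairs w. pos w (source w i) \<in> center_box (cells_per_side k \<delta>) \<and>
        pos w (dest w i) \<in> right_part (cells_per_side k \<delta>)) \<and>
    \<delta> / (128 * real (cells_per_side k \<delta>)) \<le> real (card {i. i < num_pairs w \<and>
        pos w (source w i) \<in> left_strip (cells_per_side k \<delta>) \<and> pos w (dest w i) \<in> right_part (cells_per_side k \<delta>)})) \<and>
    (\<delta> / 4 \<le> real (num_nodes w) \<and> real (num_nodes w) \<le> 2 * \<delta>)"

lemma whp_good_network:
  assumes "k \<ge> 1"
  shows "whp network_measure (good_network k)"
proof -
  have typical: "whp network_measure (\<lambda>\<delta> w. snd (fst w) permutes {..<num_nodes w} \<and> (\<forall>v. pos w v \<in> unit_square) \<and>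
      (\<forall>i<num_pairs w. pos w (source w i) \<noteq> pos w (dest w i)))"
  proof (rule whp_AE[OF prob_space_network], rule always_eventually, rule allI)
    show "AE w in network_measure \<delta>. snd (fst w) permutes {..<num_nodes w} \<and> (\<forall>v. pos w v \<in> unit_square) \<and>
      (\<forall>i<num_pairs w. pos w (source w i) \<noteq> pos w (dest w i))" for \<delta>
      using AE_permutes[of \<delta>] AE_inside[of \<delta>] AE_separated[of \<delta>] by eventually_elim blast
  qed
  note conj = whp_conj[OF prob_space_network]
  show ?thesis
    unfolding good_network_def[abs_def]
    by (rule conj[OF conj[OF typical whp_occupied[OF assms]] conj[OF conj[OF whp_strips[OF assms]]
      conj[OF conj[OF whp_central_source[OF assms] whp_center_load[OF assms]] whp_num_nodes]]])
qed

lemma throughput_bounds: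
  assumes params: "\<alpha> > 2" "N0 > 0" "P0 > 0" "P1 > 0" "tp > 0"
    and qp: "0 < qp" "2 * qp \<le> qs" and qs: "qs = cells_per_side k m" "4 \<le> qs" and m: "0 < m"
    and prim: "\<And>c. c \<in> grid qp \<Longrightarrow> nodes_in qp wp c \<noteq> []"
    and sec: "good_network k m ws"
  shows "ereal (min_rate \<alpha> N0 P0 P1 * tp / 125000 * (real qs / m))
      \<le> overlay.throughput_per_pair \<alpha> N0 P0 P1 tp qp qs wp ws"
    and "overlay.throughput_per_pair \<alpha> N0 P0 P1 tp qp qs wp ws
      \<le> ereal (max_rate \<alpha> N0 P1 * tp * 6 * (real qs / m))"
proof -
  note good = sec[unfolded good_network_def qs(1)[symmetric]]
  have perm: "snd (fst ws) permutes {..<num_nodes ws}" and in_square: "\<And>v. pos ws v \<in> unit_square"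
    using good by blast+
  interpret regular_overlay \<alpha> N0 P0 P1 tp qp qs wp ws
    by unfold_locales (use assms good in auto)
  have "real (length (packets qs ws c)) \<le> 8 * m / real qs" if "c \<in> grid qs" for c
  proof -
    have "nat (fst c) < qs" "nat (snd c) < qs" using that by (auto simp: grid_def)
    then have "real (card {v. v < num_nodes ws \<and> pos ws v \<in> row_strip qs (nat (snd c))}) \<le> 4 * m / real qs"
      "real (card {v. v < num_nodes ws \<and> pos ws v \<in> column_strip qs (nat (fst c))}) \<le> 4 * m / real qs"
      using good by blast+
    then show ?thesis using length_packets_le[OF perm in_square qs_pos that] by linarith
  qed
  from throughput_ge[OF this]
  have "ereal (min_rate \<alpha> N0 P0 P1 * ts / (8 * m / real qs) / 625) \<le> throughput_per_pair" .
  \<comment> \<open>\<open>125000 = 25 * 8 * 625\<close>: the slot length \<open>tp / 25\<close>,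
    the load \<open>8 * m / qs\<close> from one row and one column, and the period.\<close>
  then show "ereal (min_rate \<alpha> N0 P0 P1 * tp / 125000 * (real qs / m)) \<le> throughput_per_pair"
    by (simp add: ts_def)
  obtain i where i: "i < num_pairs ws" "pos ws (source ws i) \<in> center_box qs" "pos ws (dest ws i) \<in> right_part qs"
    using good by blast
  have src: "source_cell qs ws i = (int (qs div 2), int (qs div 2))"
    unfolding source_cell_def by (rule center_box_central[OF qs_pos i(2)])
  have "throughput_per_pair \<le> ereal (max_rate \<alpha> N0 P1 * ts / (m / (128 * real qs)))"
  proof (rule throughput_le[OF i(1)])
    show "source_cell qs ws i \<noteq> dest_cell qs ws i"
      using right_part_not_center[OF qs_pos i(3)] src by (simp add: dest_cell_def)
    show "1 / (4 * real qs) \<le> dist (pos ws (source ws i)) z" if "cell_of qs z \<noteq> source_cell qs ws i" for z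
      using that unfolding source_cell_def by (intro central_far center_box_central[OF qs_pos i(2)] qs_pos)
    show "0 < m / (128 * real qs)" using m qs_pos by simp
    show "m / (128 * real qs) \<le> real (length (packets qs ws (source_cell qs ws i)))"
      unfolding src using good length_packets_ge[OF qs_pos, of ws] by linarith
  qed
  \<comment> \<open>The slot length and the load give \<open>128 / 25\<close>, rounded up to
    6.\<close>
  also have "\<dots> \<le> ereal (max_rate \<alpha> N0 P1 * tp * 6 * (real qs / m))"
    using max_rate_nonneg tp m
    by (simp add: ts_def field_simps mult_right_mono)
  finally show "throughput_per_pair \<le> ereal (max_rate \<alpha> N0 P1 * tp * 6 * (real qs / m))" .
qed

text \<open>The expected ratio of the squared numbers of cells is
  \<open>n powr (\<beta> - 1) / \<beta>\<close>, which tends to infinity. Once it is at least 16 the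
  sides differ by a factor 4, of which rounding leaves at least 2.\<close>

lemma eventually_cells_ratio:
  assumes "\<beta> > 1" "k \<ge> 1"
  shows "\<forall>\<^sub>F n in at_top. 0 < cells_per_side k n \<and> 2 * cells_per_side k n \<le> cells_per_side k (n powr \<beta>)"
proof -
  have m: "filterlim (\<lambda>n::real. n powr \<beta>) at_top at_top" using assms by real_asymp
  have "filterlim (\<lambda>n::real. n powr (\<beta> - 1)) at_top at_top" using assms by real_asymp
  then have "\<forall>\<^sub>F n::real in at_top. 16 * \<beta> \<le> n powr (\<beta> - 1)" by (simp add: filterlim_at_top)
  with eventually_cells_per_side[OF assms(2)]
    eventually_compose_filterlim[OF eventually_cells_per_side[OF assms(2)] m] eventually_gt_at_top[of 0]
  show ?thesis
  proof eventually_elim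
    case (elim n)
    define x where "x = n / (k * ln n)"
    have ln: "0 < ln n" using elim(1) by linarith
    have m: "n powr \<beta> / (k * ln (n powr \<beta>)) = n powr (\<beta> - 1) / \<beta> * x"
      using elim(3) assms ln by (simp add: x_def ln_powr powr_diff)
    have "16 * x \<le> n powr (\<beta> - 1) / \<beta> * x"
      using elim(3,4) assms ln by (intro mult_right_mono) (auto simp: x_def field_simps)
    then have "sqrt (16 * x) \<le> sqrt (n powr \<beta> / (k * ln (n powr \<beta>)))" unfolding m by (rule real_sqrt_le_mono)
    then have "4 * sqrt x \<le> sqrt (n powr \<beta> / (k * ln (n powr \<beta>)))" by (simp add: real_sqrt_mult)
    moreover have "real (cells_per_side k n) \<le> sqrt x" using elim(1) by (simp add: x_def)
    ultimately have "2 * real (cells_per_side k n) \<le> real (cells_per_side k (n powr \<beta>))"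
      using elim(2) by linarith
    then show ?case using elim(1) by linarith
  qed
qed

theorem theorem5:
  fixes \<alpha> \<beta> k1 k2 N0 P0 P1 tp :: real
  assumes "\<alpha> > 2" and "\<beta> > 1" and "k1 \<ge> 1" and "k2 = k1"
    and "N0 > 0" and "P0 > 0" and "P1 > 0" and "tp > 0"
  shows "theta_whp (\<lambda>n. overlay_measure n (n powr \<beta>))
           (\<lambda>n. lambda_s \<alpha> N0 P0 P1 tp k1 k2 n (n powr \<beta>))
           (\<lambda>n. let m = n powr \<beta> in sqrt (1 / (m * ln m))) \<and>
         theta_whp (\<lambda>n. overlay_measure n (n powr \<beta>))
           (\<lambda>n. T_s \<alpha> N0 P0 P1 tp k1 k2 n (n powr \<beta>))
           (\<lambda>n. let m = n powr \<beta> in sqrt (m / ln m))"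
proof -
  define M where "M n = overlay_measure n (n powr \<beta>)" for n
  define f where "f m = sqrt (1 / (m * ln m))" for m :: real
  define c1 where "c1 = max_rate \<alpha> N0 P1 * tp * 6"
  \<comment> \<open>The additional \<open>2 * sqrt k1\<close> is lost from \<open>f m\<close> to
    \<open>q / m\<close>, through rounding and the constant in the cell area. No such factor appears
    in \<open>c1\<close>, since \<open>q / m \<le> f m\<close> when
    \<open>k1 \<ge> 1\<close>.\<close>
  define c2 where "c2 = min_rate \<alpha> N0 P0 P1 * tp / 125000 / (2 * sqrt k1)"
  define thr where "thr n = lambda_s \<alpha> N0 P0 P1 tp k1 k2 n (n powr \<beta>)" for n
  have c: "0 < c1" "0 < c2"
    using assms max_rate_pos[of N0 P1 \<alpha>] min_rate_pos[of N0 P0 P1 \<alpha>] by (simp_all add: c1_def c2_def)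
  have m: "filterlim (\<lambda>n::real. n powr \<beta>) at_top at_top" using assms by real_asymp
  have "whp M (\<lambda>n \<omega>. (\<forall>c\<in>grid (cells_per_side k1 n). nodes_in (cells_per_side k1 n) (fst \<omega>) c \<noteq> []) \<and>
      good_network k1 (n powr \<beta>) (snd \<omega>))"
  proof (rule whp_conj)
    show "prob_space (M n)" for n
    proof -
      interpret A: prob_space "network_measure n" by (rule prob_space_network)
      interpret B: prob_space "network_measure (n powr \<beta>)" by (rule prob_space_network)
      interpret pair_prob_space "network_measure n" "network_measure (n powr \<beta>)" ..
      show ?thesis unfolding M_def overlay_measure_def by unfold_locales
    qed
    show "whp M (\<lambda>n \<omega>. \<forall>c\<in>grid (cells_per_side k1 n). nodes_in (cells_per_side k1 n) (fst \<omega>) c \<noteq> [])"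
      unfolding M_def overlay_measure_def
      by (rule whp_fst[OF prob_space_network prob_space_network whp_occupied[OF assms(3)]])
    show "whp M (\<lambda>n \<omega>. good_network k1 (n powr \<beta>) (snd \<omega>))"
      unfolding M_def overlay_measure_def
      by (rule whp_snd[OF prob_space_network prob_space_network
            whp_compose[OF whp_good_network[OF assms(3)] m]])
  qed
  \<comment> \<open>The bounds on the number of nodes are kept in the same event, so that the sum
    throughput follows without a further probabilistic argument.\<close>
  then have *: "whp M (\<lambda>n \<omega>. ereal (c2 * f (n powr \<beta>)) \<le> thr n \<omega> \<and> thr n \<omega> \<le> ereal (c1 * f (n powr \<beta>)) \<and>
      n powr \<beta> / 4 \<le> real (num_nodes (snd \<omega>)) \<and> real (num_nodes (snd \<omega>)) \<le> 2 * n powr \<beta>)"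
  proof (rule whp_mono)
    show "\<forall>\<^sub>F n in at_top. \<forall>\<omega>\<in>space (M n).
        (\<forall>c\<in>grid (cells_per_side k1 n). nodes_in (cells_per_side k1 n) (fst \<omega>) c \<noteq> []) \<and>
          good_network k1 (n powr \<beta>) (snd \<omega>) \<longrightarrow>
        ereal (c2 * f (n powr \<beta>)) \<le> thr n \<omega> \<and> thr n \<omega> \<le> ereal (c1 * f (n powr \<beta>)) \<and>
          n powr \<beta> / 4 \<le> real (num_nodes (snd \<omega>)) \<and> real (num_nodes (snd \<omega>)) \<le> 2 * n powr \<beta>"
      using eventually_cells_ratio[OF assms(2,3)]
        eventually_compose_filterlim[OF eventually_cells_per_side[OF assms(3)] m] eventually_gt_at_top[of 0]
    proof eventually_elim
      case (elim n)
      define m where "m = n powr \<beta>"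
      define q where "q = cells_per_side k1 m"
      have m: "0 < m" "0 < ln m" using elim(2,3) by (simp_all add: m_def)
      have q: "4 \<le> q" "real q \<le> sqrt (m / (k1 * ln m))" "sqrt (m / (k1 * ln m)) / 2 \<le> real q"
        using elim(2) by (simp_all add: m_def q_def)
      have f: "sqrt (m / (k1 * ln m)) / m = f m / sqrt k1"
      proof -
        have "m / (k1 * ln m) = m\<^sup>2 * (1 / (m * ln m)) / k1"
          using m by (simp add: power2_eq_square)
        then have "sqrt (m / (k1 * ln m)) = m * f m / sqrt k1"
          using m by (simp only: real_sqrt_divide real_sqrt_mult f_def) simp
        then show ?thesis using m by simp
      qed
      have "f m / sqrt k1 \<le> f m / 1"
        using assms(3) m by (intro divide_left_mono) (auto simp: f_def)
      then have qm: "real q / m \<le> f m" "f m / (2 * sqrt k1) \<le> real q / m"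
        using divide_right_mono[OF q(2), of m] divide_right_mono[OF q(3), of m] m f by (simp_all add: mult.commute)
      show ?case
      proof (intro ballI impI)
        fix \<omega> assume good: "(\<forall>c\<in>grid (cells_per_side k1 n). nodes_in (cells_per_side k1 n) (fst \<omega>) c \<noteq> []) \<and>
          good_network k1 (n powr \<beta>) (snd \<omega>)"
        have qp: "0 < cells_per_side k1 n" "2 * cells_per_side k1 n \<le> q" using elim(1) by (simp_all add: q_def m_def)
        have thr: "thr n \<omega> = overlay.throughput_per_pair \<alpha> N0 P0 P1 tp (cells_per_side k1 n) q (fst \<omega>) (snd \<omega>)"
          using assms(4) by (simp add: thr_def lambda_s_def q_def m_def)
        have occ: "\<And>c. c \<in> grid (cells_per_side k1 n) \<Longrightarrow> nodes_in (cells_per_side k1 n) (fst \<omega>) c \<noteq> []"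
          and gd: "good_network k1 m (snd \<omega>)"
          using good by (simp_all add: m_def)
        have b: "ereal (min_rate \<alpha> N0 P0 P1 * tp / 125000 * (real q / m)) \<le> thr n \<omega>"
          "thr n \<omega> \<le> ereal (max_rate \<alpha> N0 P1 * tp * 6 * (real q / m))"
          unfolding thr by (rule throughput_bounds[OF assms(1,5-8) qp q_def q(1) m(1) occ gd], assumption)+
        have "min_rate \<alpha> N0 P0 P1 * tp / 125000 * (f m / (2 * sqrt k1))
            \<le> min_rate \<alpha> N0 P0 P1 * tp / 125000 * (real q / m)"
          using qm assms min_rate_pos[of N0 P0 P1 \<alpha>] by (intro mult_left_mono) auto
        then have "ereal (c2 * f m) \<le> thr n \<omega>"
          using b(1) by (intro order_trans[OF _ b(1)]) (simp add: c2_def)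
        moreover have "max_rate \<alpha> N0 P1 * tp * 6 * (real q / m) \<le> max_rate \<alpha> N0 P1 * tp * 6 * f m"
          using qm assms max_rate_pos[of N0 P1 \<alpha>] by (intro mult_left_mono) auto
        then have "thr n \<omega> \<le> ereal (c1 * f m)"
          by (intro order_trans[OF b(2)]) (simp add: c1_def)
        moreover have "n powr \<beta> / 4 \<le> real (num_nodes (snd \<omega>))" "real (num_nodes (snd \<omega>)) \<le> 2 * n powr \<beta>"
          using good by (auto simp: good_network_def)
        ultimately show "ereal (c2 * f (n powr \<beta>)) \<le> thr n \<omega> \<and> thr n \<omega> \<le> ereal (c1 * f (n powr \<beta>)) \<and>
          n powr \<beta> / 4 \<le> real (num_nodes (snd \<omega>)) \<and> real (num_nodes (snd \<omega>)) \<le> 2 * n powr \<beta>"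
          by (simp add: m_def)
      qed
    qed
  qed
  have "theta_whp M thr (\<lambda>n. let m = n powr \<beta> in sqrt (1 / (m * ln m)))"
    unfolding theta_whp_def Let_def
    using c(2) whp_mono[OF *] by (intro exI[of _ c1] exI[of _ c2]) (auto simp: f_def)
  moreover have "theta_whp M (\<lambda>n. T_s \<alpha> N0 P0 P1 tp k1 k2 n (n powr \<beta>)) (\<lambda>n. let m = n powr \<beta> in sqrt (m / ln m))"
    unfolding theta_whp_def Let_def
  proof (intro exI conjI)
    \<comment> \<open>The sum throughput is \<open>N / 2\<close> times the throughput per pair. From
      \<open>N \<ge> m / 4\<close> the factor is at least \<open>m / 8\<close>, and from
      \<open>N \<le> 2 * m\<close> it is at most \<open>m\<close>, so \<open>c1\<close> can
      stay.\<close>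
    show "0 < c2 / 8" using c by simp
    show "whp M (\<lambda>n \<omega>. ereal (c2 / 8 * sqrt (n powr \<beta> / ln (n powr \<beta>))) \<le> T_s \<alpha> N0 P0 P1 tp k1 k2 n (n powr \<beta>) \<omega> \<and>
        T_s \<alpha> N0 P0 P1 tp k1 k2 n (n powr \<beta>) \<omega> \<le> ereal (c1 * sqrt (n powr \<beta> / ln (n powr \<beta>))))"
    proof (rule whp_mono[OF *], use eventually_gt_at_top[of 1] in eventually_elim, intro ballI impI)
      fix n :: real and \<omega> :: "network \<times> network" assume n: "1 < n"
      define m where "m = n powr \<beta>"
      define N where "N = real (num_nodes (snd \<omega>))"
      assume "ereal (c2 * f (n powr \<beta>)) \<le> thr n \<omega> \<and> thr n \<omega> \<le> ereal (c1 * f (n powr \<beta>)) \<and>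
          n powr \<beta> / 4 \<le> real (num_nodes (snd \<omega>)) \<and> real (num_nodes (snd \<omega>)) \<le> 2 * n powr \<beta>"
      then have b: "ereal (c2 * f m) \<le> thr n \<omega>" "thr n \<omega> \<le> ereal (c1 * f m)" "m / 4 \<le> N" "N \<le> 2 * m"
        by (simp_all add: m_def N_def)
      have m: "0 < m" "0 < ln m" using n assms(2) by (simp_all add: m_def ln_powr)
      have f: "m * f m = sqrt (m / ln m)" "0 \<le> f m"
      proof -
        have "m / ln m = m\<^sup>2 * (1 / (m * ln m))"
          using m by (simp add: power2_eq_square)
        then show "m * f m = sqrt (m / ln m)"
          using m by (simp only: real_sqrt_mult f_def) simp
        show "0 \<le> f m" using m by (simp add: f_def)
      qed
      have T: "T_s \<alpha> N0 P0 P1 tp k1 k2 n m \<omega> = ereal (N / 2) * thr n \<omega>"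
        by (simp add: T_s_def overlay.sum_throughput_def thr_def lambda_s_def m_def N_def)
      have "c2 / 8 * sqrt (m / ln m) = m / 8 * (c2 * f m)" by (simp add: f(1)[symmetric])
      also have "\<dots> \<le> N / 2 * (c2 * f m)"
        using b(3) c f(2) by (intro mult_right_mono) auto
      finally have "ereal (c2 / 8 * sqrt (m / ln m)) \<le> ereal (N / 2) * ereal (c2 * f m)" by simp
      also have "\<dots> \<le> ereal (N / 2) * thr n \<omega>"
        using b(1) by (intro ereal_mult_left_mono) (auto simp: N_def)
      finally have 1: "ereal (c2 / 8 * sqrt (m / ln m)) \<le> T_s \<alpha> N0 P0 P1 tp k1 k2 n m \<omega>" by (simp only: T)
      have "ereal (N / 2) * thr n \<omega> \<le> ereal (N / 2) * ereal (c1 * f m)"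
        using b(2) by (intro ereal_mult_left_mono) (auto simp: N_def)
      also have "\<dots> \<le> ereal (m * (c1 * f m))"
      proof -
        have "N / 2 * (c1 * f m) \<le> m * (c1 * f m)"
          using b(4) c f(2) by (intro mult_right_mono) auto
        then show ?thesis by simp
      qed
      also have "m * (c1 * f m) = c1 * sqrt (m / ln m)" by (simp add: f(1)[symmetric])
      finally have "T_s \<alpha> N0 P0 P1 tp k1 k2 n m \<omega> \<le> ereal (c1 * sqrt (m / ln m))" by (simp only: T)
      with 1 show "ereal (c2 / 8 * sqrt (n powr \<beta> / ln (n powr \<beta>))) \<le> T_s \<alpha> N0 P0 P1 tp k1 k2 n (n powr \<beta>) \<omega> \<and>
        T_s \<alpha> N0 P0 P1 tp k1 k2 n (n powr \<beta>) \<omega> \<le> ereal (c1 * sqrt (n powr \<beta> / ln (n powr \<beta>)))"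
        unfolding m_def by blast
    qed
  qed
  ultimately show ?thesis unfolding M_def thr_def by simp
qed

end
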